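(* For every integer $r\geq 4$, let $k=\lceil r/e\rceil$. Then for every sufficiently large $n$, $\mathrm{ex}(n,\mathcal{F}_{r,k})=|E(T^r(n))|$, and $T^r(n)$ is the unique (up to isomorphism) $\mathcal{F}_{r,k}$-free $r$-uniform hypergraph on $n$ vertices with this many edges.
   Context: For a family $\mathcal{F}$ of $r$-uniform hypergraphs, an $r$-uniform hypergraph is $\mathcal{F}$-free if it contains no member of $\mathcal{F}$ as a subgraph; $\mathrm{ex}(n,\mathcal{F})$ is the maximum number of edges in an $\mathcal{F}$-free $r$-uniform hypergraph on $n$ vertices. $T^r(n)$ denotes the balanced complete $r$-partite $r$-uniform hypergraph on $n$ vertices (vertex set split into $r$ parts of sizes differing by at most one, edges are all $r$-sets meeting every part in exactly one vertex). For $1\leq i\leq\lfloor r/2\rfloor$, the $(r-i,i)$-tent $\Delta_{(r-i,i)}$ is the $r$-uniform hypergraph with vertex set $\{1,\dots,2r-1\}$ and the three edges $\{1,2,\ldots,r\}$, $\{1,\ldots,i,r+1,\ldots,2r-i-1,2r-1\}$, $\{i+1,\ldots,r,2r-i,\ldots,2r-1\}$. For $1\leq k\leq\lfloor r/2\rfloor$, $\mathcal{F}_{r,k}=\{\Delta_{(r-i,i)}: 1\leq i\leq k\}$. *)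

theory Defs
  imports Complex_Main
begin

type_synonym 'a hypergraph = "'a set \<times> 'a set set"

abbreviation verts :: "'a hypergraph \<Rightarrow> 'a set" where
  "verts \<equiv> fst"

abbreviation hedges :: "'a hypergraph \<Rightarrow> 'a set set" where
  "hedges \<equiv> snd"

definition uniform_hypergraph :: "nat \<Rightarrow> 'a hypergraph \<Rightarrow> bool" where
  "uniform_hypergraph r H \<longleftrightarrow>
     finite (verts H) \<and> (\<forall>e\<in>hedges H. e \<subseteq> verts H \<and> card e = r)"

text \<open>Containment as a not necessarily induced subgraph, up to isomorphism.\<close>

definition contains_copy :: "'a hypergraph \<Rightarrow> 'b hypergraph \<Rightarrow> bool" where
  "contains_copy H F \<longleftrightarrow>
     (\<exists>f. inj_on f (verts F) \<and> f ` verts F \<subseteq> verts H \<and> (\<forall>e\<in>hedges F. f ` e \<in> hedges H))"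

definition family_free :: "'b hypergraph set \<Rightarrow> 'a hypergraph \<Rightarrow> bool" where
  "family_free \<F> H \<longleftrightarrow> (\<forall>F\<in>\<F>. \<not> contains_copy H F)"

definition hypergraph_iso :: "'a hypergraph \<Rightarrow> 'b hypergraph \<Rightarrow> bool" where
  "hypergraph_iso G H \<longleftrightarrow>
     (\<exists>f. bij_betw f (verts G) (verts H) \<and> (\<lambda>e. f ` e) ` hedges G = hedges H)"

text \<open>Every finite hypergraph is isomorphic to one whose vertices are natural numbers, so it
  suffices to let host hypergraphs range over the type \<^typ>\<open>nat hypergraph\<close>.\<close>

definition free_hypergraphs :: "nat \<Rightarrow> nat \<Rightarrow> 'b hypergraph set \<Rightarrow> nat hypergraph set" where
  "free_hypergraphs r n \<F> =
     {H. uniform_hypergraph r H \<and> card (verts H) = n \<and> family_free \<F> H}"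

definition ex_number :: "nat \<Rightarrow> nat \<Rightarrow> 'b hypergraph set \<Rightarrow> nat" where
  "ex_number r n \<F> = Max ((\<lambda>H. card (hedges H)) ` free_hypergraphs r n \<F>)"

lemma finite_free_hypergraph_sizes:
  "finite ((\<lambda>H. card (hedges H)) ` free_hypergraphs r n \<F>)"
proof (rule finite_subset)
  show "(\<lambda>H. card (hedges H)) ` free_hypergraphs r n \<F> \<subseteq> {..n choose r}"
  proof clarsimp
    fix V :: "nat set" and E assume "(V, E) \<in> free_hypergraphs r n \<F>"
    then have V: "finite V" "card V = n" and E: "E \<subseteq> {e. e \<subseteq> V \<and> card e = r}"
      by (auto simp: free_hypergraphs_def uniform_hypergraph_def)
    have "card E \<le> card {e. e \<subseteq> V \<and> card e = r}"
      using V E by (intro card_mono) auto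
    then show "card E \<le> n choose r"
      using V by (simp add: n_subsets)
  qed
qed simp

text \<open>The vertices \<open>0, \<dots>, n - 1\<close> are split into the residue classes modulo \<open>r\<close>; these parts are
  balanced by \<open>turan_part_balanced\<close>.\<close>

definition turan_part :: "nat \<Rightarrow> nat \<Rightarrow> nat \<Rightarrow> nat set" where
  "turan_part r n j = {v. v < n \<and> v mod r = j}"

definition turan_hypergraph :: "nat \<Rightarrow> nat \<Rightarrow> nat hypergraph" where
  "turan_hypergraph r n =
     ({..<n}, {e. e \<subseteq> {..<n} \<and> card e = r \<and> (\<forall>j<r. card (e \<inter> turan_part r n j) = 1)})"

lemma turan_part_Union: "0 < r \<Longrightarrow> (\<Union>j<r. turan_part r n j) = {..<n}"
  by (auto simp: turan_part_def)

lemma turan_part_disjoint: "i \<noteq> j \<Longrightarrow> turan_part r n i \<inter> turan_part r n j = {}"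
  by (auto simp: turan_part_def)

lemma card_turan_part:
  assumes "j < r"
  shows "card (turan_part r n j) = n div r + (if j < n mod r then 1 else 0)"
proof (induction n)
  case 0
  then show ?case by (simp add: turan_part_def)
next
  case (Suc n)
  have "finite (turan_part r n j)" "n \<notin> turan_part r n j"
    by (auto simp: turan_part_def)
  moreover have "turan_part r (Suc n) j =
      (if n mod r = j then insert n (turan_part r n j) else turan_part r n j)"
    by (auto simp: turan_part_def less_Suc_eq)
  ultimately have "card (turan_part r (Suc n) j) =
      card (turan_part r n j) + (if n mod r = j then 1 else 0)"
    by simp
  with Suc.IH assms show ?case
    by (auto simp: mod_Suc div_Suc)
qed

lemma turan_part_balanced:
  "i < r \<Longrightarrow> j < r \<Longrightarrow> card (turan_part r n i) \<le> card (turan_part r n j) + 1"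
  by (simp add: card_turan_part)

text \<open>The tent \<open>\<Delta>\<close> of type \<open>(r - i, i)\<close>, meaningful for \<open>1 \<le> i \<le> r div 2\<close>.\<close>

definition tent :: "nat \<Rightarrow> nat \<Rightarrow> nat hypergraph" where
  "tent r i =
     ({1..2 * r - 1},
      {{1..r},
       {1..i} \<union> {r + 1..2 * r - i - 1} \<union> {2 * r - 1},
       {i + 1..r} \<union> {2 * r - i..2 * r - 1}})"

lemma uniform_tent:
  assumes "1 \<le> i" "i \<le> r div 2"
  shows "uniform_hypergraph r (tent r i)"
proof -
  have "card ({1..i} \<union> {r + 1..2 * r - i - 1} \<union> {2 * r - 1}) = r"
    using assms by (subst card_Un_disjoint; (subst card_Un_disjoint)?; auto)
  moreover have "card ({i + 1..r} \<union> {2 * r - i..2 * r - 1}) = r"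
    using assms by (subst card_Un_disjoint) auto
  ultimately show ?thesis
    using assms by (auto simp: uniform_hypergraph_def tent_def)
qed

definition tent_family :: "nat \<Rightarrow> nat \<Rightarrow> nat hypergraph set" where
  "tent_family r k = tent r ` {1..k}"

end

theory Submission
  imports Defs "HOL-Combinatorics.Permutations" "HOL-Library.FuncSet"
begin

text \<open>Deleting \<open>O(n\<^sup>r\<^sup>-\<^sup>1)\<close> edges from a tent-free hypergraph destroys all homomorphic images of the tents.
  For the resulting hypergraph let \<open>x\<^sub>i\<close> be the exponential of \<open>h\<^sub>r\<^sub>-\<^sub>i - h\<^sub>0\<close>, where \<open>h\<^sub>j\<close> is the entropy of a
  vertex of a uniformly random ordered edge given \<open>j\<close> other vertices of the edge. The forbidden
  configurations give \<open>x\<^sub>i + x\<^sub>j \<le> x\<^sub>i\<^sub>+\<^sub>j\<close> for \<open>i \<le> k\<close>. As \<open>k \<ge> r / e\<close>, the sum of \<open>1 / i\<close> over \<open>k < i \<le> r\<close> is at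
  most \<open>1\<close>, which implies that \<open>x\<^sub>i / i\<close> summed over \<open>i \<le> r\<close> is at most \<open>x\<^sub>r = 1\<close>; by the inequality of
  arithmetic and geometric means the product of the \<open>x\<^sub>i\<close> is at most \<open>r! / r\<^sup>r\<close>, which bounds the edge
  density. If this bound is nearly attained, then some edge has the property that the sets of vertices
  replacing its individual vertices nearly partition the vertex set into \<open>r\<close> equal parts, and no edge
  meets such a set twice. When all degrees are large, using the first tent once more this partition can
  be corrected to one of the whole vertex set in which every edge is a transversal. Deleting vertices
  of small degree reduces the general case to this one.\<close>

section \<open>Inequalities for superadditive sequences\<close>

text \<open>Only tents with i \<le> k are forbidden, so two indices above k cannot be combined in
  x_i + x_j \<le> x_(i+j). The price for this is the harmonic tail, bounded by ln (r / k); this is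
  where e comes from. In the balanced complete r-partite hypergraph with r dividing n, x_i = i / r,
  so all numbers r x_i / i equal 1: the equality case of both the sum bound and the product bound.
  Near equality, only i = 1 is exploited: x_1 close to 1 / r and exp h_0 close to n say that the
  last vertex of an edge, given the others, has about n / r choices in the geometric mean. Averaging
  logarithms over all positions yields one edge whose r replacement sets have a large product; the
  first tent makes them disjoint, so their sizes add up to at most n and each is close to n / r.
  This structure concerns the thinned hypergraph, and some vertices may lie in no part. In the
  original hypergraph each vertex is therefore coloured by the part that its link misses; the degree
  bound makes links so large that two of the same colour share many sets.\<close>

lemma exp_mean_ln_le_mean:
  fixes y :: "'a \<Rightarrow> real"
  assumes "finite S" "S \<noteq> {}" "\<And>s. s \<in> S \<Longrightarrow> y s > 0"
  shows "card S * exp ((\<Sum>s\<in>S. ln (y s)) / card S) \<le> sum y S"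
proof -
  define m where "m = (\<Sum>s\<in>S. ln (y s)) / card S"
  have c: "real (card S) > 0" using assms by (simp add: card_gt_0_iff)
  have "y s \<ge> exp m * (1 + ln (y s) - m)" if "s \<in> S" for s
  proof -
    have "ln (y s / exp m) \<le> y s / exp m - 1"
      using assms(3)[OF that] by (intro ln_le_minus_one) simp
    then have "ln (y s) - m \<le> y s / exp m - 1"
      using assms(3)[OF that] by (simp add: ln_div)
    then show ?thesis by (simp add: field_simps)
  qed
  then have "(\<Sum>s\<in>S. exp m * (1 + ln (y s) - m)) \<le> sum y S"
    by (rule sum_mono)
  also have "(\<Sum>s\<in>S. exp m * (1 + ln (y s) - m)) = exp m * (card S + card S * m - card S * m)"
    using c by (simp add: sum_distrib_left[symmetric] sum.distrib sum_subtractf m_def)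
  finally show ?thesis by (simp add: m_def mult.commute)
qed

lemma prod_le_one_of_sum_le:
  fixes t :: "'a \<Rightarrow> real"
  assumes "finite S" "\<And>s. s \<in> S \<Longrightarrow> t s \<ge> 0" "sum t S \<le> card S"
  shows "prod t S \<le> 1"
proof -
  have "prod t S \<le> (\<Prod>s\<in>S. exp (t s - 1))"
    using assms(2) by (intro prod_mono) (smt (verit) exp_ge_add_one_self)
  also have "\<dots> = exp (\<Sum>s\<in>S. t s - 1)" using assms(1) by (simp add: exp_sum)
  also have "\<dots> \<le> 1" using assms by (simp add: sum_subtractf)
  finally show ?thesis .
qed

text \<open>Stability for arithmetic and geometric means: a factor \<open>1 - s\<close> leaves the
  others a product of at most \<open>exp s\<close>, and
  \<open>(1 - s) * exp s \<le> 1 - s^2 / 2\<close>, so the deficit is at least quadratic in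
  \<open>s\<close>. It is applied to entropies and again to part sizes.\<close>

lemma factor_ge_of_prod_ge:
  fixes t :: "'a \<Rightarrow> real"
  assumes "finite S" "\<And>s. s \<in> S \<Longrightarrow> t s \<ge> 0" "sum t S \<le> card S"
    and "prod t S \<ge> 1 - \<epsilon>" "a \<in> S" "\<epsilon> \<ge> 0"
  shows "t a \<ge> 1 - sqrt (2 * \<epsilon>)"
proof (cases "t a \<ge> 1")
  case True
  then show ?thesis using assms(6) by (smt (verit) real_sqrt_ge_zero)
next
  case False
  define s where "s = 1 - t a"
  have s: "0 < s" "s \<le> 1" using False assms(2,5) by (auto simp: s_def)
  have "prod t (S - {a}) \<le> (\<Prod>s\<in>S - {a}. exp (t s - 1))"
    using assms(2) by (intro prod_mono) (smt (verit) exp_ge_add_one_self Diff_iff)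
  also have "\<dots> = exp (\<Sum>s\<in>S - {a}. t s - 1)" using assms(1) by (simp add: exp_sum)
  also have "(\<Sum>s\<in>S - {a}. t s - 1) = sum t S - card S + s"
    using sum.remove[OF assms(1,5), of "\<lambda>s. t s - 1"] assms(1) by (simp add: sum_subtractf s_def)
  finally have "prod t (S - {a}) \<le> exp s" using assms(3) 
    by (smt (verit) exp_le_cancel_iff)
  then have "t a * prod t (S - {a}) \<le> (1 - s) * exp s"
    using s by (simp add: s_def mult_left_mono)
  then have 1: "1 - \<epsilon> \<le> (1 - s) * exp s"
    using assms by (simp add: prod.remove[OF assms(1,5)])
  have "(1 - s) * exp s \<le> 1 - s^2 / 2"
  proof -
    have "\<exists>y. ((\<lambda>u. (1 - u) * exp u + u^2 / 2) has_real_derivative y) (at u) \<and> y \<le> 0"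
      if "0 \<le> u" "u \<le> s" for u
    proof -
      have "((\<lambda>u. (1 - u) * exp u + u^2 / 2) has_real_derivative (u - u * exp u)) (at u)"
        by (auto intro!: derivative_eq_intros simp: algebra_simps)
      moreover have "u - u * exp u \<le> 0" using that by (simp add: mult_le_cancel_left1)
      ultimately show ?thesis by blast
    qed
    from DERIV_nonpos_imp_nonincreasing[of 0 s "\<lambda>u. (1 - u) * exp u + u^2 / 2", OF _ this] s
    show ?thesis by simp
  qed
  with 1 have "s^2 \<le> 2 * \<epsilon>" by linarith
  then have "s \<le> sqrt (2 * \<epsilon>)" by (rule real_le_rsqrt)
  then show ?thesis by (simp add: s_def)
qed

text \<open>With \<open>s\<close> the partial sum and \<open>y\<close> the next term, the hypothesis
  at \<open>Suc a\<close> reads \<open>s + y \<le> (a + 1) * y\<close>, so \<open>y\<close> is at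
  least the average \<open>s / a\<close> and appending it cannot lower the average.\<close>

lemma partial_sum_ratio_mono:
  fixes x :: "nat \<Rightarrow> real"
  assumes "\<And>a. 1 \<le> a \<Longrightarrow> a \<le> k \<Longrightarrow> (\<Sum>b=1..a. x b / b) \<le> x a" "1 \<le> a" "a < k"
  shows "(\<Sum>b=1..a. x b / b) / a \<le> (\<Sum>b=1..Suc a. x b / b) / Suc a"
proof -
  define s where "s = (\<Sum>b=1..a. x b / b)"
  define y where "y = x (Suc a) / Suc a"
  have "s + x (Suc a) / Suc a \<le> x (Suc a)"
    using assms(1)[of "Suc a"] assms(2,3) by (simp add: s_def)
  then have "s + y \<le> (a + 1) * y" by (simp add: y_def)
  then have "s * Suc a \<le> (s + y) * a" by (simp add: algebra_simps)
  then have "s \<le> (s + y) * a / Suc a" by (intro mult_imp_le_div_pos) auto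
  then have "s / a \<le> (s + y) / Suc a" using assms(2) by (intro mult_imp_div_pos_le) auto
  moreover have "(\<Sum>b=1..Suc a. x b / b) = s + y" by (simp add: s_def y_def)
  ultimately show ?thesis unfolding s_def by simp
qed

text \<open>Chebyshev's sum inequality, although \<open>x b / b\<close> need not be monotone:
  monotone running averages suffice once the new term is rewritten as
  \<open>(m + 1) * A' - m * A\<close>.\<close>

lemma chebyshev_weighted:
  fixes x c :: "nat \<Rightarrow> real"
  assumes S: "\<And>a. 1 \<le> a \<Longrightarrow> a \<le> k \<Longrightarrow> (\<Sum>b=1..a. x b / b) \<le> x a"
    and c: "\<And>a b. 1 \<le> a \<Longrightarrow> a \<le> b \<Longrightarrow> b \<le> k \<Longrightarrow> c a \<le> c b"
    and "m \<le> k"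
  shows "(\<Sum>b=1..m. x b / b) / m * (\<Sum>a=1..m. c a) \<le> (\<Sum>a=1..m. c a * (x a / a))"
  using \<open>m \<le> k\<close>
proof (induction m)
  case 0
  then show ?case by simp
next
  case (Suc m)
  show ?case
  proof (cases "m = 0")
    case True
    then show ?thesis by simp
  next
    case False
    define A where "A = (\<Sum>b=1..m. x b / b) / m"
    define A' where "A' = (\<Sum>b=1..Suc m. x b / b) / Suc m"
    define y where "y = x (Suc m) / Suc m"
    define Q where "Q = (\<Sum>a=1..m. c a)"
    have IH: "A * Q \<le> (\<Sum>a=1..m. c a * (x a / a))" using Suc by (simp add: A_def Q_def)
    have AA: "A \<le> A'" using partial_sum_ratio_mono[of k x m] S Suc False by (simp add: A_def A'_def)
    have y: "y = (m + 1) * A' - m * A" using False by (simp add: y_def A_def A'_def)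
    have "Q \<le> (\<Sum>a=1..m. c (Suc m))" unfolding Q_def
      using Suc by (intro sum_mono c) auto
    then have "Q \<le> m * c (Suc m)" by simp
    then have "0 \<le> (A' - A) * (m * c (Suc m) - Q)" using AA by simp
    also have "\<dots> = A * Q + c (Suc m) * y - A' * (Q + c (Suc m))"
      by (simp add: y algebra_simps)
    finally have "A' * (Q + c (Suc m)) \<le> (\<Sum>a=1..m. c a * (x a / a)) + c (Suc m) * y"
      using IH by simp
    moreover have "(\<Sum>a=1..Suc m. c a) = Q + c (Suc m)"
      and "(\<Sum>a=1..Suc m. c a * (x a / a)) = (\<Sum>a=1..m. c a * (x a / a)) + c (Suc m) * y"
      by (simp_all add: Q_def y_def)
    ultimately show ?thesis unfolding A'_def[symmetric] by simp
  qed
qed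

lemma harmonic_tail_le:
  fixes k r :: nat
  assumes "0 < k" "k \<le> r"
  shows "(\<Sum>i=Suc k..r. 1 / real i) \<le> ln (r / k)"
  using assms(2)
proof (induction r rule: dec_induct)
  case base
  then show ?case using assms by simp
next
  case (step n)
  have n: "n > 0" using step assms by simp
  have "ln (real n / Suc n) \<le> real n / Suc n - 1" using n by (intro ln_le_minus_one) simp
  then have "1 / real (Suc n) \<le> ln (Suc n) - ln n"
    using n by (simp add: ln_div field_simps)
  then show ?case using step n assms by (simp add: ln_div)
qed

text \<open>On the left, \<open>x i / i\<close> occurs once for each \<open>a\<close> from
  \<open>i\<close> to \<open>n\<close>, hence \<open>n + 1 - i\<close> times.\<close>

lemma sum_partial_sums_div:
  fixes x :: "nat \<Rightarrow> real"
  shows "(\<Sum>a=1..n. \<Sum>i=1..a. x i / i) = (n + 1) * (\<Sum>i=1..n. x i / i) - (\<Sum>i=1..n. x i)"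
proof (induction n)
  case (Suc n)
  have "(real n + 2) * (x (Suc n) / Suc n) = x (Suc n) + x (Suc n) / Suc n"
    by (simp add: field_simps)
  with Suc show ?case by (simp add: algebra_simps)
qed simp

text \<open>Two averagings are combined: \<open>x i + x (m - i) \<le> x m\<close> summed over
  \<open>i < m\<close> bounds the plain sum of the \<open>x i\<close>, and the induction hypothesis
  summed over \<open>a < m\<close> bounds \<open>m\<close> times the weighted sum by twice that
  plain sum.\<close>

lemma sum_div_le_of_superadditive:
  fixes x :: "nat \<Rightarrow> real"
  assumes sup: "\<And>i j. 1 \<le> i \<Longrightarrow> 1 \<le> j \<Longrightarrow> i + j \<le> r \<Longrightarrow> x i + x j \<le> x (i + j)"
    and "1 \<le> m" "m \<le> r"
  shows "(\<Sum>i=1..m. x i / i) \<le> x m"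
  using assms(2,3)
proof (induction m rule: less_induct)
  case (less m)
  then obtain n where n: "m = Suc n" by (cases m) auto
  have "(\<Sum>i=1..n. x i + x (m - i)) \<le> (\<Sum>i=1..n. x m)"
  proof (rule sum_mono)
    fix i assume "i \<in> {1..n}"
    then show "x i + x (m - i) \<le> x m" using sup[of i "m - i"] n less.prems by fastforce
  qed
  moreover have "(\<Sum>i=1..n. x (m - i)) = (\<Sum>i=1..n. x i)"
    by (rule sum.reindex_bij_witness[of _ "\<lambda>i. m - i" "\<lambda>i. m - i"]) (auto simp: n)
  ultimately have 1: "2 * (\<Sum>i=1..n. x i) \<le> n * x m" by (simp add: sum.distrib)
  have "(\<Sum>a=1..n. \<Sum>i=1..a. x i / i) \<le> (\<Sum>a=1..n. x a)"
    using less n by (intro sum_mono less.IH) auto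
  then have "m * (\<Sum>i=1..n. x i / i) \<le> n * x m"
    using 1 by (subst (asm) sum_partial_sums_div) (simp add: n add.commute)
  then have "(\<Sum>i=1..n. x i / i) + x m / m \<le> x m"
    by (simp add: n field_simps)
  then show ?case by (simp add: n)
qed

text \<open>Superadditivity is only available when one of the two summands is at most \<open>k\<close>. A part of size
  \<open>i > k\<close> is split off with weight \<open>1 / i\<close> (these weights sum to at most \<open>1\<close>) and the remainder is
  filled with parts of size at most \<open>k\<close> whose weights are nondecreasing.\<close>

lemma sum_div_le_of_restricted_superadditive:
  fixes x :: "nat \<Rightarrow> real"
  assumes sup: "\<And>i j. 1 \<le> i \<Longrightarrow> i \<le> k \<Longrightarrow> 1 \<le> j \<Longrightarrow> i + j \<le> r \<Longrightarrow> x i + x j \<le> x (i + j)"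
    and k: "1 \<le> k" "r \<le> 3 * k" "k \<le> r"
    and T: "(\<Sum>i=Suc k..r. 1 / real i) \<le> 1"
  shows "(\<Sum>i=1..r. x i / i) \<le> x r"
\<comment> \<open>Two summands above \<open>k\<close> total at least \<open>2 * k + 2\<close>, so in
  this case superadditivity is unrestricted up to \<open>r\<close>.\<close>
proof (cases "r \<le> 2 * k + 1")
  case True
  have "x i + x j \<le> x (i + j)" if "1 \<le> i" "1 \<le> j" "i + j \<le> r" for i j
    using sup[of i j] sup[of j i] that True by (cases "i \<le> k") (auto simp: add.commute)
  then show ?thesis
    using k by (intro sum_div_le_of_superadditive[where r=r]) auto
next
  case False
  define A where "A = (\<Sum>b=1..k. x b / b) / k"
  have S: "(\<Sum>b=1..a. x b / b) \<le> x a" if "1 \<le> a" "a \<le> k" for a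
    using that False by (intro sum_div_le_of_superadditive[where r=k] sup) auto
  have cheb: "A * (\<Sum>a=1..k. c a) \<le> (\<Sum>a=1..k. c a * (x a / a))"
    if "\<And>a b. 1 \<le> a \<Longrightarrow> a \<le> b \<Longrightarrow> b \<le> k \<Longrightarrow> c a \<le> c b" for c
    unfolding A_def by (rule chebyshev_weighted[where k=k]) (use S that in auto)
  \<comment> \<open>The weight is \<open>a\<close> on the window from \<open>m - k\<close> to
    \<open>k\<close> and 0 below it. The window is symmetric under \<open>a\<close> to
    \<open>m - a\<close>, so the pairs \<open>x a + x (m - a)\<close> average at least
    \<open>A * m\<close> over it and some pair attains this.\<close>
  have pair: "\<exists>a. 1 \<le> a \<and> a \<le> k \<and> a < m \<and> m - a \<le> k \<and> A * m \<le> x a + x (m - a)"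
    if m: "k < m" "m \<le> 2 * k" for m
  proof (rule ccontr)
    assume no: "\<not> ?thesis"
    have ne: "{m-k..k} \<noteq> {}" using m by auto
    have sub: "{a \<in> {1..k}. m - k \<le> a} = {m-k..k}" using m by auto
    have "A * (\<Sum>a=m-k..k. real a) \<le> (\<Sum>a=m-k..k. x a)"
    proof -
      have "A * (\<Sum>a=1..k. if m - k \<le> a then real a else 0)
          \<le> (\<Sum>a=1..k. (if m - k \<le> a then real a else 0) * (x a / a))"
        by (rule cheb) auto
      also have "(\<Sum>a=1..k. (if m - k \<le> a then real a else 0) * (x a / a))
          = (\<Sum>a\<in>{a \<in> {1..k}. m - k \<le> a}. x a)"
        by (subst sum.inter_filter) (auto intro!: sum.cong)
      also have "(\<Sum>a=1..k. if m - k \<le> a then real a else 0) = (\<Sum>a\<in>{a \<in> {1..k}. m - k \<le> a}. real a)"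
        by (subst sum.inter_filter) (auto intro!: sum.cong)
      finally show ?thesis unfolding sub .
    qed
    moreover have "(\<Sum>a=m-k..k. real a) = (\<Sum>a=m-k..k. real (m - a))"
      by (rule sum.reindex_bij_witness[of _ "\<lambda>i. m - i" "\<lambda>i. m - i"]) (use m in auto)
    moreover have "(\<Sum>a=m-k..k. x a) = (\<Sum>a=m-k..k. x (m - a))"
      by (rule sum.reindex_bij_witness[of _ "\<lambda>i. m - i" "\<lambda>i. m - i"]) (use m in auto)
    ultimately have "A * ((\<Sum>a=m-k..k. real a) + (\<Sum>a=m-k..k. real (m - a)))
        \<le> (\<Sum>a=m-k..k. x a) + (\<Sum>a=m-k..k. x (m - a))"
      by (simp add: algebra_simps)
    then have "(\<Sum>a=m-k..k. A * (real a + real (m - a))) \<le> (\<Sum>a=m-k..k. x a + x (m - a))"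
      unfolding sum.distrib sum_distrib_left[symmetric] .
    moreover have "(\<Sum>a=m-k..k. x a + x (m - a)) < (\<Sum>a=m-k..k. A * (real a + real (m - a)))"
    proof (rule sum_strict_mono)
      fix a assume a: "a \<in> {m-k..k}"
      have "real a + real (m - a) = m" using a m by (simp add: of_nat_diff)
      moreover have "1 \<le> a \<and> a \<le> k \<and> a < m \<and> m - a \<le> k" using a m by auto
      ultimately show "x a + x (m - a) < A * (real a + real (m - a))"
        using no by (metis linorder_not_le)
    qed (use ne in auto)
    ultimately show False by simp
  qed
  \<comment> \<open>The remainder \<open>r - i\<close> is written as two parts of size at most
    \<open>k\<close>, which are split off from \<open>r\<close> one after the other;
    \<open>i\<close> itself may exceed \<open>k\<close>.\<close>
  have big: "A * (r - i) \<le> x r - x i" if i: "1 \<le> i" "k < r - i" "r - i \<le> 2 * k" for i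
  proof -
    obtain a where a: "1 \<le> a" "a \<le> k" "a < r - i" "r - i - a \<le> k" "A * (r - i) \<le> x a + x (r - i - a)"
      using pair[OF i(2,3)] by auto
    have "x a + x (r - a) \<le> x r" using sup[of a "r - a"] a i by simp
    moreover have "x (r - i - a) + x i \<le> x (r - a)" using sup[of "r - i - a" i] a i by simp
    ultimately show ?thesis using a(5) i by (simp add: of_nat_diff)
  qed
  have top: "A * r \<le> x r"
  proof -
    have "A * (r - k) \<le> x r - x k" using big[of k] k False by simp
    moreover have "A * k \<le> x k" using S[of k] k by (simp add: A_def)
    ultimately show ?thesis using k by (simp add: of_nat_diff algebra_simps)
  qed
  have small: "A * (\<Sum>m=1..k. real m / (r - m)) \<le> (\<Sum>m=1..k. (x r - x (r - m)) / (r - m))"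
  proof -
    have "A * (\<Sum>m=1..k. real m / (r - m)) \<le> (\<Sum>m=1..k. real m / (r - m) * (x m / m))"
      by (rule cheb) (use False in \<open>auto intro!: frac_le\<close>)
    also have "\<dots> = (\<Sum>m=1..k. x m / (r - m))" by (intro sum.cong) auto
    also have "\<dots> \<le> (\<Sum>m=1..k. (x r - x (r - m)) / (r - m))"
    proof (intro sum_mono divide_right_mono)
      fix m assume "m \<in> {1..k}"
      moreover from this have "1 \<le> r - m" using False by auto
      ultimately show "x m \<le> x r - x (r - m)" using sup[of m "r - m"] by simp
    qed (use False in auto)
    finally show ?thesis .
  qed
  define T' where "T' = (\<Sum>i=Suc k..r. 1 / real i)"
  have split: "(\<Sum>i=Suc k..r. g i) = (\<Sum>i=Suc k..r-k-1. g i) + (\<Sum>m=1..k. g (r - m)) + g r"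
    for g :: "nat \<Rightarrow> real"
  proof -
    have "{Suc k..r} = {Suc k..r-k-1} \<union> {r-k..r-1} \<union> {r}" using False k by auto
    moreover have "(\<Sum>i\<in>{Suc k..r-k-1} \<union> {r-k..r-1} \<union> {r}. g i)
       = (\<Sum>i=Suc k..r-k-1. g i) + (\<Sum>i=r-k..r-1. g i) + g r"
      using False k by (subst sum.union_disjoint; (subst sum.union_disjoint)?; auto)
    moreover have "(\<Sum>i=r-k..r-1. g i) = (\<Sum>m=1..k. g (r - m))"
      by (rule sum.reindex_bij_witness[of _ "\<lambda>i. r - i" "\<lambda>i. r - i"]) (use False k in auto)
    ultimately show ?thesis by simp
  qed
  have "A * (\<Sum>i=Suc k..r. (r - real i) / i) \<le> (\<Sum>i=Suc k..r. (x r - x i) / i)"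
  proof -
    have "A * (\<Sum>i=Suc k..r-k-1. (r - real i) / i) \<le> (\<Sum>i=Suc k..r-k-1. (x r - x i) / i)"
      unfolding sum_distrib_left
    proof (rule sum_mono)
      fix i assume i: "i \<in> {Suc k..r-k-1}"
      then have "A * (r - i) \<le> x r - x i" using k by (intro big) auto
      then have "A * (r - i) / i \<le> (x r - x i) / i" by (rule divide_right_mono) simp
      then show "A * ((r - real i) / i) \<le> (x r - x i) / i"
        using i le_trans[of i "r - Suc k" r] by (simp add: of_nat_diff)
    qed
    moreover have "(\<Sum>m=1..k. (r - real (r - m)) / real (r - m)) = (\<Sum>m=1..k. real m / (r - m))"
      using False by (intro sum.cong) (auto simp: of_nat_diff)
    then have "A * (\<Sum>m=1..k. (r - real (r - m)) / real (r - m)) \<le> (\<Sum>m=1..k. (x r - x (r - m)) / real (r - m))"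
      using small False by (simp add: of_nat_diff)
    ultimately show ?thesis
      unfolding split by (simp add: algebra_simps)
  qed
  moreover have "(\<Sum>i=Suc k..r. (r - real i) / i) = r * T' - (r - k)"
  proof -
    have "(\<Sum>i=Suc k..r. (r - real i) / i) = (\<Sum>i=Suc k..r. r * (1 / real i) - 1)"
      by (intro sum.cong) (auto simp: field_simps)
    also have "\<dots> = r * T' - (r - k)"
      using k by (simp add: T'_def sum_subtractf sum_distrib_left of_nat_diff)
    finally show ?thesis .
  qed
  moreover have "(\<Sum>i=Suc k..r. (x r - x i) / i) = T' * x r - (\<Sum>i=Suc k..r. x i / i)"
    by (simp add: T'_def sum_subtractf diff_divide_distrib sum_distrib_right)
  \<comment> \<open>Added to the previous estimate, this turns the coefficient \<open>T'\<close> of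
    \<open>x r\<close> into 1 and leaves exactly \<open>A * k\<close> on the left. Here the harmonic
    tail has to be at most 1.\<close>
  moreover have "(1 - T') * (A * r) \<le> (1 - T') * x r"
    using T top by (intro mult_left_mono) (auto simp: T'_def)
  ultimately have "A * k + (\<Sum>i=Suc k..r. x i / i) \<le> x r"
    using k by (simp add: of_nat_diff algebra_simps)
  moreover have "(\<Sum>i=1..r. x i / i) = (\<Sum>i=1..k. x i / i) + (\<Sum>i=Suc k..r. x i / i)"
    using k sum.ub_add_nat[of 1 k "\<lambda>i. x i / i" "r - k"] by simp
  ultimately show ?thesis using k by (simp add: A_def)
qed

section \<open>Entropy of a uniformly random ordered edge\<close>

definition cylinder :: "('i \<Rightarrow> 'a) set \<Rightarrow> 'i set \<Rightarrow> ('i \<Rightarrow> 'a) \<Rightarrow> ('i \<Rightarrow> 'a) set" where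
  "cylinder \<Omega> J f = {g\<in>\<Omega>. \<forall>j\<in>J. g j = f j}"

text \<open>For a uniformly random \<open>f \<in> \<Omega>\<close>, this is the conditional entropy of \<open>f\<close> given its values on \<open>J\<close>.
  Differences of this quantity are conditional entropies of single coordinates.\<close>

definition mean_log :: "('i \<Rightarrow> 'a) set \<Rightarrow> 'i set \<Rightarrow> real" where
  "mean_log \<Omega> J = (\<Sum>f\<in>\<Omega>. ln (card (cylinder \<Omega> J f))) / card \<Omega>"

lemma cylinder_self: "f \<in> \<Omega> \<Longrightarrow> f \<in> cylinder \<Omega> J f"
  by (simp add: cylinder_def)

lemma finite_cylinder: "finite \<Omega> \<Longrightarrow> finite (cylinder \<Omega> J f)"
  by (simp add: cylinder_def)

lemma cylinder_eq: "g \<in> cylinder \<Omega> K f \<Longrightarrow> J \<subseteq> K \<Longrightarrow> cylinder \<Omega> J g = cylinder \<Omega> J f"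
  by (auto simp: cylinder_def subset_iff)

lemma card_cylinder_pos: "finite \<Omega> \<Longrightarrow> f \<in> \<Omega> \<Longrightarrow> 0 < card (cylinder \<Omega> J f)"
  using cylinder_self finite_cylinder by (metis card_gt_0_iff empty_iff)

lemma cylinder_subset: "cylinder \<Omega> J f \<subseteq> \<Omega>"
  by (auto simp: cylinder_def)

text \<open>Each \<open>h\<close> is weighted by the reciprocal of the number of members of
  \<open>cylinder \<Omega> K f\<close> sharing its value at \<open>p\<close>. Every value possible
  at \<open>p\<close> then has total weight 1, so each \<open>g\<close> on the left is counted
  once.\<close>

lemma card_cylinder_projection:
  assumes "finite \<Omega>" "f \<in> \<Omega>" "C \<subseteq> K"
  shows "real (card {g \<in> cylinder \<Omega> C f. g p \<in> (\<lambda>g'. g' p) ` cylinder \<Omega> K f}) =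
    (\<Sum>h\<in>cylinder \<Omega> K f. card (cylinder \<Omega> (insert p C) h) / card (cylinder \<Omega> (insert p K) h))"
proof -
  let ?X = "{g \<in> cylinder \<Omega> C f. g p \<in> (\<lambda>g'. g' p) ` cylinder \<Omega> K f}"
  let ?w = "\<lambda>h. 1 / real (card (cylinder \<Omega> (insert p K) h))"
  have fin: "finite ?X" "finite (cylinder \<Omega> K f)" using assms by (auto simp: finite_cylinder)
  have "(\<Sum>h\<in>cylinder \<Omega> K f. card (cylinder \<Omega> (insert p C) h) / card (cylinder \<Omega> (insert p K) h))
     = (\<Sum>h\<in>cylinder \<Omega> K f. \<Sum>g\<in>{g \<in> ?X. g p = h p}. ?w h)"
  proof (rule sum.cong[OF refl])
    fix h assume h: "h \<in> cylinder \<Omega> K f"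
    have "cylinder \<Omega> (insert p C) h = {g \<in> ?X. g p = h p}"
      using h assms(3) by (auto simp: cylinder_def)
    then show "card (cylinder \<Omega> (insert p C) h) / card (cylinder \<Omega> (insert p K) h)
        = (\<Sum>g\<in>{g \<in> ?X. g p = h p}. ?w h)" by simp
  qed
  also have "\<dots> = (\<Sum>g\<in>?X. \<Sum>h\<in>{h \<in> cylinder \<Omega> K f. g p = h p}. ?w h)"
    by (rule sum.swap_restrict) (use fin in auto)
  also have "\<dots> = (\<Sum>g\<in>?X. 1)"
  proof (rule sum.cong[OF refl])
    fix g assume "g \<in> ?X"
    then obtain g' where g': "g' \<in> cylinder \<Omega> K f" "g p = g' p" by auto
    have eq: "{h \<in> cylinder \<Omega> K f. g p = h p} = cylinder \<Omega> (insert p K) g'"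
      using g' by (auto simp: cylinder_def)
    have "(\<Sum>h\<in>cylinder \<Omega> (insert p K) g'. ?w h) = (\<Sum>h\<in>cylinder \<Omega> (insert p K) g'. ?w g')"
      by (intro sum.cong refl) (use cylinder_eq[of _ \<Omega> "insert p K" g' "insert p K"] in auto)
    also have "\<dots> = 1"
      using card_cylinder_pos[OF assms(1), of g' "insert p K"] g' cylinder_subset by fastforce
    finally show "(\<Sum>h\<in>{h \<in> cylinder \<Omega> K f. g p = h p}. ?w h) = 1" by (simp only: eq)
  qed
  finally show ?thesis by simp
qed

text \<open>Choose \<open>f\<close> uniformly and \<open>g\<close> uniformly among those agreeing with \<open>f\<close> on \<open>C\<close>. The right-hand side adds
  up the probabilities that \<open>g p\<close> is a value that is still possible when \<open>f\<close> is fixed on \<open>K\<close>.\<close>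

lemma sum_projection_ge:
  assumes "finite \<Omega>" "\<Omega> \<noteq> {}" "C \<subseteq> K"
  shows "card \<Omega> * exp (mean_log \<Omega> K + mean_log \<Omega> (insert p C) - mean_log \<Omega> C - mean_log \<Omega> (insert p K))
    \<le> (\<Sum>f\<in>\<Omega>. card {g \<in> cylinder \<Omega> C f. g p \<in> (\<lambda>g'. g' p) ` cylinder \<Omega> K f} / card (cylinder \<Omega> C f))"
proof -
  let ?D = "\<lambda>J f. real (card (cylinder \<Omega> J f))"
  have pos: "?D J f > 0" if "f \<in> \<Omega>" for J f using card_cylinder_pos[OF assms(1) that] by simp
  have "(\<Sum>f\<in>\<Omega>. card {g \<in> cylinder \<Omega> C f. g p \<in> (\<lambda>g'. g' p) ` cylinder \<Omega> K f} / ?D C f)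
     = (\<Sum>f\<in>\<Omega>. \<Sum>h\<in>{h\<in>\<Omega>. h \<in> cylinder \<Omega> K f}. ?D (insert p C) h / (?D (insert p K) h * ?D C h))"
  proof (rule sum.cong[OF refl])
    fix f assume f: "f \<in> \<Omega>"
    have "{h\<in>\<Omega>. h \<in> cylinder \<Omega> K f} = cylinder \<Omega> K f" by (auto simp: cylinder_def)
    moreover have "cylinder \<Omega> C h = cylinder \<Omega> C f" if "h \<in> cylinder \<Omega> K f" for h
      using that assms(3) by (rule cylinder_eq)
    ultimately show "card {g \<in> cylinder \<Omega> C f. g p \<in> (\<lambda>g'. g' p) ` cylinder \<Omega> K f} / ?D C f
       = (\<Sum>h\<in>{h\<in>\<Omega>. h \<in> cylinder \<Omega> K f}. ?D (insert p C) h / (?D (insert p K) h * ?D C h))"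
      using card_cylinder_projection[OF assms(1) f assms(3)] by (simp add: sum_divide_distrib)
  qed
  also have "\<dots> = (\<Sum>h\<in>\<Omega>. \<Sum>f\<in>{f\<in>\<Omega>. h \<in> cylinder \<Omega> K f}. ?D (insert p C) h / (?D (insert p K) h * ?D C h))"
    by (rule sum.swap_restrict) (use assms in auto)
  also have "\<dots> = (\<Sum>h\<in>\<Omega>. ?D K h * ?D (insert p C) h / (?D (insert p K) h * ?D C h))"
  proof (rule sum.cong[OF refl])
    fix h assume "h \<in> \<Omega>"
    then have "{f\<in>\<Omega>. h \<in> cylinder \<Omega> K f} = cylinder \<Omega> K h" by (auto simp: cylinder_def)
    then show "(\<Sum>f\<in>{f\<in>\<Omega>. h \<in> cylinder \<Omega> K f}. ?D (insert p C) h / (?D (insert p K) h * ?D C h))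
       = ?D K h * ?D (insert p C) h / (?D (insert p K) h * ?D C h)" by simp
  qed
  \<comment> \<open>The mean dominates the geometric mean. The resulting exponent is the entropy of
    coordinate \<open>p\<close> given \<open>K\<close> minus its entropy given
    \<open>C\<close>.\<close>
  also have "\<dots> \<ge> card \<Omega> * exp ((\<Sum>h\<in>\<Omega>. ln (?D K h * ?D (insert p C) h / (?D (insert p K) h * ?D C h))) / card \<Omega>)"
    by (rule exp_mean_ln_le_mean) (use assms pos in auto)
  also have "(\<Sum>h\<in>\<Omega>. ln (?D K h * ?D (insert p C) h / (?D (insert p K) h * ?D C h))) / card \<Omega>
     = mean_log \<Omega> K + mean_log \<Omega> (insert p C) - mean_log \<Omega> C - mean_log \<Omega> (insert p K)"
  proof -
    have "(\<Sum>h\<in>\<Omega>. ln (?D K h * ?D (insert p C) h / (?D (insert p K) h * ?D C h)))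
       = (\<Sum>h\<in>\<Omega>. ln (?D K h) + ln (?D (insert p C) h) - ln (?D (insert p K) h) - ln (?D C h))"
      by (intro sum.cong refl) (use pos in \<open>simp add: ln_div ln_mult\<close>)
    then show ?thesis
      by (simp add: mean_log_def sum.distrib sum_subtractf add_divide_distrib diff_divide_distrib)
  qed
  finally show ?thesis .
qed

lemma mean_log_empty: "finite \<Omega> \<Longrightarrow> \<Omega> \<noteq> {} \<Longrightarrow> mean_log \<Omega> {} = ln (card \<Omega>)"
  by (simp add: mean_log_def cylinder_def)

text \<open>Entropy is at most the logarithm of the number of values: the functions with a given
  value at \<open>p\<close> contribute reciprocals of their number, hence 1 in total, and the mean
  dominates the geometric mean.\<close>

lemma exp_entropy_le_card_range:
  assumes "finite \<Omega>" "\<Omega> \<noteq> {}" "finite V" "\<And>f. f \<in> \<Omega> \<Longrightarrow> f p \<in> V"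
  shows "exp (mean_log \<Omega> {} - mean_log \<Omega> {p}) \<le> card V"
proof -
  let ?D = "\<lambda>J f. real (card (cylinder \<Omega> J f))"
  have pos: "?D J f > 0" if "f \<in> \<Omega>" for J f using card_cylinder_pos[OF assms(1) that] by simp
  have c: "real (card \<Omega>) > 0" using assms by (simp add: card_gt_0_iff)
  have "card \<Omega> * exp ((\<Sum>f\<in>\<Omega>. ln (card \<Omega> / ?D {p} f)) / card \<Omega>) \<le> (\<Sum>f\<in>\<Omega>. card \<Omega> / ?D {p} f)"
    by (rule exp_mean_ln_le_mean) (use assms pos c in auto)
  also have "(\<Sum>f\<in>\<Omega>. ln (card \<Omega> / ?D {p} f)) / card \<Omega> = mean_log \<Omega> {} - mean_log \<Omega> {p}"
  proof -
    have "(\<Sum>f\<in>\<Omega>. ln (card \<Omega> / ?D {p} f)) = (\<Sum>f\<in>\<Omega>. ln (card \<Omega>) - ln (?D {p} f))"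
      by (intro sum.cong refl) (use pos c in \<open>simp add: ln_div\<close>)
    then show ?thesis using c mean_log_empty[OF assms(1,2)]
      by (simp add: mean_log_def sum_subtractf diff_divide_distrib)
  qed
  also have "(\<Sum>f\<in>\<Omega>. card \<Omega> / ?D {p} f) = card \<Omega> * (\<Sum>v\<in>(\<lambda>f. f p) ` \<Omega>. \<Sum>f\<in>{f\<in>\<Omega>. f p = v}. 1 / ?D {p} f)"
    using assms(1) by (subst sum.image_gen[of _ _ "\<lambda>f. f p"]) (auto simp: sum_distrib_left)
  also have "(\<Sum>v\<in>(\<lambda>f. f p) ` \<Omega>. \<Sum>f\<in>{f\<in>\<Omega>. f p = v}. 1 / ?D {p} f) = (\<Sum>v\<in>(\<lambda>f. f p) ` \<Omega>. 1)"
  proof (rule sum.cong[OF refl])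
    fix v assume "v \<in> (\<lambda>f. f p) ` \<Omega>"
    then obtain g where g: "g \<in> \<Omega>" "v = g p" by auto
    have "cylinder \<Omega> {p} f = {f\<in>\<Omega>. f p = v}" if "f p = v" for f
      using that by (auto simp: cylinder_def)
    then have "(\<Sum>f\<in>{f\<in>\<Omega>. f p = v}. 1 / ?D {p} f) = (\<Sum>f\<in>{f\<in>\<Omega>. f p = v}. 1 / card {f\<in>\<Omega>. f p = v})"
      by (intro sum.cong refl) auto
    also have "\<dots> = 1" using g assms(1) by auto
    finally show "(\<Sum>f\<in>{f\<in>\<Omega>. f p = v}. 1 / ?D {p} f) = 1" .
  qed
  finally have "exp (mean_log \<Omega> {} - mean_log \<Omega> {p}) \<le> card ((\<lambda>f. f p) ` \<Omega>)"
    using c by simp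
  also have "\<dots> \<le> card V" using assms by (intro of_nat_mono card_mono) auto
  finally show ?thesis .
qed

text \<open>Ordering the edges in all ways makes the coordinates exchangeable, so that
  \<open>mean_log\<close> depends only on the number of fixed coordinates. Extensionality ensures
  that the coordinates below \<open>r\<close> determine the function.\<close>

definition ordered_edges :: "nat \<Rightarrow> 'a set set \<Rightarrow> (nat \<Rightarrow> 'a) set" where
  "ordered_edges r E = {f \<in> extensional {..<r}. inj_on f {..<r} \<and> f ` {..<r} \<in> E}"

lemma finite_ordered_edges:
  assumes "finite V" "\<And>e. e \<in> E \<Longrightarrow> e \<subseteq> V"
  shows "finite (ordered_edges r E)"
proof (rule finite_subset)
  show "ordered_edges r E \<subseteq> {..<r} \<rightarrow>\<^sub>E V"
    using assms(2) by (auto simp: ordered_edges_def PiE_def)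
  show "finite ({..<r} \<rightarrow>\<^sub>E V)" using assms(1) by (simp add: finite_PiE)
qed

lemma card_ordered_edges:
  assumes "finite V" "\<And>e. e \<in> E \<Longrightarrow> e \<subseteq> V \<and> card e = r"
  shows "card (ordered_edges r E) = fact r * card E"
proof -
  have finE: "finite E" using assms by (meson PowI finite_Pow_iff finite_subset subsetI)
  have eq: "{f \<in> ordered_edges r E. f ` {..<r} = e} = {f \<in> {..<r} \<rightarrow>\<^sub>E e. inj_on f {..<r}}"
    if "e \<in> E" for e
  proof (intro set_eqI iffI)
    fix f assume "f \<in> {f \<in> {..<r} \<rightarrow>\<^sub>E e. inj_on f {..<r}}"
    then have f: "f \<in> {..<r} \<rightarrow>\<^sub>E e" "inj_on f {..<r}" by auto
    have e: "finite e" "card e = r" using assms that finite_subset by blast+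
    have "f ` {..<r} = e"
      using f e by (intro card_subset_eq) (auto simp: card_image)
    then show "f \<in> {f \<in> ordered_edges r E. f ` {..<r} = e}"
      using f that by (auto simp: ordered_edges_def PiE_def)
  qed (auto simp: ordered_edges_def PiE_def)
  have "ordered_edges r E = (\<Union>e\<in>E. {f \<in> ordered_edges r E. f ` {..<r} = e})"
    by (auto simp: ordered_edges_def)
  also have "card \<dots> = (\<Sum>e\<in>E. card {f \<in> ordered_edges r E. f ` {..<r} = e})"
    using finE finite_ordered_edges[OF assms(1), of E r] assms(2) by (intro card_UN_disjoint) auto
  also have "\<dots> = (\<Sum>e\<in>E. fact r)"
  proof (rule sum.cong[OF refl])
    fix e assume e: "e \<in> E"
    have "card {f \<in> {..<r} \<rightarrow>\<^sub>E e. inj_on f {..<r}} = prod ((-) r) {0..<r}"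
      using assms(2)[OF e] finite_subset[of e V] assms(1)
      by (subst card_inj_on_subset_funcset) auto
    then show "card {f \<in> ordered_edges r E. f ` {..<r} = e} = fact r"
      by (simp add: eq[OF e] fact_prod_rev)
  qed
  finally show ?thesis by simp
qed

section \<open>Exchangeability of the coordinates of a random ordered edge\<close>

lemma ordered_edges_permute:
  assumes "\<pi> permutes {..<r}"
  shows "bij_betw (\<lambda>f. f \<circ> \<pi>) (ordered_edges r E) (ordered_edges r E)"
proof (rule bij_betw_byWitness[where f' = "\<lambda>f. f \<circ> inv \<pi>"])
  have *: "f \<circ> \<sigma> \<in> ordered_edges r E" if "\<sigma> permutes {..<r}" "f \<in> ordered_edges r E" for \<sigma> f
  proof -
    have "(f \<circ> \<sigma>) ` {..<r} = f ` {..<r}"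
      using permutes_image[OF that(1)] by (metis image_comp)
    moreover have "inj_on (f \<circ> \<sigma>) {..<r}"
      using that permutes_image[OF that(1)]
      by (intro comp_inj_on) (auto simp: ordered_edges_def permutes_inj_on)
    moreover have "f \<circ> \<sigma> \<in> extensional {..<r}"
      using that by (auto simp: ordered_edges_def extensional_def permutes_def)
    ultimately show ?thesis using that by (simp add: ordered_edges_def)
  qed
  show "(\<lambda>f. f \<circ> \<pi>) ` ordered_edges r E \<subseteq> ordered_edges r E" using *[OF assms] by auto
  show "(\<lambda>f. f \<circ> inv \<pi>) ` ordered_edges r E \<subseteq> ordered_edges r E"
    using *[OF permutes_inv[OF assms]] by auto
qed (use permutes_inv_o[OF assms] in \<open>auto simp: comp_assoc\<close>)

text \<open>Coordinate \<open>j\<close> of \<open>f \<circ> \<pi>\<close> is coordinate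
  \<open>\<pi> j\<close> of \<open>f\<close>, hence the image of \<open>J\<close> and not its
  preimage.\<close>

lemma card_cylinder_permute:
  assumes "\<pi> permutes {..<r}"
  shows "card (cylinder (ordered_edges r E) J (f \<circ> \<pi>)) = card (cylinder (ordered_edges r E) (\<pi> ` J) f)"
proof -
  let ?\<Omega> = "ordered_edges r E"
  have bij: "bij_betw (\<lambda>f. f \<circ> \<pi>) ?\<Omega> ?\<Omega>" by (rule ordered_edges_permute[OF assms])
  then have \<Omega>: "?\<Omega> = (\<lambda>f. f \<circ> \<pi>) ` ?\<Omega>" by (simp add: bij_betw_def)
  have "cylinder ?\<Omega> J (f \<circ> \<pi>) = (\<lambda>h. h \<circ> \<pi>) ` cylinder ?\<Omega> (\<pi> ` J) f"
  proof (intro set_eqI iffI)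
    fix g assume "g \<in> cylinder ?\<Omega> J (f \<circ> \<pi>)"
    then have g: "g \<in> ?\<Omega>" "\<And>j. j \<in> J \<Longrightarrow> g j = f (\<pi> j)" by (auto simp: cylinder_def)
    then obtain h where "h \<in> ?\<Omega>" "g = h \<circ> \<pi>" using \<Omega> by blast
    with g show "g \<in> (\<lambda>h. h \<circ> \<pi>) ` cylinder ?\<Omega> (\<pi> ` J) f" by (auto simp: cylinder_def)
  next
    fix g assume "g \<in> (\<lambda>h. h \<circ> \<pi>) ` cylinder ?\<Omega> (\<pi> ` J) f"
    then obtain h where "h \<in> ?\<Omega>" "g = h \<circ> \<pi>" "\<And>j. j \<in> J \<Longrightarrow> h (\<pi> j) = f (\<pi> j)"
      by (auto simp: cylinder_def)
    then show "g \<in> cylinder ?\<Omega> J (f \<circ> \<pi>)" using \<Omega> by (auto simp: cylinder_def)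
  qed
  moreover have "inj_on (\<lambda>h. h \<circ> \<pi>) (cylinder ?\<Omega> (\<pi> ` J) f)"
    using bij cylinder_subset unfolding bij_betw_def by (rule inj_on_subset[OF conjunct1])
  ultimately show ?thesis by (simp add: card_image)
qed

lemma mean_log_permute:
  assumes "\<pi> permutes {..<r}"
  shows "mean_log (ordered_edges r E) (\<pi> ` J) = mean_log (ordered_edges r E) J"
proof -
  let ?\<Omega> = "ordered_edges r E"
  have "(\<Sum>f\<in>?\<Omega>. ln (card (cylinder ?\<Omega> J f))) = (\<Sum>f\<in>?\<Omega>. ln (card (cylinder ?\<Omega> J (f \<circ> \<pi>))))"
    by (rule sum.reindex_bij_betw[OF ordered_edges_permute[OF assms], symmetric])
  then show ?thesis by (simp add: mean_log_def card_cylinder_permute[OF assms])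
qed

lemma permutes_image_eq_exists:
  assumes "finite S" "A \<subseteq> S" "B \<subseteq> S" "card A = card B"
  shows "\<exists>\<pi>. \<pi> permutes S \<and> \<pi> ` A = B"
proof -
  have fin: "finite A" "finite B" using assms finite_subset by auto
  obtain g where g: "bij_betw g A B"
    using assms(4) fin finite_same_card_bij by blast
  have "card (S - A) = card (S - B)" using assms fin by (simp add: card_Diff_subset)
  then obtain h where h: "bij_betw h (S - A) (S - B)"
    using finite_same_card_bij assms(1) by (metis finite_Diff)
  define \<pi> where "\<pi> x = (if x \<in> S then if x \<in> A then g x else h x else x)" for x
  have "bij_betw \<pi> A B" using g assms(2) by (subst bij_betw_cong[of A \<pi> g]) (auto simp: \<pi>_def)
  moreover have "bij_betw \<pi> (S - A) (S - B)" using h by (subst bij_betw_cong[of _ \<pi> h]) (auto simp: \<pi>_def)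
  ultimately have "bij_betw \<pi> (A \<union> (S - A)) (B \<union> (S - B))" by (rule bij_betw_combine) auto
  then have "bij_betw \<pi> S S" using assms by (simp add: Un_absorb1)
  then have "\<pi> permutes S" by (intro bij_imp_permutes) (auto simp: \<pi>_def)
  moreover have "\<pi> ` A = B" using \<open>bij_betw \<pi> A B\<close> by (simp add: bij_betw_def)
  ultimately show ?thesis by blast
qed

lemma mean_log_eq_of_card_eq:
  assumes "A \<subseteq> {..<r}" "B \<subseteq> {..<r}" "card A = card B"
  shows "mean_log (ordered_edges r E) A = mean_log (ordered_edges r E) B"
  using permutes_image_eq_exists[OF finite_lessThan assms] mean_log_permute by metis

section \<open>Density and stability of hypergraphs without homomorphic tents\<close>

text \<open>Absence of homomorphic images of \<open>(r - i, i)\<close>-tents with \<open>i \<le> k\<close>: outside their prescribed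
  intersections, the edges of the image may overlap.\<close>

definition hom_tent_free :: "nat \<Rightarrow> 'a set set \<Rightarrow> bool" where
  "hom_tent_free k E \<longleftrightarrow> (\<forall>e\<in>E. \<forall>A v. A \<subseteq> e \<longrightarrow> 1 \<le> card A \<longrightarrow> card A \<le> k \<longrightarrow> v \<notin> e \<longrightarrow>
     \<not> ((\<exists>e'\<in>E. insert v A \<subseteq> e') \<and> (\<exists>e'\<in>E. insert v (e - A) \<subseteq> e')))"

lemma hom_tent_freeD:
  "hom_tent_free k E \<Longrightarrow> e \<in> E \<Longrightarrow> A \<subseteq> e \<Longrightarrow> 1 \<le> card A \<Longrightarrow> card A \<le> k \<Longrightarrow> v \<notin> e \<Longrightarrow>
    e' \<in> E \<Longrightarrow> insert v A \<subseteq> e' \<Longrightarrow> e'' \<in> E \<Longrightarrow> insert v (e - A) \<subseteq> e'' \<Longrightarrow> False"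
  unfolding hom_tent_free_def by blast

text \<open>A common value \<open>v = g p = g' p'\<close> lies outside the edge of \<open>f\<close>.
  With \<open>A\<close> the image of the complement of \<open>K'\<close>, which lies inside
  \<open>K\<close>, the edge of \<open>g\<close> contains \<open>A\<close> and \<open>v\<close>, and
  that of \<open>g'\<close> contains \<open>v\<close> and the rest of the edge of \<open>f\<close>:
  a homomorphic tent.\<close>

lemma projections_disjoint:
  assumes htf: "hom_tent_free k E" and f: "f \<in> ordered_edges r E"
    and K: "K \<subseteq> {..<r}" "K' \<subseteq> {..<r}" "K \<union> K' = {..<r}" "p \<in> {..<r} - K" "p' \<in> {..<r} - K'"
    and card: "card ({..<r} - K') \<le> k"
  shows "(\<lambda>g. g p) ` cylinder (ordered_edges r E) K f \<inter> (\<lambda>g. g p') ` cylinder (ordered_edges r E) K' f = {}"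
proof (rule ccontr)
  assume "\<not> ?thesis"
  then obtain g g' where g: "g \<in> cylinder (ordered_edges r E) K f"
    and g': "g' \<in> cylinder (ordered_edges r E) K' f" and eq: "g p = g' p'"
    by auto
  let ?A = "f ` ({..<r} - K')"
  have inj: "inj_on f {..<r}" "inj_on g {..<r}" "inj_on g' {..<r}"
    and mem: "f ` {..<r} \<in> E" "g ` {..<r} \<in> E" "g' ` {..<r} \<in> E"
    and on: "\<And>j. j \<in> K \<Longrightarrow> g j = f j" "\<And>j. j \<in> K' \<Longrightarrow> g' j = f j"
    using f g g' by (auto simp: cylinder_def ordered_edges_def)
  have 1: "g p \<notin> f ` K" 
  proof
    assume "g p \<in> f ` K"
    then obtain j where "j \<in> K" "g p = g j" using on by auto
    then show False using inj(2) K by (auto simp: inj_on_def)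
  qed
  have 2: "g p \<notin> f ` K'" 
  proof
    assume "g p \<in> f ` K'"
    then obtain j where "j \<in> K'" "g' p' = g' j" using on eq by auto
    then show False using inj(3) K by (auto simp: inj_on_def)
  qed
  have "g p \<notin> f ` {..<r}" using 1 2 K(3) by (metis UnE image_Un)
  moreover have "card ?A = card ({..<r} - K')"
    using inj(1) by (intro card_image) (auto intro: inj_on_subset)
  moreover have "card ({..<r} - K') \<ge> 1"
    using K(5) by (metis One_nat_def Suc_leI card_gt_0_iff empty_iff finite_Diff finite_lessThan)
  moreover have "insert (g p) ?A \<subseteq> g ` {..<r}"
  proof -
    have "{..<r} - K' \<subseteq> K" using K by auto
    then have "?A = g ` ({..<r} - K')" using on(1) by (intro image_cong) auto
    then have "?A \<subseteq> g ` {..<r}" by auto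
    then show ?thesis using K by auto
  qed
  moreover have "f ` {..<r} - ?A = f ` K'"
    using K inj(1) by (auto simp: inj_on_def)
  then have "insert (g p) (f ` {..<r} - ?A) \<subseteq> g' ` {..<r}"
  proof -
    have "f ` K' = g' ` K'" using on(2) by (intro image_cong) auto
    then have "f ` K' \<subseteq> g' ` {..<r}" using K by auto
    moreover have "g p \<in> g' ` {..<r}" using eq K by auto
    ultimately show ?thesis using \<open>f ` {..<r} - ?A = f ` K'\<close> by simp
  qed
  ultimately show False
    using hom_tent_freeD[OF htf mem(1), of ?A "g p" "g ` {..<r}" "g' ` {..<r}"] card mem by auto
qed

text \<open>The transposition of \<open>p\<close> and \<open>p'\<close> preserves the ordered edges
  and fixes \<open>C\<close> pointwise. It brings projections taken at two different positions to
  one position, where disjoint value sets give disjoint events.\<close>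

lemma cylinder_coordinate_swap:
  assumes "p < r" "p' < r" "p \<notin> C" "p' \<notin> C" 
  shows "card {g \<in> cylinder (ordered_edges r E) C f. g p' \<in> N} = card {g \<in> cylinder (ordered_edges r E) C f. g p \<in> N}"
proof -
  define \<tau> where "\<tau> = transpose p p'"
  have \<tau>: "\<tau> permutes {..<r}" unfolding \<tau>_def using assms by (intro permutes_swap_id) auto
  have t: "\<tau> p = p'" "\<tau> p' = p" "\<And>j. j \<in> C \<Longrightarrow> \<tau> j = j" "\<And>j. \<tau> (\<tau> j) = j"
    using assms by (auto simp: \<tau>_def transpose_def)
  have \<Omega>: "g \<circ> \<tau> \<in> ordered_edges r E" if "g \<in> ordered_edges r E" for g
    using ordered_edges_permute[OF \<tau>] that by (auto simp: bij_betw_def)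
  have "bij_betw (\<lambda>g. g \<circ> \<tau>) {g \<in> cylinder (ordered_edges r E) C f. g p' \<in> N}
     {g \<in> cylinder (ordered_edges r E) C f. g p \<in> N}"
    by (rule bij_betw_byWitness[where f' = "\<lambda>g. g \<circ> \<tau>"]) (auto simp: cylinder_def t \<Omega> fun_eq_iff)
  then show ?thesis by (rule bij_betw_same_card)
qed

locale dense_hom_tent_free =
  fixes r k :: nat and V :: "'a set" and E :: "'a set set"
  assumes finite_V: "finite V" and edge: "\<And>e. e \<in> E \<Longrightarrow> e \<subseteq> V \<and> card e = r"
    and E_nonempty: "E \<noteq> {}" and htf: "hom_tent_free k E"
    and k: "1 \<le> k" "k \<le> r" "r \<le> 3 * k" and tail: "(\<Sum>i=Suc k..r. 1 / real i) \<le> 1"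
begin

abbreviation \<Omega> :: "(nat \<Rightarrow> 'a) set" where "\<Omega> \<equiv> ordered_edges r E"

text \<open>\<open>ent j\<close> is the entropy of one vertex of a random ordered edge given \<open>j\<close> others.\<close>

definition ent :: "nat \<Rightarrow> real" where
  "ent j = mean_log \<Omega> {..<j} - mean_log \<Omega> {..<Suc j}"

text \<open>The index counts the vertices still free, and the normalisation makes
  \<open>ratio r = 1\<close>. In a complete r-partite hypergraph with equal parts, given
  \<open>r - i\<close> vertices the next one is uniform on the \<open>i\<close> remaining parts, so
  \<open>ratio i = i / r\<close>.\<close>

definition ratio :: "nat \<Rightarrow> real" where
  "ratio i = exp (ent (r - i) - ent 0)"

lemma finite_\<Omega>: "finite \<Omega>"
  using finite_ordered_edges[OF finite_V] edge by blast

lemma finite_E: "finite E"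
  using edge finite_V by (meson PowI finite_Pow_iff finite_subset subsetI)

lemma card_\<Omega>: "card \<Omega> = fact r * card E"
  using card_ordered_edges[OF finite_V] edge by blast

lemma \<Omega>_nonempty: "\<Omega> \<noteq> {}"
proof -
  have "card \<Omega> > 0" using card_\<Omega> finite_E E_nonempty by (simp add: card_gt_0_iff)
  then show ?thesis by auto
qed

lemma mean_log_lessThan: "A \<subseteq> {..<r} \<Longrightarrow> mean_log \<Omega> A = mean_log \<Omega> {..<card A}"
  by (intro mean_log_eq_of_card_eq) (auto dest: card_mono[rotated])

text \<open>Split an edge into parts \<open>A\<close>, \<open>B\<close>, \<open>C\<close> of sizes \<open>i\<close>, \<open>j\<close>, \<open>r - i - j\<close>. A vertex that extends both
  \<open>A \<union> C\<close> and \<open>B \<union> C\<close> would give a tent, so the two events of \<open>sum_projection_ge\<close> are disjoint.\<close>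

lemma ratio_superadditive:
  assumes "1 \<le> i" "i \<le> k" "1 \<le> j" "i + j \<le> r"
  shows "ratio i + ratio j \<le> ratio (i + j)"
proof -
  define c where "c = r - (i + j)"
  \<comment> \<open>Positions below \<open>c\<close> form \<open>C\<close>, the next
    \<open>i\<close> form \<open>A\<close>, the last \<open>j\<close> form \<open>B\<close>. Thus
    \<open>K\<close> is \<open>C\<close> with \<open>A\<close> and \<open>p\<close> the first
    position of \<open>B\<close>, while \<open>K'\<close> is \<open>C\<close> with \<open>B\<close>
    and \<open>p'\<close> the first position of \<open>A\<close>; the complement of
    \<open>K'\<close> has size \<open>i \<le> k\<close>.\<close>
  define C K K' where "C = {..<c}" and "K = {..<c+i}" and "K' = {..<c} \<union> {c+i..<r}"
  define p p' where "p = c + i" and "p' = c"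
  have r: "r = c + i + j" using assms by (simp add: c_def)
  define N N' where "N f = (\<lambda>g. g p) ` cylinder \<Omega> K f" and "N' f = (\<lambda>g. g p') ` cylinder \<Omega> K' f" for f
  have disj: "N f \<inter> N' f = {}" if "f \<in> \<Omega>" for f
  proof -
    have "{..<r} - K' = {c..<c+i}" by (auto simp: K'_def r)
    then have "card ({..<r} - K') \<le> k" using assms by simp
    then show ?thesis unfolding N_def N'_def
      using that assms by (intro projections_disjoint[OF htf])
        (auto simp: K_def K'_def p_def p'_def r)
  qed
  have 1: "card \<Omega> * exp (ent (c + i) - ent c)
      \<le> (\<Sum>f\<in>\<Omega>. card {g \<in> cylinder \<Omega> C f. g p \<in> N f} / card (cylinder \<Omega> C f))"
  proof -
    have "mean_log \<Omega> (insert p C) = mean_log \<Omega> {..<Suc c}"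
      using assms by (subst mean_log_lessThan) (auto simp: C_def p_def r)
    moreover have "insert p K = {..<Suc (c + i)}" by (auto simp: p_def K_def)
    ultimately show ?thesis
      using sum_projection_ge[OF finite_\<Omega> \<Omega>_nonempty, of C K p]
      by (simp add: ent_def N_def C_def K_def algebra_simps)
  qed
  have 2: "card \<Omega> * exp (ent (c + j) - ent c)
      \<le> (\<Sum>f\<in>\<Omega>. card {g \<in> cylinder \<Omega> C f. g p \<in> N' f} / card (cylinder \<Omega> C f))"
  proof -
    have "mean_log \<Omega> (insert p' C) = mean_log \<Omega> {..<Suc c}"
      using assms by (subst mean_log_lessThan) (auto simp: C_def p'_def r)
    moreover have "card K' = c + j" unfolding K'_def by (subst card_Un_disjoint) (auto simp: r)
    then have "mean_log \<Omega> K' = mean_log \<Omega> {..<c + j}" "mean_log \<Omega> (insert p' K') = mean_log \<Omega> {..<Suc (c + j)}"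
      using assms by (subst mean_log_lessThan; auto simp: K'_def p'_def r)+
    moreover have "(\<Sum>f\<in>\<Omega>. card {g \<in> cylinder \<Omega> C f. g p \<in> N' f} / card (cylinder \<Omega> C f))
      = (\<Sum>f\<in>\<Omega>. card {g \<in> cylinder \<Omega> C f. g p' \<in> N' f} / card (cylinder \<Omega> C f))"
      using assms by (subst cylinder_coordinate_swap[where p=p and p'=p']) (auto simp: C_def p_def p'_def r)
    ultimately show ?thesis
      using sum_projection_ge[OF finite_\<Omega> \<Omega>_nonempty, of C K' p']
      by (simp add: ent_def N'_def C_def K'_def algebra_simps)
  qed
  have "(\<Sum>f\<in>\<Omega>. card {g \<in> cylinder \<Omega> C f. g p \<in> N f} / card (cylinder \<Omega> C f)) +
     (\<Sum>f\<in>\<Omega>. card {g \<in> cylinder \<Omega> C f. g p \<in> N' f} / card (cylinder \<Omega> C f)) \<le> (\<Sum>f\<in>\<Omega>. 1)"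
    unfolding sum.distrib[symmetric]
  proof (rule sum_mono)
    fix f assume f: "f \<in> \<Omega>"
    let ?Y = "cylinder \<Omega> C f"
    have fin: "finite ?Y" by (rule finite_cylinder[OF finite_\<Omega>])
    have "card {g \<in> ?Y. g p \<in> N f} + card {g \<in> ?Y. g p \<in> N' f}
        = card ({g \<in> ?Y. g p \<in> N f} \<union> {g \<in> ?Y. g p \<in> N' f})"
      using fin disj[OF f] by (subst card_Un_disjoint) auto
    also have "\<dots> \<le> card ?Y" using fin by (intro card_mono) auto
    finally have "real (card {g \<in> ?Y. g p \<in> N f}) + card {g \<in> ?Y. g p \<in> N' f} \<le> card ?Y"
      by linarith
    then show "card {g \<in> ?Y. g p \<in> N f} / card ?Y + card {g \<in> ?Y. g p \<in> N' f} / card ?Y \<le> 1"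
      using card_cylinder_pos[OF finite_\<Omega> f, of C] by (simp add: field_simps)
  qed
  with 1 2 have "card \<Omega> * (exp (ent (c + i) - ent c) + exp (ent (c + j) - ent c)) \<le> real (card \<Omega>) * 1"
    by (simp add: distrib_left)
  then have "exp (ent (c + i) - ent c) + exp (ent (c + j) - ent c) \<le> 1"
    using \<Omega>_nonempty finite_\<Omega> by (metis card_gt_0_iff mult_le_cancel_left_pos of_nat_0_less_iff)
  \<comment> \<open>This factor passes from entropies relative to \<open>ent c\<close> to ones
    relative to \<open>ent 0\<close>; since \<open>c = r - (i + j)\<close>, the right-hand side is
    \<open>ratio (i + j)\<close>.\<close>
  then have "exp (ent c - ent 0) * (exp (ent (c + i) - ent c) + exp (ent (c + j) - ent c)) \<le> exp (ent c - ent 0)"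
    by simp
  moreover have "r - i = c + j" "r - j = c + i" using r by auto
  ultimately show ?thesis
    by (simp add: ratio_def distrib_left exp_add[symmetric] flip: c_def)
qed

lemma ratio_r: "ratio r = 1"
  by (simp add: ratio_def)

lemma sum_ratio_le: "(\<Sum>i=1..r. r * ratio i / i) \<le> r"
proof -
  have "(\<Sum>i=1..r. ratio i / i) \<le> ratio r"
    using ratio_superadditive k tail by (intro sum_div_le_of_restricted_superadditive[where k=k]) auto
  then have "real r * (\<Sum>i=1..r. ratio i / i) \<le> real r * 1" by (intro mult_left_mono) (auto simp: ratio_r)
  then show ?thesis by (simp add: sum_distrib_left)
qed

lemma mean_log_full: "mean_log \<Omega> {..<r} = 0"
proof -
  have "cylinder \<Omega> {..<r} f = {f}" if "f \<in> \<Omega>" for f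
    using that by (auto simp: cylinder_def ordered_edges_def intro!: extensionalityI[where A="{..<r}"])
  then show ?thesis by (simp add: mean_log_def)
qed

text \<open>The chain rule for entropy: \<open>ent 0\<close> to \<open>ent (r - 1)\<close> telescope
  to the total entropy \<open>ln (card \<Omega>)\<close>, as all coordinates together determine the
  ordered edge.\<close>

lemma prod_ratio: "real (card \<Omega>) = exp (ent 0) ^ r * (\<Prod>i=1..r. ratio i)"
proof -
  have "(\<Prod>i=1..r. ratio i) = (\<Prod>j<r. exp (ent j - ent 0))"
    unfolding ratio_def
    by (rule prod.reindex_bij_witness[of _ "\<lambda>j. r - j" "\<lambda>i. r - i"]) auto
  also have "\<dots> = exp ((\<Sum>j<r. ent j) - r * ent 0)"
    by (simp add: exp_sum[symmetric] sum_subtractf)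
  also have "(\<Sum>j<r. ent j) = mean_log \<Omega> {} - mean_log \<Omega> {..<r}"
    unfolding ent_def by (subst sum_lessThan_telescope') simp
  also have "\<dots> = ln (card \<Omega>)"
    using mean_log_full mean_log_empty[OF finite_\<Omega> \<Omega>_nonempty] by simp
  also have "exp (ln (card \<Omega>) - r * ent 0) = card \<Omega> / exp (ent 0) ^ r"
    using \<Omega>_nonempty finite_\<Omega> by (simp add: exp_diff exp_of_nat_mult card_gt_0_iff)
  finally show ?thesis by simp
qed

lemma exp_ent_0_le: "exp (ent 0) \<le> card V"
proof -
  have "exp (mean_log \<Omega> {} - mean_log \<Omega> {0}) \<le> card V"
  proof (rule exp_entropy_le_card_range[OF finite_\<Omega> \<Omega>_nonempty finite_V])
    fix f assume "f \<in> \<Omega>"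
    then have "f ` {..<r} \<subseteq> V" using edge by (auto simp: ordered_edges_def)
    then show "f 0 \<in> V" using k by auto
  qed
  then show ?thesis by (simp add: ent_def lessThan_Suc)
qed

lemma card_V_pos: "card V > 0"
proof -
  obtain e where "e \<in> E" using E_nonempty by auto
  then have "e \<subseteq> V" "card e = r" using edge by auto
  then show ?thesis using k finite_V by (metis card_gt_0_iff card.empty le_zero_eq not_one_le_zero subset_empty)
qed

text \<open>The edge number equals \<open>(n / r) ^ r\<close> times \<open>s ^ r\<close> times the
  product of the \<open>t i\<close>, and both extra factors are at most 1. High density therefore
  forces \<open>s\<close> and \<open>t 1\<close> close to 1, and \<open>t 1 * s * (n / r)\<close> is
  \<open>exp (ent (r - 1))\<close>.\<close>

lemma exp_ent_last_ge:
  assumes dense: "(1 - \<epsilon>) * (card V / r) ^ r \<le> card E" and \<epsilon>: "0 \<le> \<epsilon>" "\<epsilon> \<le> 1 / 2"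
  shows "(1 - sqrt (2 * \<epsilon>)) * (1 - \<epsilon>) * (card V / r) \<le> exp (ent (r - 1))"
proof -
  define n where "n = real (card V)"
  define s where "s = exp (ent 0) / n"
  define t where "t i = r * ratio i / i" for i :: nat
  have n: "n > 0" using card_V_pos by (simp add: n_def)
  have s: "0 < s" "s \<le> 1" using exp_ent_0_le n by (auto simp: s_def n_def)
  have sum_t: "sum t {1..r} \<le> card {1..r}" using sum_ratio_le by (simp add: t_def)
  have t0: "t i \<ge> 0" for i by (simp add: t_def ratio_def)
  have t1: "prod t {1..r} \<le> 1" using sum_t t0 by (intro prod_le_one_of_sum_le) auto
  have "prod t {1..r} = r ^ r * (\<Prod>i=1..r. ratio i) / fact r"
    by (simp add: t_def prod_dividef prod.distrib fact_prod)
  then have "fact r * card E = (s * n) ^ r * (fact r * prod t {1..r} / r ^ r)"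
    using prod_ratio n k by (simp add: card_\<Omega> s_def)
  then have "(fact r :: real) * card E = fact r * (s ^ r * prod t {1..r} * (n / r) ^ r)"
    by (simp add: power_mult_distrib power_divide mult_ac)
  then have "real (card E) = s ^ r * prod t {1..r} * (n / r) ^ r"
    using mult_left_cancel[OF fact_nonzero] by blast
  with dense have "(1 - \<epsilon>) * (n / r) ^ r \<le> s ^ r * prod t {1..r} * (n / r) ^ r"
    by (simp add: n_def)
  then have st: "1 - \<epsilon> \<le> s ^ r * prod t {1..r}"
    using n k by (subst (asm) mult_le_cancel_right_pos) auto
  have "s ^ r \<le> 1" using s by (simp add: power_le_one)
  then have "s ^ r * prod t {1..r} \<le> prod t {1..r}" using t0 by (simp add: mult_left_le_one_le prod_nonneg s(1) less_imp_le)
  with st have "1 - \<epsilon> \<le> prod t {1..r}" by simp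
  then have "t 1 \<ge> 1 - sqrt (2 * \<epsilon>)"
    using sum_t t0 \<epsilon> k by (intro factor_ge_of_prod_ge[of "{1..r}"]) auto
  moreover have "s \<ge> 1 - \<epsilon>"
  proof -
    have "s ^ r * prod t {1..r} \<le> s ^ r" using t1 s by (simp add: mult_left_le)
    moreover have "s ^ r \<le> s ^ 1" using s k by (intro power_decreasing) auto
    ultimately show ?thesis using st by simp
  qed
  ultimately have "(1 - sqrt (2 * \<epsilon>)) * (1 - \<epsilon>) \<le> t 1 * s"
    using \<epsilon> s t0[of 1] by (intro mult_mono) auto
  then have "(1 - sqrt (2 * \<epsilon>)) * (1 - \<epsilon>) * (n / r) \<le> t 1 * s * (n / r)"
    using n by (intro mult_right_mono) auto
  also have "\<dots> = ratio 1 * exp (ent 0)" using n k by (simp add: t_def s_def)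
  also have "\<dots> = exp (ent (r - 1))" by (simp add: ratio_def exp_add[symmetric])
  finally show ?thesis by (simp add: n_def)
qed

text \<open>The vertices that can replace the \<open>j\<close>-th vertex of the ordered edge \<open>f\<close>. For a well chosen \<open>f\<close>,
  these sets are the parts of an almost \<open>r\<close>-partition of the vertex set.\<close>

definition fibre :: "(nat \<Rightarrow> 'a) \<Rightarrow> nat \<Rightarrow> 'a set" where
  "fibre f j = (\<lambda>g. g j) ` cylinder \<Omega> ({..<r} - {j}) f"

lemma card_fibre: "card (fibre f j) = card (cylinder \<Omega> ({..<r} - {j}) f)"
  unfolding fibre_def
proof (rule card_image, rule inj_onI)
  fix g h assume g: "g \<in> cylinder \<Omega> ({..<r} - {j}) f" "h \<in> cylinder \<Omega> ({..<r} - {j}) f" "g j = h j"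
  show "g = h"
  proof (rule extensionalityI[where A="{..<r}"])
    fix i assume "i \<in> {..<r}"
    then show "g i = h i" using g by (cases "i = j") (auto simp: cylinder_def)
  qed (use g in \<open>auto simp: cylinder_def ordered_edges_def\<close>)
qed

lemma fibre_subset: "j < r \<Longrightarrow> fibre f j \<subseteq> V"
  using edge by (auto simp: fibre_def cylinder_def ordered_edges_def)

lemma fibreE:
  assumes "f \<in> \<Omega>" "v \<in> fibre f j" "j < r"
  obtains "v \<notin> f ` ({..<r} - {j})" "insert v (f ` ({..<r} - {j})) \<in> E"
proof -
  obtain g where g: "g \<in> \<Omega>" "\<And>i. i < r \<Longrightarrow> i \<noteq> j \<Longrightarrow> g i = f i" "v = g j"
    using assms by (auto simp: fibre_def cylinder_def)
  have im: "g ` ({..<r} - {j}) = f ` ({..<r} - {j})" using g by (intro image_cong) auto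
  have "g ` {..<r} = insert v (g ` ({..<r} - {j}))"
    using g(3) assms(3) by (metis image_insert insert_Diff lessThan_iff)
  then have "insert v (f ` ({..<r} - {j})) \<in> E" using g(1) im by (auto simp: ordered_edges_def)
  moreover have "inj_on g {..<r}" using g(1) by (simp add: ordered_edges_def)
  then have "v \<notin> g ` ({..<r} - {j})" unfolding g(3) using assms(3) by (auto dest: inj_onD)
  ultimately show ?thesis using that im by metis
qed

text \<open>If \<open>e\<close> contained \<open>u\<close> and \<open>w\<close> from the fibre, then
  with \<open>?B\<close> the other vertices of \<open>f\<close>, the edges
  \<open>insert u ?B\<close>, \<open>e\<close> and \<open>insert w ?B\<close> would form a
  homomorphic tent with \<open>A = {u}\<close>.\<close>

lemma fibre_independent:
  assumes "f \<in> \<Omega>" "j < r" "e \<in> E"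
  shows "card (e \<inter> fibre f j) \<le> 1"
proof (rule ccontr)
  assume no: "\<not> ?thesis"
  have "finite e" using assms edge finite_V finite_subset by blast
  then have "finite (e \<inter> fibre f j)" by simp
  with no have "\<not> (\<forall>x\<in>e \<inter> fibre f j. \<forall>y\<in>e \<inter> fibre f j. x = y)"
    by (simp add: card_le_Suc0_iff_eq)
  then obtain u w where uw: "u \<in> e" "w \<in> e" "u \<in> fibre f j" "w \<in> fibre f j" "u \<noteq> w" by auto
  let ?B = "f ` ({..<r} - {j})"
  have B: "u \<notin> ?B" "insert u ?B \<in> E" "w \<notin> ?B" "insert w ?B \<in> E"
    using fibreE[OF assms(1) uw(3) assms(2)] fibreE[OF assms(1) uw(4) assms(2)] by metis+
  show False
    by (rule hom_tent_freeD[OF htf B(2), of "{u}" w e "insert w ?B"]) (use B uw assms k in auto)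
qed

text \<open>A vertex that can replace both \<open>f i\<close> and \<open>f j\<close> yields a
  homomorphic tent on the edge of \<open>f\<close> with \<open>A = {f j}\<close>: the replacement at
  \<open>i\<close> keeps \<open>f j\<close>, the replacement at \<open>j\<close> keeps everything
  else.\<close>

lemma fibre_disjoint:
  assumes "f \<in> \<Omega>" "i < r" "j < r" "i \<noteq> j"
  shows "fibre f i \<inter> fibre f j = {}"
proof (rule ccontr)
  assume "\<not> ?thesis"
  then obtain w where w: "w \<in> fibre f i" "w \<in> fibre f j" by auto
  have B: "w \<notin> f ` ({..<r} - {i})" "insert w (f ` ({..<r} - {i})) \<in> E"
     "w \<notin> f ` ({..<r} - {j})" "insert w (f ` ({..<r} - {j})) \<in> E"
    using fibreE[OF assms(1) w(1) assms(2)] fibreE[OF assms(1) w(2) assms(3)] by metis+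
  have inj: "inj_on f {..<r}" and mem: "f ` {..<r} \<in> E" using assms by (auto simp: ordered_edges_def)
  have "w \<notin> f ` {..<r}" using B assms by blast
  moreover have "f ` {..<r} - {f j} = f ` ({..<r} - {j})"
    using inj assms by (auto simp: inj_on_def)
  ultimately show False
    by (intro hom_tent_freeD[OF htf mem, of "{f j}" w "insert w (f ` ({..<r} - {i}))" "insert w (f ` ({..<r} - {j}))"])
       (use B assms k in auto)
qed

text \<open>For every position, \<open>ent (r - 1)\<close> is the mean over \<open>f\<close> of the
  logarithm of the fibre size. Some \<open>f\<close> is thus at least average for the sum over all
  positions, which bounds the product of its fibre sizes below; disjointness bounds their sum by
  \<open>card V\<close>, and stability of the two means applies.\<close>

lemma exists_large_fibres:
  assumes dense: "(1 - \<epsilon>) * (card V / r) ^ r \<le> card E" and \<epsilon>: "0 \<le> \<epsilon>" "\<epsilon> \<le> 1 / 4"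
  shows "\<exists>f\<in>\<Omega>. \<forall>j<r. (1 - sqrt (2 * (1 - ((1 - sqrt (2 * \<epsilon>)) * (1 - \<epsilon>)) ^ r))) * (card V / r) \<le> card (fibre f j)"
proof -
  define \<gamma> where "\<gamma> = (1 - sqrt (2 * \<epsilon>)) * (1 - \<epsilon>)"
  have sq: "sqrt (2 * \<epsilon>) < 1" using \<epsilon> by simp
  have \<gamma>: "0 < \<gamma>" "\<gamma> \<le> 1" unfolding \<gamma>_def using \<epsilon> sq
    by (auto intro!: mult_le_one)
  define n where "n = real (card V)"
  have n: "n > 0" using card_V_pos by (simp add: n_def)
  let ?D = "\<lambda>j f. real (card (cylinder \<Omega> ({..<r} - {j}) f))"
  have pos: "?D j f > 0" if "f \<in> \<Omega>" for j f using card_cylinder_pos[OF finite_\<Omega> that] by simp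
  have last: "mean_log \<Omega> ({..<r} - {j}) = ent (r - 1)" if "j < r" for j
  proof -
    have "mean_log \<Omega> ({..<r} - {j}) = mean_log \<Omega> {..<r - 1}"
      using that by (subst mean_log_lessThan) auto
    then show ?thesis using k mean_log_full by (simp add: ent_def)
  qed
  have "\<exists>f\<in>\<Omega>. r * ent (r - 1) \<le> (\<Sum>j<r. ln (?D j f))"
  proof (rule ccontr)
    assume "\<not> ?thesis"
    then have "(\<Sum>f\<in>\<Omega>. \<Sum>j<r. ln (?D j f)) < (\<Sum>f\<in>\<Omega>. r * ent (r - 1))"
      using finite_\<Omega> \<Omega>_nonempty by (intro sum_strict_mono) auto
    also have "(\<Sum>f\<in>\<Omega>. \<Sum>j<r. ln (?D j f)) = (\<Sum>j<r. \<Sum>f\<in>\<Omega>. ln (?D j f))" by (rule sum.swap)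
    also have "\<dots> = (\<Sum>j<r. card \<Omega> * mean_log \<Omega> ({..<r} - {j}))"
      using finite_\<Omega> \<Omega>_nonempty by (simp add: mean_log_def)
    also have "\<dots> = (\<Sum>j<r. card \<Omega> * ent (r - 1))" using last by simp
    finally show False by simp
  qed
  then obtain f where f: "f \<in> \<Omega>" "r * ent (r - 1) \<le> (\<Sum>j<r. ln (?D j f))" by blast
  define u where "u j = r * ?D j f / n" for j
  have u0: "u j \<ge> 0" for j using n by (simp add: u_def)
  have "(\<Sum>j<r. card (fibre f j)) = card (\<Union>j<r. fibre f j)"
    using fibre_subset finite_V fibre_disjoint[OF f(1)]
    by (subst card_UN_disjoint) (auto intro: finite_subset)
  also have "\<dots> \<le> card V" using fibre_subset finite_V by (intro card_mono) auto
  finally have "real (\<Sum>j<r. card (fibre f j)) \<le> n" unfolding n_def by (rule of_nat_mono)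
  then have sum_u: "sum u {..<r} \<le> card {..<r}"
    using n mult_left_mono[of "\<Sum>j<r. ?D j f" n "real r"]
    by (simp add: u_def card_fibre sum_divide_distrib[symmetric] sum_distrib_left[symmetric] divide_le_eq)
  have "\<gamma> ^ r * (n / r) ^ r \<le> exp (ent (r - 1)) ^ r"
    unfolding power_mult_distrib[symmetric] \<gamma>_def n_def
    using exp_ent_last_ge[OF dense \<epsilon>(1)] \<epsilon> \<gamma> by (intro power_mono) (auto simp: \<gamma>_def)
  also have "\<dots> = exp (r * ent (r - 1))" by (simp add: exp_of_nat_mult)
  also have "\<dots> \<le> exp (\<Sum>j<r. ln (?D j f))" using f by simp
  also have "\<dots> = (\<Prod>j<r. ?D j f)" using pos[OF f(1)] by (simp add: exp_sum)
  also have "\<dots> = (\<Prod>j<r. u j * (n / r))" using n k by (simp add: u_def)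
  also have "\<dots> = (\<Prod>j<r. u j) * (n / r) ^ r" by (simp add: prod.distrib del: times_divide_eq_right)
  finally have "\<gamma> ^ r \<le> prod u {..<r}"
    using n k by (subst (asm) mult_le_cancel_right_pos) auto
  then have prod_u: "1 - (1 - \<gamma> ^ r) \<le> prod u {..<r}" by simp
  have "1 - sqrt (2 * (1 - \<gamma> ^ r)) \<le> u j" if "j < r" for j
    using sum_u u0 that \<gamma> by (intro factor_ge_of_prod_ge[OF _ _ _ prod_u]) (auto simp: power_le_one)
  then have "(1 - sqrt (2 * (1 - \<gamma> ^ r))) * (n / r) \<le> card (fibre f j)" if "j < r" for j
  proof -
    have "(1 - sqrt (2 * (1 - \<gamma> ^ r))) * (n / r) \<le> u j * (n / r)"
      using \<open>\<And>j. j < r \<Longrightarrow> 1 - sqrt (2 * (1 - \<gamma> ^ r)) \<le> u j\<close>[OF that] n by (intro mult_right_mono) auto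
    also have "\<dots> = card (fibre f j)" using n k by (simp add: u_def card_fibre)
    finally show ?thesis .
  qed
  then show ?thesis using f(1) by (auto simp: \<gamma>_def n_def)
qed

end

lemma hom_tent_free_stability:
  fixes r k :: nat and \<delta> :: real
  assumes k: "1 \<le> k" "k \<le> r" "r \<le> 3 * k" and tail: "(\<Sum>i=Suc k..r. 1 / real i) \<le> 1"
    and \<delta>: "\<delta> > 0"
  shows "\<exists>\<epsilon>>0. \<forall>(V::'a set) E. finite V \<longrightarrow> (\<forall>e\<in>E. e \<subseteq> V \<and> card e = r) \<longrightarrow> E \<noteq> {} \<longrightarrow>
    hom_tent_free k E \<longrightarrow> (1 - \<epsilon>) * (card V / r) ^ r \<le> card E \<longrightarrow>
    (\<exists>P. (\<forall>j<r. P j \<subseteq> V \<and> (1 - \<delta>) * (card V / r) \<le> card (P j)) \<and>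
         (\<forall>i<r. \<forall>j<r. i \<noteq> j \<longrightarrow> P i \<inter> P j = {}) \<and> (\<forall>e\<in>E. \<forall>j<r. card (e \<inter> P j) \<le> 1))"
proof -
  \<comment> \<open>The relative loss from \<open>exists_large_fibres\<close>. It is continuous with
    value 0 at 0, so a positive \<open>\<epsilon>\<close> with loss below \<open>\<delta>\<close>
    exists without solving for it.\<close>
  define F where "F \<epsilon> = sqrt (2 * (1 - ((1 - sqrt (2 * \<epsilon>)) * (1 - \<epsilon>)) ^ r))" for \<epsilon> :: real
  have F: "(F \<longlongrightarrow> F 0) (at_right 0)"
    unfolding F_def by (intro tendsto_intros)
  have "F 0 < \<delta>" using \<delta> by (simp add: F_def)
  then have "\<forall>\<^sub>F \<epsilon> in at_right 0. F \<epsilon> < \<delta>" by (rule order_tendstoD(2)[OF F])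
  moreover have "\<forall>\<^sub>F \<epsilon> in at_right (0::real). \<epsilon> < 1 / 4"
    by (rule eventually_at_rightI[of 0 "1/4"]) auto
  moreover have "\<forall>\<^sub>F \<epsilon> in at_right (0::real). 0 < \<epsilon>"
    by (simp add: eventually_at_right_less)
  ultimately have "\<forall>\<^sub>F \<epsilon> in at_right 0. F \<epsilon> < \<delta> \<and> \<epsilon> < 1 / 4 \<and> 0 < \<epsilon>" by eventually_elim simp
  then obtain \<epsilon> where \<epsilon>: "F \<epsilon> < \<delta>" "\<epsilon> < 1 / 4" "0 < \<epsilon>"
    using eventually_happens by force
  show ?thesis
  proof (rule exI[of _ \<epsilon>], intro conjI allI impI)
    fix V :: "'a set" and E
    assume *: "finite V" "\<forall>e\<in>E. e \<subseteq> V \<and> card e = r" "E \<noteq> {}" "hom_tent_free k E"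
      "(1 - \<epsilon>) * (card V / r) ^ r \<le> card E"
    then interpret dense_hom_tent_free r k V E using k tail by unfold_locales auto
    obtain f where f: "f \<in> \<Omega>" "\<And>j. j < r \<Longrightarrow> (1 - F \<epsilon>) * (card V / r) \<le> card (fibre f j)"
      using exists_large_fibres[OF *(5)] \<epsilon> by (auto simp: F_def)
    have "(1 - \<delta>) * (card V / r) \<le> card (fibre f j)" if "j < r" for j
    proof -
      have "(1 - \<delta>) * (card V / r) \<le> (1 - F \<epsilon>) * (card V / r)"
        using \<epsilon> by (intro mult_right_mono) auto
      also have "\<dots> \<le> card (fibre f j)" using f that by blast
      finally show ?thesis .
    qed
    then show "\<exists>P. (\<forall>j<r. P j \<subseteq> V \<and> (1 - \<delta>) * (card V / r) \<le> card (P j)) \<and>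
         (\<forall>i<r. \<forall>j<r. i \<noteq> j \<longrightarrow> P i \<inter> P j = {}) \<and> (\<forall>e\<in>E. \<forall>j<r. card (e \<inter> P j) \<le> 1)"
      using fibre_subset fibre_disjoint fibre_independent f(1)
      by (intro exI[of _ "fibre f"]) blast
  qed (use \<epsilon> in auto)
qed

section \<open>Removing few edges to destroy homomorphic tents\<close>

text \<open>The prescribed intersections fix the sizes of \<open>A\<close>, \<open>B\<close>,
  \<open>C\<close>, \<open>D\<close> and \<open>{v}\<close>, which are matched with consecutive
  intervals of the tent's vertices; \<open>v\<close> plays \<open>2 * r - 1\<close>, and
  \<open>D\<close> is empty when \<open>i = 1\<close>.\<close>

lemma contains_tent:
  assumes "finite V" and e: "e1 \<in> E" "e2 \<in> E" "e3 \<in> E" "e1 \<union> e2 \<union> e3 \<subseteq> V"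
    and card: "card e1 = r" "card e2 = r" "card e3 = r"
    and i: "card A = i" "1 \<le> i" "i < r"
    and int: "e1 \<inter> e2 = A" "e1 \<inter> e3 = e1 - A" "e2 \<inter> e3 = {v}" "v \<notin> e1"
  shows "contains_copy (V, E) (tent r i)"
proof -
  define B C D where "B = e1 - A" and "C = e2 - A - {v}" and "D = e3 - B - {v}"
  have fin: "finite e1" "finite e2" "finite e3" using assms finite_subset by auto
  have sub: "A \<subseteq> e1" "A \<subseteq> e2" "v \<in> e2" "v \<in> e3" "B \<subseteq> e3" "v \<notin> A" "v \<notin> B" using int by (auto simp: B_def)
  have cB: "card B = r - i" unfolding B_def using fin sub card i by (simp add: card_Diff_subset finite_subset)
  have cC: "card C = r - i - 1" unfolding C_def using fin sub card i by (simp add: card_Diff_subset finite_subset)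
  have cD: "card D = i - 1" unfolding D_def using fin sub card i cB by (simp add: card_Diff_subset finite_subset)
  have finA: "finite A" "finite B" "finite C" "finite D" using fin sub finite_subset by (auto simp: B_def C_def D_def)
  obtain fA where fA: "bij_betw fA {1..i} A" using finite_same_card_bij[of "{1..i}" A] finA i by auto
  obtain fB where fB: "bij_betw fB {i+1..r} B" using finite_same_card_bij[of "{i+1..r}" B] finA i cB by auto
  obtain fC where fC: "bij_betw fC {r+1..2*r-i-1} C" using finite_same_card_bij[of "{r+1..2*r-i-1}" C] finA i cC by auto
  obtain fD where fD: "bij_betw fD {2*r-i..2*r-2} D" using finite_same_card_bij[of "{2*r-i..2*r-2}" D] finA i cD by auto
  define f where "f x = (if x \<in> {1..i} then fA x else if x \<in> {i+1..r} then fB x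
     else if x \<in> {r+1..2*r-i-1} then fC x else if x \<in> {2*r-i..2*r-2} then fD x else v)" for x
  have bA: "bij_betw f {1..i} A" using fA by (subst bij_betw_cong[of _ f fA]) (auto simp: f_def)
  have bB: "bij_betw f {i+1..r} B" using fB by (subst bij_betw_cong[of _ f fB]) (auto simp: f_def)
  have bC: "bij_betw f {r+1..2*r-i-1} C" using fC i by (subst bij_betw_cong[of _ f fC]) (auto simp: f_def)
  have bD: "bij_betw f {2*r-i..2*r-2} D" using fD i by (subst bij_betw_cong[of _ f fD]) (auto simp: f_def)
  have bv: "bij_betw f {2*r-1} {v}" using i by (auto simp: f_def bij_betw_def)
  have CD: "C \<inter> D = {}" "D \<inter> A = {}" "C \<inter> B = {}" using int by (auto simp: B_def C_def D_def)
  have "bij_betw f ({1..i} \<union> {i+1..r} \<union> {r+1..2*r-i-1} \<union> {2*r-i..2*r-2} \<union> {2*r-1}) (A \<union> B \<union> C \<union> D \<union> {v})"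
    by (intro bij_betw_combine bA bB bC bD bv) (use CD sub in \<open>auto simp: B_def C_def D_def\<close>)
  moreover have V: "{1..i} \<union> {i+1..r} \<union> {r+1..2*r-i-1} \<union> {2*r-i..2*r-2} \<union> {2*r-1} = {1..2*r-1}"
    using i by auto
  ultimately have bij: "bij_betw f {1..2*r-1} (A \<union> B \<union> C \<union> D \<union> {v})" by simp
  have im: "f ` {1..i} = A" "f ` {i+1..r} = B" "f ` {r+1..2*r-i-1} = C" "f ` {2*r-i..2*r-2} = D" "f (2*r-1) = v"
    using bA bB bC bD bv by (simp_all add: bij_betw_def)
  have "{1..r} = {1..i} \<union> {i+1..r}" using i by auto
  then have 1: "f ` {1..r} = e1" using im sub by (auto simp: image_Un B_def)
  have 2: "f ` ({1..i} \<union> {r + 1..2 * r - i - 1} \<union> {2 * r - 1}) = e2"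
    unfolding image_Un im using im sub by (auto simp: C_def)
  have "{i + 1..r} \<union> {2 * r - i..2 * r - 1} = {i + 1..r} \<union> {2*r-i..2*r-2} \<union> {2*r-1}" using i by auto
  then have 3: "f ` ({i + 1..r} \<union> {2 * r - i..2 * r - 1}) = e3"
    using im sub by (auto simp: image_Un D_def)
  have "A \<union> B \<union> C \<union> D \<union> {v} \<subseteq> V" using e(4) sub by (auto simp: B_def C_def D_def)
  then have "inj_on f {1..2*r-1}" "f ` {1..2*r-1} \<subseteq> V" using bij by (simp_all add: bij_betw_def)
  moreover have "f ` X \<in> E" if "X \<in> hedges (tent r i)" for X
  proof -
    from that consider "X = {1..r}" | "X = {1..i} \<union> {r + 1..2 * r - i - 1} \<union> {2 * r - 1}"
      | "X = {i + 1..r} \<union> {2 * r - i..2 * r - 1}"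
      unfolding tent_def snd_conv by blast
    then show ?thesis by cases (simp_all only: 1 2 3 e)
  qed
  moreover have "verts (tent r i) = {1..2*r-1}" by (simp add: tent_def)
  ultimately show ?thesis unfolding contains_copy_def by (intro exI[of _ f]) simp
qed

section \<open>Counting edges through a set, and rich subfamilies\<close>

lemma finite_edges: "finite V \<Longrightarrow> (\<And>e. e \<in> E \<Longrightarrow> e \<subseteq> V) \<Longrightarrow> finite E"
  by (rule finite_subset[of E "Pow V"]) auto

lemma card_edges_containing_le:
  assumes "finite V" "\<And>e. e \<in> F \<Longrightarrow> e \<subseteq> V \<and> card e = r \<and> T \<subseteq> e" "finite T"
  shows "card F \<le> card V ^ (r - card T)"
proof -
  have "card F = card ((\<lambda>e. e - T) ` F)"
    using assms(2) by (intro card_image[symmetric] inj_onI) (metis Diff_partition)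
  also have "\<dots> \<le> card {X. X \<subseteq> V \<and> card X = r - card T}"
    using assms by (intro card_mono) (auto simp: card_Diff_subset)
  also have "\<dots> = card V choose (r - card T)" using assms by (simp add: n_subsets)
  also have "\<dots> \<le> card V ^ (r - card T)"
    by (cases "r - card T \<le> card V") (auto simp: binomial_le_pow binomial_eq_0)
  finally show ?thesis .
qed

lemma card_edges_meeting_le:
  assumes "finite V" "\<And>e. e \<in> F \<Longrightarrow> e \<subseteq> V \<and> card e = r \<and> T \<subseteq> e \<and> e \<inter> Z \<noteq> {}" "finite T" "finite Z" "T \<inter> Z = {}"
  shows "card F \<le> card Z * card V ^ (r - card T - 1)"
proof -
  have "e \<inter> Z \<noteq> {}" if "e \<in> F" for e using assms(2)[OF that] by simp
  then have "F = (\<Union>z\<in>Z. {e\<in>F. z \<in> e})" by blast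
  then have "card F = card (\<Union>z\<in>Z. {e\<in>F. z \<in> e})" by simp
  also have "\<dots> \<le> (\<Sum>z\<in>Z. card {e\<in>F. z \<in> e})" using assms(4) by (rule card_UN_le)
  also have "\<dots> \<le> (\<Sum>z\<in>Z. card V ^ (r - card T - 1))"
  proof (rule sum_mono)
    fix z assume z: "z \<in> Z"
    have "card {e\<in>F. z \<in> e} \<le> card V ^ (r - card (insert z T))"
      using assms by (intro card_edges_containing_le) auto
    moreover have "card (insert z T) = Suc (card T)" using z assms by (subst card_insert_disjoint) auto
    ultimately show "card {e\<in>F. z \<in> e} \<le> card V ^ (r - card T - 1)" by simp
  qed
  finally show ?thesis by simp
qed

text \<open>Any part of an edge extends to an edge avoiding \<open>q\<close> prescribed vertices
  outside that part. This is what turns homomorphic tents into genuine ones.\<close>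

definition rich :: "nat \<Rightarrow> 'a set set \<Rightarrow> bool" where
  "rich q E \<longleftrightarrow> (\<forall>e\<in>E. \<forall>S Z. S \<subseteq> e \<longrightarrow> finite Z \<longrightarrow> card Z \<le> q \<longrightarrow> S \<inter> Z = {} \<longrightarrow>
     (\<exists>e'\<in>E. S \<subseteq> e' \<and> e' \<inter> Z = {}))"

text \<open>Take the subfamily that maximises the number of edges minus a weight for every set in its
  shadow: deleting the edges through a set that violates richness would increase this quantity.\<close>

lemma exists_rich_subfamily:
  assumes "finite V" "V \<noteq> {}" and edge: "\<And>e. e \<in> E \<Longrightarrow> e \<subseteq> V \<and> card e = r"
  shows "\<exists>E'\<subseteq>E. rich q E' \<and> card E \<le> card E' + r * (q + 1) * card V ^ (r - 1)"
proof -
  define n where "n = card V"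
  have n: "n \<ge> 1" using assms by (simp add: n_def Suc_le_eq card_gt_0_iff)
  define sh where "sh F = {S. S \<subseteq> V \<and> card S < r \<and> (\<exists>e\<in>F. S \<subseteq> e)}" for F :: "'a set set"
  \<comment> \<open>The factor \<open>q + 1\<close> beats the at most
    \<open>q * n ^ (r - card S - 1)\<close> edges through \<open>S\<close> that meet
    \<open>Z\<close>. The at most \<open>n ^ s\<close> sets of size \<open>s\<close> have total
    weight at most \<open>(q + 1) * n ^ (r - 1)\<close>, and there are \<open>r\<close> sizes.
    Integers are used since \<open>\<Phi>\<close> can be negative.\<close>
  define w where "w S = int ((q + 1) * n ^ (r - card S - 1))" for S :: "'a set"
  define \<Phi> where "\<Phi> F = int (card F) - (\<Sum>S\<in>sh F. w S)" for F
  have finE: "finite E" using assms(1) edge by (blast intro: finite_edges)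
  have finsh: "finite (sh F)" for F using assms(1) by (simp add: sh_def)
  have w0: "w S \<ge> 0" for S by (simp add: w_def)
  have "\<exists>E'\<in>Pow E. \<forall>F\<in>Pow E. \<Phi> F \<le> \<Phi> E'"
  proof -
    have "finite (\<Phi> ` Pow E)" "\<Phi> ` Pow E \<noteq> {}" using finE by auto
    then have "Max (\<Phi> ` Pow E) \<in> \<Phi> ` Pow E" "\<And>x. x \<in> \<Phi> ` Pow E \<Longrightarrow> x \<le> Max (\<Phi> ` Pow E)"
      by (rule Max_in, simp)
    then show ?thesis by (metis (no_types, lifting) imageE imageI)
  qed
  then obtain E' where E': "E' \<subseteq> E" "\<And>F. F \<subseteq> E \<Longrightarrow> \<Phi> F \<le> \<Phi> E'" by auto
  have "rich q E'"
  proof (rule ccontr)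
    assume "\<not> rich q E'"
    then obtain e S Z where eSZ: "e \<in> E'" "S \<subseteq> e" "finite Z" "card Z \<le> q" "S \<inter> Z = {}"
       and "\<not> (\<exists>e'\<in>E'. S \<subseteq> e' \<and> e' \<inter> Z = {})"
      unfolding rich_def by metis
    then have no: "\<And>e'. e' \<in> E' \<Longrightarrow> S \<subseteq> e' \<Longrightarrow> e' \<inter> Z \<noteq> {}" by blast
    define F where "F = {e'\<in>E'. \<not> S \<subseteq> e'}"
    have e: "e \<subseteq> V" "card e = r" using eSZ(1) E'(1) edge by blast+
    then have fine: "finite e" using assms(1) finite_subset by blast
    have S: "S \<subseteq> V" "finite S" using eSZ e finite_subset[OF _ fine] by auto
    have "S \<noteq> e" using no[OF eSZ(1,2)] eSZ by auto
    then have "card S < r" using eSZ(2) e psubset_card_mono[OF fine] by blast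
    then have Ssh: "S \<in> sh E'" using eSZ S by (auto simp: sh_def)
    have "card (E' - F) \<le> card Z * card V ^ (r - card S - 1)"
    proof (rule card_edges_meeting_le[OF assms(1) _ S(2) eSZ(3,5)])
      fix e' assume e': "e' \<in> E' - F"
      then have "e' \<subseteq> V \<and> card e' = r" using E'(1) edge by blast
      then show "e' \<subseteq> V \<and> card e' = r \<and> S \<subseteq> e' \<and> e' \<inter> Z \<noteq> {}" using e' no by (auto simp: F_def)
    qed
    also have "\<dots> \<le> q * n ^ (r - card S - 1)" using eSZ by (simp add: n_def)
    finally have "int (card (E' - F)) \<le> int (q * n ^ (r - card S - 1))" by linarith
    moreover have "int (q * n ^ (r - card S - 1)) < w S" using n by (simp add: w_def)
    ultimately have lt: "int (card (E' - F)) < w S" by linarith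
    have "card E' = card F + card (E' - F)"
      using finE E' by (subst card_Un_disjoint[symmetric]) (auto simp: F_def finite_subset intro!: arg_cong[where f=card])
    moreover have "(\<Sum>S\<in>sh F. w S) \<le> (\<Sum>S\<in>sh E' - {S}. w S)"
      using finsh w0 by (intro sum_mono2) (auto simp: sh_def F_def)
    moreover have "(\<Sum>S\<in>sh E'. w S) = w S + (\<Sum>S\<in>sh E' - {S}. w S)"
      using finsh Ssh by (rule sum.remove)
    ultimately have "\<Phi> E' < \<Phi> F" using lt by (simp add: \<Phi>_def)
    moreover have "F \<subseteq> E" using E'(1) unfolding F_def by blast
    then have "\<Phi> F \<le> \<Phi> E'" by (rule E'(2))
    ultimately show False by simp
  qed
  moreover have "(\<Sum>S\<in>sh E. w S) \<le> int (r * (q + 1) * n ^ (r - 1))"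
  proof -
    have "(\<Sum>S\<in>sh E. w S) \<le> (\<Sum>S\<in>{S. S \<subseteq> V \<and> card S < r}. w S)"
      using assms(1) w0 by (intro sum_mono2) (auto simp: sh_def)
    also have "{S. S \<subseteq> V \<and> card S < r} = (\<Union>s<r. {S. S \<subseteq> V \<and> card S = s})" by auto
    also have "(\<Sum>S\<in>\<dots>. w S) = (\<Sum>s<r. \<Sum>S\<in>{S. S \<subseteq> V \<and> card S = s}. w S)"
      using assms(1) by (intro sum.UNION_disjoint) auto
    also have "\<dots> \<le> (\<Sum>s<r. int ((q + 1) * n ^ (r - 1)))"
    proof (rule sum_mono)
      fix s assume s: "s \<in> {..<r}"
      have "(\<Sum>S\<in>{S. S \<subseteq> V \<and> card S = s}. w S) = int ((n choose s) * ((q + 1) * n ^ (r - s - 1)))"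
        using assms(1) by (simp add: w_def n_subsets n_def)
      moreover have "n choose s \<le> n ^ s"
        by (cases "s \<le> n") (auto simp: binomial_le_pow binomial_eq_0)
      then have "(n choose s) * ((q + 1) * n ^ (r - s - 1)) \<le> n ^ s * ((q + 1) * n ^ (r - s - 1))"
        by (rule mult_le_mono1)
      moreover have "n ^ s * ((q + 1) * n ^ (r - s - 1)) = (q + 1) * (n ^ s * n ^ (r - s - 1))"
        by (simp only: mult_ac)
      moreover have "n ^ s * n ^ (r - s - 1) = n ^ (r - 1)"
        using s by (simp add: power_add[symmetric])
      ultimately show "(\<Sum>S\<in>{S. S \<subseteq> V \<and> card S = s}. w S) \<le> int ((q + 1) * n ^ (r - 1))"
        by (metis of_nat_mono)
    qed
    finally show ?thesis by (simp add: algebra_simps)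
  qed
  then have "int (card E) \<le> int (card E' + r * (q + 1) * n ^ (r - 1))"
    using E'(2)[of E] sum_nonneg[of "sh E'" w] w0 unfolding \<Phi>_def by simp
  then have "card E \<le> card E' + r * (q + 1) * n ^ (r - 1)" by linarith
  ultimately show ?thesis using E'(1) by (auto simp: n_def)
qed

text \<open>The second and third edge are chosen anew: \<open>e2\<close> through
  \<open>insert v A\<close> avoiding \<open>e1 - A\<close>, then \<open>e3\<close> through
  \<open>insert v (e1 - A)\<close> avoiding \<open>e2 - {v}\<close>, hence also \<open>A\<close>.
  Both avoided sets have at most \<open>r\<close> elements, and only the prescribed intersections
  remain.\<close>

lemma hom_tent_free_of_rich:
  assumes "finite V" and edge: "\<And>e. e \<in> E \<Longrightarrow> e \<subseteq> V \<and> card e = r"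
    and E': "E' \<subseteq> E" "rich r E'" and free: "family_free (tent_family r k) (V, E)" and k: "k < r"
  shows "hom_tent_free k E'"
  unfolding hom_tent_free_def
proof (intro ballI allI impI notI)
  fix e1 A v
  assume e1: "e1 \<in> E'" and A: "A \<subseteq> e1" "1 \<le> card A" "card A \<le> k" and v: "v \<notin> e1"
    and ex: "(\<exists>e'\<in>E'. insert v A \<subseteq> e') \<and> (\<exists>e'\<in>E'. insert v (e1 - A) \<subseteq> e')"
  have uni: "e \<subseteq> V \<and> card e = r \<and> finite e" if "e \<in> E'" for e
    using edge[of e] that E'(1) assms(1) by (auto intro: finite_subset)
  have rich: "\<exists>e'\<in>E'. S \<subseteq> e' \<and> e' \<inter> Z = {}"
    if "e \<in> E'" "S \<subseteq> e" "finite Z" "card Z \<le> r" "S \<inter> Z = {}" for e S Z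
    using E'(2) that unfolding rich_def by blast
  from ex obtain e2' e3' where "e2' \<in> E'" "insert v A \<subseteq> e2'" "e3' \<in> E'" "insert v (e1 - A) \<subseteq> e3'" by auto
  have "card (e1 - A) \<le> r" using uni[OF e1] by (metis Diff_subset card_mono)
  then obtain e2 where e2: "e2 \<in> E'" "insert v A \<subseteq> e2" "e2 \<inter> (e1 - A) = {}"
    using rich[OF \<open>e2' \<in> E'\<close> \<open>insert v A \<subseteq> e2'\<close>, of "e1 - A"] v uni[OF e1] by auto
  have "card (e2 - {v}) \<le> r" using uni[OF e2(1)] by (metis Diff_subset card_mono)
  then obtain e3 where e3: "e3 \<in> E'" "insert v (e1 - A) \<subseteq> e3" "e3 \<inter> (e2 - {v}) = {}"
    using rich[OF \<open>e3' \<in> E'\<close> \<open>insert v (e1 - A) \<subseteq> e3'\<close>, of "e2 - {v}"] e2 uni[OF e2(1)] by auto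
  have "contains_copy (V, E) (tent r (card A))"
    by (rule contains_tent[where ?e1.0=e1 and ?e2.0=e2 and ?e3.0=e3 and v=v and A=A])
       (use assms(1) E' uni e1 e2 e3 A v k in auto)
  then show False using free A by (auto simp: family_free_def tent_family_def)
qed

text \<open>The case \<open>i = 1\<close> is all that is needed to pass from the approximate to the exact result.\<close>

lemma no_generalized_triangle:
  assumes "finite V" and edge: "\<And>e. e \<in> E \<Longrightarrow> e \<subseteq> V \<and> card e = r"
    and free: "family_free (tent_family r k) (V, E)" and k: "1 \<le> k" "2 \<le> r"
    and "insert u S \<in> E" "insert v S \<in> E" "f \<in> E" "u \<in> f" "v \<in> f" "u \<noteq> v" "f \<inter> S = {}"
  shows False
proof -
  have "u \<notin> S" "v \<notin> S" using assms by auto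
  then have "contains_copy (V, E) (tent r 1)"
    using edge[of f] edge[of "insert u S"] edge[of "insert v S"] assms
    by (intro contains_tent[where ?e1.0="insert u S" and ?e2.0=f and ?e3.0="insert v S" and v=v and A="{u}"]) auto
  then show False using free k by (auto simp: family_free_def tent_family_def)
qed

section \<open>Colouring an approximately partite hypergraph\<close>

definition transversals :: "(nat \<Rightarrow> 'a set) \<Rightarrow> nat set \<Rightarrow> 'a set set" where
  "transversals P I = {X. X \<subseteq> (\<Union>i\<in>I. P i) \<and> (\<forall>i\<in>I. card (X \<inter> P i) = 1)}"

lemma transversals_eq_image:
  assumes "disjoint_family_on P I"
  shows "transversals P I = (\<lambda>f. f ` I) ` (PiE I P)"
proof (intro set_eqI iffI)
  fix X assume X: "X \<in> transversals P I"
  define f where "f = restrict (\<lambda>i. the_elem (X \<inter> P i)) I"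
  have fi: "X \<inter> P i = {f i}" if "i \<in> I" for i
  proof -
    have "card (X \<inter> P i) = 1" using X that by (simp add: transversals_def)
    then obtain x where "X \<inter> P i = {x}" by (auto simp: card_1_singleton_iff)
    then show ?thesis using that by (simp add: f_def)
  qed
  have "f \<in> PiE I P" using fi by (auto simp: f_def)
  moreover have "X = f ` I" using fi X unfolding transversals_def by blast
  ultimately show "X \<in> (\<lambda>f. f ` I) ` (PiE I P)" by blast
next
  fix X assume "X \<in> (\<lambda>f. f ` I) ` (PiE I P)"
  then obtain f where f: "f \<in> PiE I P" "X = f ` I" by auto
  have "X \<inter> P i = {f i}" if "i \<in> I" for i
  proof -
    have "j = i" if "j \<in> I" "f j \<in> P i" for j
      using f(1) \<open>i \<in> I\<close> that assms by (force simp: PiE_iff disjoint_family_on_def)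
    then show ?thesis using f that by (auto simp: PiE_iff)
  qed
  then show "X \<in> transversals P I" using f by (auto simp: transversals_def)
qed

lemma card_transversals:
  assumes "finite I" "disjoint_family_on P I"
  shows "card (transversals P I) = (\<Prod>i\<in>I. card (P i))"
proof -
  have "inj_on (\<lambda>f. f ` I) (PiE I P)"
  proof (rule inj_onI)
    fix f g assume f: "f \<in> PiE I P" and g: "g \<in> PiE I P" and eq: "f ` I = g ` I"
    have "f i = g i" if i: "i \<in> I" for i
    proof -
      have "f i \<in> g ` I" using eq i by auto
      then obtain j where j: "j \<in> I" "f i = g j" by auto
      then have "f i \<in> P i \<inter> P j" using f g i by (auto simp: PiE_iff)
      then have "i = j" using assms(2) i j unfolding disjoint_family_on_def by blast
      then show ?thesis using j by simp
    qed
    then show "f = g" using f g by (intro PiE_ext[of f I P]) auto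
  qed
  then have "card (transversals P I) = card (PiE I P)"
    unfolding transversals_eq_image[OF assms(2)] by (rule card_image)
  then show ?thesis using assms(1) by (simp add: card_PiE)
qed

lemma card_mem_transversals:
  assumes "finite I" "disjoint_family_on P I" "X \<in> transversals P I"
  shows "card X = card I"
proof -
  obtain f where f: "f \<in> PiE I P" "X = f ` I"
    using assms(3) unfolding transversals_eq_image[OF assms(2)] by auto
  have "inj_on f I"
  proof (rule inj_onI)
    fix i j assume "i \<in> I" "j \<in> I" "f i = f j"
    then show "i = j" using f assms(2) by (force simp: PiE_iff disjoint_family_on_def)
  qed
  then show ?thesis using f by (simp add: card_image)
qed

lemma transversals_subset: "X \<in> transversals P I \<Longrightarrow> i \<in> I \<Longrightarrow> \<exists>x. x \<in> X \<and> x \<in> P i"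
proof -
  assume "X \<in> transversals P I" "i \<in> I"
  then have "X \<inter> P i \<noteq> {}" by (auto simp: transversals_def)
  then show ?thesis by blast
qed

text \<open>The sets \<open>P j\<close> need not cover \<open>V\<close>. The number \<open>m\<close>
  is the tolerance of missing transversals through a typical vertex; all counting conditions are
  left to the individual lemmas.\<close>

locale approx_partite =
  fixes r k :: nat and V :: "'a set" and E :: "'a set set" and P :: "nat \<Rightarrow> 'a set" and m :: real
  assumes finite_V: "finite V" and edge: "\<And>e. e \<in> E \<Longrightarrow> e \<subseteq> V \<and> card e = r"
    and free: "family_free (tent_family r k) (V, E)" and k: "1 \<le> k" and r: "2 \<le> r"
    and P_subset: "\<And>j. j < r \<Longrightarrow> P j \<subseteq> V"
    and P_disjoint: "\<And>i j. i < r \<Longrightarrow> j < r \<Longrightarrow> i \<noteq> j \<Longrightarrow> P i \<inter> P j = {}"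
begin

section \<open>Missing transversals, typical vertices and links\<close>

definition missing :: "'a \<Rightarrow> 'a set set" where
  "missing v = {X \<in> transversals P {..<r}. v \<in> X \<and> X \<notin> E}"

definition typical :: "'a set" where
  "typical = {v \<in> (\<Union>j<r. P j). real (card (missing v)) \<le> m}"

definition link :: "'a \<Rightarrow> 'a set set" where
  "link v = {S. S \<subseteq> typical \<and> v \<notin> S \<and> insert v S \<in> E}"

abbreviation partial_transversals :: "nat \<Rightarrow> 'a set set" where
  "partial_transversals j \<equiv> transversals P ({..<r} - {j})"

lemma disjoint: "I \<subseteq> {..<r} \<Longrightarrow> disjoint_family_on P I"
  using P_disjoint by (auto simp: disjoint_family_on_def subset_iff)

lemma no_triangle:
  "insert u S \<in> E \<Longrightarrow> insert v S \<in> E \<Longrightarrow> f \<in> E \<Longrightarrow> u \<in> f \<Longrightarrow> v \<in> f \<Longrightarrow> u \<noteq> v \<Longrightarrow> f \<inter> S = {} \<Longrightarrow> False"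
  by (rule no_generalized_triangle[OF finite_V edge free k r])

lemma transversal_subset: "X \<in> transversals P I \<Longrightarrow> I \<subseteq> {..<r} \<Longrightarrow> X \<subseteq> V"
proof -
  assume X: "X \<in> transversals P I" and I: "I \<subseteq> {..<r}"
  have "P i \<subseteq> V" if "i \<in> I" for i using P_subset[of i] I that by auto
  then have "(\<Union>i\<in>I. P i) \<subseteq> V" by (rule UN_least)
  then show "X \<subseteq> V" using X unfolding transversals_def by blast
qed

lemma finite_edge: "e \<in> E \<Longrightarrow> finite e"
  using edge finite_V finite_subset by blast

lemma finite_missing: "finite (missing v)"
proof (rule finite_subset)
  show "missing v \<subseteq> Pow V" using transversal_subset by (auto simp: missing_def)
qed (use finite_V in simp)

lemma typical_subset: "typical \<subseteq> V"
  using P_subset by (auto simp: typical_def)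

lemma partial_transversal:
  assumes "S \<in> partial_transversals j" "j < r"
  shows "S \<subseteq> V" "card S = r - 1" "S \<inter> P j = {}" "finite S"
proof -
  show "S \<subseteq> V" using transversal_subset[OF assms(1)] by auto
  then show "finite S" using finite_V finite_subset by blast
  show "card S = r - 1" using card_mem_transversals[OF _ disjoint assms(1)] assms(2) by simp
  show "S \<inter> P j = {}" using assms P_disjoint by (fastforce simp: transversals_def)
qed

lemma finite_partial_transversals: "j < r \<Longrightarrow> finite (partial_transversals j)"
  using partial_transversal(1) finite_V by (intro finite_edges) auto

lemma insert_partial_transversal:
  assumes "S \<in> partial_transversals j" "j < r" "u \<in> P j"
  shows "insert u S \<in> transversals P {..<r}"
proof -
  have "card (insert u S \<inter> P i) = 1" if "i < r" for i
  proof (cases "i = j")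
    case True
    then have "insert u S \<inter> P i = {u}" using partial_transversal(3)[OF assms(1,2)] assms(3) by auto
    then show ?thesis by simp
  next
    case False
    then have "u \<notin> P i" using P_disjoint[of i j] that assms by auto
    then show ?thesis using assms(1) that False by (auto simp: transversals_def)
  qed
  then show ?thesis using assms by (auto simp: transversals_def)
qed

lemma card_non_extending_le:
  assumes "F \<subseteq> partial_transversals j" "j < r" "u \<in> P j"
  shows "card {S \<in> F. insert u S \<notin> E} \<le> card (missing u)"
proof -
  have u: "u \<notin> S" if "S \<in> F" for S using partial_transversal(3)[of S j] assms that by auto
  have "card {S \<in> F. insert u S \<notin> E} = card (insert u ` {S \<in> F. insert u S \<notin> E})"
    using u by (intro card_image[symmetric] inj_onI) (metis (no_types, lifting) insert_ident mem_Collect_eq)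
  also have "\<dots> \<le> card (missing u)"
    using insert_partial_transversal[of _ j u] assms
    by (intro card_mono finite_missing) (auto simp: missing_def)
  finally show ?thesis .
qed

lemma card_partial_meeting_le:
  assumes "F \<subseteq> partial_transversals j" "j < r" "e \<in> E"
  shows "card {S \<in> F. S \<inter> e \<noteq> {}} \<le> r * card V ^ (r - 2)"
proof -
  have "card {S \<in> F. S \<inter> e \<noteq> {}} \<le> card e * card V ^ (r - 1 - card ({} :: 'a set) - 1)"
  proof (rule card_edges_meeting_le[OF finite_V])
    fix S assume "S \<in> {S \<in> F. S \<inter> e \<noteq> {}}"
    then have "S \<in> partial_transversals j" "S \<inter> e \<noteq> {}" using assms(1) by auto
    then show "S \<subseteq> V \<and> card S = r - 1 \<and> {} \<subseteq> S \<and> S \<inter> e \<noteq> {}"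
      using partial_transversal[OF _ assms(2)] by auto
  qed (use finite_edge[OF assms(3)] in auto)
  then show ?thesis using edge[OF assms(3)] r by (simp add: numeral_2_eq_2)
qed

text \<open>All but \<open>2 * m\<close> partial transversals omitting class \<open>j\<close> extend
  to edges by both \<open>u\<close> and \<open>w\<close>, and few meet \<open>e\<close>. A remaining
  one forms the forbidden triangle with \<open>e\<close>.\<close>

lemma typical_unique:
  assumes large: "2 * m + r * card V ^ (r - 2) < card (partial_transversals j)"
    and "j < r" "e \<in> E" "u \<in> e" "w \<in> e" "u \<in> typical \<inter> P j" "w \<in> typical \<inter> P j"
  shows "u = w"
proof (rule ccontr)
  assume ne: "u \<noteq> w"
  let ?T = "partial_transversals j"
  have fin: "finite ?T" using finite_partial_transversals assms by blast
  have "\<exists>S\<in>?T. insert u S \<in> E \<and> insert w S \<in> E \<and> S \<inter> e = {}"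
  proof (rule ccontr)
    assume "\<not> ?thesis"
    then have "?T \<subseteq> {S \<in> ?T. insert u S \<notin> E} \<union> {S \<in> ?T. insert w S \<notin> E} \<union> {S \<in> ?T. S \<inter> e \<noteq> {}}" by auto
    then have "card ?T \<le> card ({S \<in> ?T. insert u S \<notin> E} \<union> {S \<in> ?T. insert w S \<notin> E} \<union> {S \<in> ?T. S \<inter> e \<noteq> {}})"
      using fin by (intro card_mono) auto
    also have "\<dots> \<le> card {S \<in> ?T. insert u S \<notin> E} + card {S \<in> ?T. insert w S \<notin> E} + card {S \<in> ?T. S \<inter> e \<noteq> {}}"
      by (meson add_le_cancel_right card_Un_le order_trans)
    also have "\<dots> \<le> card (missing u) + card (missing w) + r * card V ^ (r - 2)"
      using assms by (intro add_mono card_non_extending_le card_partial_meeting_le) auto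
    finally have "real (card ?T) \<le> card (missing u) + card (missing w) + r * card V ^ (r - 2)" by linarith
    moreover have "card (missing u) \<le> m" "card (missing w) \<le> m" using assms by (auto simp: typical_def)
    ultimately show False using large by simp
  qed
  then obtain S where "insert u S \<in> E" "insert w S \<in> E" "e \<inter> S = {}" by auto
  from no_triangle[OF this(1,2) assms(3,4,5) ne this(3)] show False .
qed

text \<open>The \<open>r - 1\<close> vertices of \<open>S\<close> lie in distinct classes by
  \<open>typical_unique\<close>, so exactly one class is missed.\<close>

lemma link_partial_transversal:
  assumes large: "\<forall>j<r. 2 * m + r * card V ^ (r - 2) < card (partial_transversals j)"
    and S: "S \<in> link v"
  shows "\<exists>j<r. S \<in> partial_transversals j"
proof -
  have e: "insert v S \<in> E" "v \<notin> S" "S \<subseteq> typical" using S by (auto simp: link_def)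
  have fin: "finite S" using finite_edge[OF e(1)] by simp
  have "card (insert v S) = Suc (card S)" using e(2) fin by simp
  then have cS: "card S = r - 1" using edge[OF e(1)] by linarith
  have cover: "S \<subseteq> (\<Union>j<r. P j)" using e(3) by (auto simp: typical_def)
  have le1: "card (S \<inter> P j) \<le> 1" if "j < r" for j
  proof -
    have "\<forall>x\<in>S \<inter> P j. \<forall>y\<in>S \<inter> P j. x = y"
      using typical_unique[OF large[rule_format, OF that] that e(1)] e(3) by auto
    then show ?thesis using fin by (simp add: card_le_Suc0_iff_eq)
  qed
  have sum: "card S = (\<Sum>j<r. card (S \<inter> P j))"
  proof -
    have "S = (\<Union>j<r. S \<inter> P j)" using cover by auto
    then have "card S = card (\<Union>j<r. S \<inter> P j)" by simp
    also have "\<dots> = (\<Sum>j<r. card (S \<inter> P j))"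
      using fin P_disjoint by (intro card_UN_disjoint) auto
    finally show ?thesis .
  qed
  have "\<exists>j<r. card (S \<inter> P j) = 0"
  proof (rule ccontr)
    assume "\<not> ?thesis"
    then have "(\<Sum>j<r. 1) \<le> (\<Sum>j<r. card (S \<inter> P j))" by (intro sum_mono) (auto simp: Suc_le_eq)
    then show False using sum cS r by simp
  qed
  then obtain j where j: "j < r" "card (S \<inter> P j) = 0" by auto
  have "card (S \<inter> P i) = 1" if i: "i \<in> {..<r} - {j}" for i
  proof (rule ccontr)
    assume "card (S \<inter> P i) \<noteq> 1"
    then have i0: "card (S \<inter> P i) = 0" using le1[of i] i by auto
    have "(\<Sum>l<r. card (S \<inter> P l)) = (\<Sum>l\<in>{..<r} - {i, j}. card (S \<inter> P l))"
      using i0 j i by (intro sum.mono_neutral_right) auto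
    also have "\<dots> \<le> (\<Sum>l\<in>{..<r} - {i, j}. 1)" using le1 by (intro sum_mono) auto
    also have "\<dots> = r - 2" using i j by (simp add: card_Diff_subset)
    finally show False using sum cS r by simp
  qed
  moreover have "S \<inter> P j = {}" using j fin by simp
  then have "S \<subseteq> (\<Union>i\<in>{..<r} - {j}. P i)" using cover by blast
  ultimately have "S \<in> partial_transversals j" by (auto simp: transversals_def)
  then show ?thesis using j by auto
qed

text \<open>A member \<open>S'\<close> of the link omitting another class contains a typical
  \<open>u\<close> in \<open>P j\<close>. Among the many \<open>S\<close> of the link omitting
  \<open>j\<close>, one avoids \<open>insert v S'\<close> and extends by \<open>u\<close>; then
  \<open>insert u S\<close>, \<open>insert v S\<close> and \<open>insert v S'\<close> form the
  forbidden triangle.\<close>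

lemma link_in_one_class:
  assumes large: "\<forall>j<r. 2 * m + r * card V ^ (r - 2) < card (partial_transversals j)"
    and j: "j < r" and big: "m + r * card V ^ (r - 2) < card (link v \<inter> partial_transversals j)"
  shows "link v \<subseteq> partial_transversals j"
proof (rule ccontr)
  assume "\<not> ?thesis"
  then obtain S' where S': "S' \<in> link v" "S' \<notin> partial_transversals j" by auto
  then obtain j' where j': "j' < r" "S' \<in> partial_transversals j'"
    using link_partial_transversal[OF large] by blast
  then have "j' \<noteq> j" using S' by auto
  then obtain u where u: "u \<in> S'" "u \<in> P j" using transversals_subset[OF j'(2), of j] j by auto
  have e': "insert v S' \<in> E" "v \<notin> S'" "u \<in> typical" using S' u by (auto simp: link_def)
  let ?L = "link v \<inter> partial_transversals j"
  have fin: "finite ?L" using finite_partial_transversals[OF j] by simp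
  have "\<exists>S\<in>?L. insert u S \<in> E \<and> S \<inter> insert v S' = {}"
  proof (rule ccontr)
    assume "\<not> ?thesis"
    then have "?L \<subseteq> {S \<in> ?L. insert u S \<notin> E} \<union> {S \<in> ?L. S \<inter> insert v S' \<noteq> {}}" by auto
    then have "card ?L \<le> card ({S \<in> ?L. insert u S \<notin> E} \<union> {S \<in> ?L. S \<inter> insert v S' \<noteq> {}})"
      by (rule card_mono[rotated]) (rule finite_subset[OF _ fin], blast)
    also have "\<dots> \<le> card {S \<in> ?L. insert u S \<notin> E} + card {S \<in> ?L. S \<inter> insert v S' \<noteq> {}}"
      by (rule card_Un_le)
    also have "\<dots> \<le> card (missing u) + r * card V ^ (r - 2)"
      using j u e' by (intro add_mono card_non_extending_le card_partial_meeting_le) auto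
    finally have "real (card ?L) \<le> card (missing u) + r * card V ^ (r - 2)" by linarith
    moreover have "card (missing u) \<le> m" using e' by (simp add: typical_def)
    ultimately show False using big by simp
  qed
  then obtain S where S: "S \<in> link v" "insert u S \<in> E" "insert v S' \<inter> S = {}" by auto
  then have "insert v S \<in> E" "u \<noteq> v" using u e' by (auto simp: link_def)
  then show False
    using no_triangle[OF S(2) _ e'(1), of v] u S(3) by auto
qed

lemma card_link_ge:
  assumes "v \<in> V"
  shows "real (card {e\<in>E. v \<in> e}) - card (V - typical) * card V ^ (r - 2) \<le> card (link v)"
proof -
  have finE: "finite E" using finite_V edge by (blast intro: finite_edges)
  have finl: "finite (link v)"
    using typical_subset finite_V by (intro finite_edges[of V]) (auto simp: link_def)
  \<comment> \<open>The vertex \<open>v\<close> may itself be atypical, so it is exempted.\<close>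
  let ?bad = "{e\<in>E. v \<in> e \<and> e \<inter> (V - typical - {v}) \<noteq> {}}"
  have "{e\<in>E. v \<in> e} \<subseteq> insert v ` link v \<union> ?bad"
  proof
    fix e assume e: "e \<in> {e\<in>E. v \<in> e}"
    show "e \<in> insert v ` link v \<union> ?bad"
    proof (cases "e \<inter> (V - typical - {v}) = {}")
      case True
      then have "e - {v} \<subseteq> typical" using e edge[of e] by blast
      then have "e - {v} \<in> link v" using e by (auto simp: link_def insert_absorb)
      moreover have "e = insert v (e - {v})" using e by auto
      ultimately show ?thesis by blast
    qed (use e in auto)
  qed
  then have "card {e\<in>E. v \<in> e} \<le> card (insert v ` link v \<union> ?bad)"
    using finE finl by (intro card_mono) auto
  also have "\<dots> \<le> card (link v) + card ?bad"
    by (meson add_le_cancel_right card_Un_le card_image_le finl order_trans)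
  also have "card ?bad \<le> card (V - typical - {v}) * card V ^ (r - card {v} - 1)"
    using finite_V edge by (intro card_edges_meeting_le[OF finite_V]) auto
  also have "card (V - typical - {v}) * card V ^ (r - card {v} - 1) \<le> card (V - typical) * card V ^ (r - 2)"
    using finite_V by (intro mult_mono card_mono) (auto simp: numeral_2_eq_2)
  finally have "card {e\<in>E. v \<in> e} \<le> card (link v) + card (V - typical) * card V ^ (r - 2)" by simp
  then show ?thesis by linarith
qed

text \<open>By pigeonhole one class is omitted by so many members of the link of \<open>v\<close>
  that all members omit it; it is the colour of \<open>v\<close>, typical or not. Links of two
  vertices of equal colour fill more than half of the same set system, so they share a set disjoint
  from a given edge, and an edge containing both vertices would complete a triangle.\<close>

lemma rainbow_colouring:
  fixes \<kappa> :: real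
  assumes large: "\<forall>j<r. 2 * m + r * card V ^ (r - 2) < card (partial_transversals j)"
    and deg: "\<And>v. v \<in> V \<Longrightarrow> \<kappa> + card (V - typical) * card V ^ (r - 2) \<le> card {e\<in>E. v \<in> e}"
    and \<kappa>: "r * (m + r * card V ^ (r - 2)) < \<kappa>"
    and small: "\<And>j. j < r \<Longrightarrow> card (partial_transversals j) + r * card V ^ (r - 2) < 2 * \<kappa>"
  shows "\<exists>c. (\<forall>v\<in>V. c v < r) \<and> (\<forall>e\<in>E. inj_on c e)"
proof -
  have link: "\<kappa> \<le> card (link v)" if "v \<in> V" for v using deg[OF that] card_link_ge[OF that] by simp
  have "\<exists>j<r. link v \<subseteq> partial_transversals j" if v: "v \<in> V" for v
  proof (rule ccontr)
    assume no: "\<not> ?thesis"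
    have "link v = (\<Union>j<r. link v \<inter> partial_transversals j)"
      using link_partial_transversal[OF large] by blast
    then have "card (link v) \<le> (\<Sum>j<r. card (link v \<inter> partial_transversals j))"
      by (metis card_UN_le finite_lessThan)
    then have "real (card (link v)) \<le> (\<Sum>j<r. real (card (link v \<inter> partial_transversals j)))" 
      by (metis of_nat_mono of_nat_sum)
    also have "\<dots> \<le> (\<Sum>j<r. m + r * card V ^ (r - 2))"
      using no link_in_one_class[OF large] by (intro sum_mono) (metis lessThan_iff linorder_not_le)
    finally show False using \<kappa> link[OF v] by simp
  qed
  then obtain c where c: "\<And>v. v \<in> V \<Longrightarrow> c v < r \<and> link v \<subseteq> partial_transversals (c v)" by metis
  have "inj_on c e" if e: "e \<in> E" for e
  proof (rule inj_onI, rule ccontr)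
    fix u v assume uv: "u \<in> e" "v \<in> e" "c u = c v" "u \<noteq> v"
    have V: "u \<in> V" "v \<in> V" using uv edge[OF e] by auto
    define j where "j = c v"
    let ?T = "partial_transversals j"
    have j: "j < r" "link u \<subseteq> ?T" "link v \<subseteq> ?T" using c[OF V(1)] c[OF V(2)] uv by (auto simp: j_def)
    have finT: "finite ?T" using finite_partial_transversals[OF j(1)] .
    then have fin: "finite (link u)" "finite (link v)" using j finite_subset by blast+
    have "card (link u) + card (link v) = card (link u \<union> link v) + card (link u \<inter> link v)"
      using fin by (rule card_Un_Int)
    also have "\<dots> \<le> card ?T + card (link u \<inter> link v)"
      using finT j by (intro add_right_mono card_mono) auto
    finally have "2 * \<kappa> \<le> card ?T + real (card (link u \<inter> link v))"
      using link[OF V(1)] link[OF V(2)] by linarith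
    then have "real (r * card V ^ (r - 2)) < real (card (link u \<inter> link v))"
      using small[OF j(1)] by simp
    then have big: "r * card V ^ (r - 2) < card (link u \<inter> link v)" by (simp only: of_nat_less_iff)
    have "\<exists>S\<in>link u \<inter> link v. S \<inter> e = {}"
    proof (rule ccontr)
      assume "\<not> ?thesis"
      then have "link u \<inter> link v = {S \<in> link u \<inter> link v. S \<inter> e \<noteq> {}}" by auto
      then have "card (link u \<inter> link v) \<le> r * card V ^ (r - 2)"
        using card_partial_meeting_le[of "link u \<inter> link v" j e] j e by auto
      then show False using big by linarith
    qed
    then obtain S where "insert u S \<in> E" "insert v S \<in> E" "e \<inter> S = {}" by (auto simp: link_def)
    from no_triangle[OF this(1,2) e uv(1,2,4) this(3)] show False .
  qed
  then show ?thesis using c by blast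
qed

text \<open>Markov's inequality, each missing transversal being counted once for each of its
  \<open>r\<close> vertices.\<close>

lemma card_atypical_le:
  assumes "m > 0" 
  shows "real (card ((\<Union>j<r. P j) - typical)) \<le> r * card (transversals P {..<r} - E) / m"
proof -
  let ?U = "(\<Union>j<r. P j)" and ?M = "transversals P {..<r} - E"
  have U: "?U \<subseteq> V" using P_subset by auto
  have finU: "finite ?U" using U finite_V finite_subset by blast
  have Msub: "X \<subseteq> ?U" if "X \<in> ?M" for X using that by (auto simp: transversals_def)
  have finM: "finite ?M" using Msub finU by (blast intro: finite_edges)
  have "m * card (?U - typical) = (\<Sum>v\<in>?U - typical. m)" by simp
  also have "\<dots> \<le> (\<Sum>v\<in>?U - typical. real (card (missing v)))"
    by (intro sum_mono) (auto simp: typical_def)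
  also have "\<dots> \<le> (\<Sum>v\<in>?U. real (card (missing v)))"
    using finU by (intro sum_mono2) auto
  also have "\<dots> = real (\<Sum>v\<in>?U. card {X\<in>?M. v \<in> X})"
    by (simp add: missing_def conj_ac)
  also have "(\<Sum>v\<in>?U. card {X\<in>?M. v \<in> X}) = (\<Sum>X\<in>?M. card {v\<in>?U. v \<in> X})"
    using sum.swap_restrict[OF finU finM, of "\<lambda>_ _. 1::nat" "\<lambda>v X. v \<in> X"] by simp
  also have "\<dots> = (\<Sum>X\<in>?M. r)"
  proof (intro sum.cong refl)
    fix X assume X: "X \<in> ?M"
    then have "{v\<in>?U. v \<in> X} = X" using Msub by auto
    then show "card {v\<in>?U. v \<in> X} = r"
      using X card_mem_transversals[of "{..<r}" P X] disjoint[of "{..<r}"] by auto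
  qed
  finally have "m * card (?U - typical) \<le> r * card ?M" by (simp add: mult.commute)
  then show ?thesis using assms by (simp add: field_simps)
qed

end

section \<open>Large minimum degree forces a rainbow colouring\<close>

lemma sum_degrees:
  assumes "finite V" "\<And>e. e \<in> E \<Longrightarrow> e \<subseteq> V \<and> card e = r"
  shows "(\<Sum>v\<in>V. card {e\<in>E. v \<in> e}) = r * card E"
proof -
  have finE: "finite E" using assms by (blast intro: finite_edges)
  have "(\<Sum>v\<in>V. card {e\<in>E. v \<in> e}) = (\<Sum>e\<in>E. card {v\<in>V. v \<in> e})"
    using sum.swap_restrict[OF assms(1) finE, of "\<lambda>_ _. 1::nat" "\<lambda>v e. v \<in> e"] by simp
  also have "\<dots> = (\<Sum>e\<in>E. r)"
  proof (intro sum.cong refl)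
    fix e assume "e \<in> E"
    then have "{v\<in>V. v \<in> e} = e" "card e = r" using assms(2) by auto
    then show "card {v\<in>V. v \<in> e} = r" by simp
  qed
  finally show ?thesis by simp
qed

lemma transversal_of_card_le_one:
  assumes "e \<subseteq> (\<Union>j<r. P j)" "card e = r" "finite e" "disjoint_family_on P {..<r}"
    and le: "\<And>j. j < r \<Longrightarrow> card (e \<inter> P j) \<le> 1"
  shows "e \<in> transversals P {..<r}"
proof -
  have "e = (\<Union>j<r. e \<inter> P j)" using assms(1) by auto
  then have "r = card (\<Union>j<r. e \<inter> P j)" using assms(2) by simp
  also have "\<dots> = (\<Sum>j<r. card (e \<inter> P j))"
    using assms(3,4) by (intro card_UN_disjoint) (auto simp: disjoint_family_on_def)
  finally have sum: "r = (\<Sum>j<r. card (e \<inter> P j))" .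
  have "card (e \<inter> P i) = 1" if "i < r" for i
  proof (rule ccontr)
    assume "card (e \<inter> P i) \<noteq> 1"
    then have "card (e \<inter> P i) < 1" using le[OF that] by simp
    then have "(\<Sum>j<r. card (e \<inter> P j)) < (\<Sum>j<r. 1)"
      using le that by (intro sum_strict_mono_ex1) auto
    then show False using sum by simp
  qed
  then show ?thesis using assms(1) by (auto simp: transversals_def)
qed

text \<open>Up to rounding, \<open>b\<close> is the vertex degree in the balanced complete r-partite
  hypergraph. The subfamily \<open>E'\<close>, for which the parts are independent, shows that few
  transversals are missing; the degrees refer to \<open>E\<close>.\<close>

lemma colouring_of_dense:
  fixes r k :: nat and V :: "'a set" and \<epsilon> \<delta> :: real
  defines "n \<equiv> real (card V)" and "b \<equiv> (card V / r) ^ (r - 1)"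
  assumes r: "2 \<le> r" and k: "1 \<le> k" "k < r" and V: "finite V"
    and edge: "\<And>e. e \<in> E \<Longrightarrow> e \<subseteq> V \<and> card e = r"
    and free: "family_free (tent_family r k) (V, E)"
    and E': "E' \<subseteq> E" "(1 - \<delta>) * (n / r) ^ r \<le> card E'"
    and P: "\<And>j. j < r \<Longrightarrow> P j \<subseteq> V" "\<And>j. j < r \<Longrightarrow> (1 - \<delta>) * (n / r) \<le> card (P j)"
      "\<And>i j. i < r \<Longrightarrow> j < r \<Longrightarrow> i \<noteq> j \<Longrightarrow> P i \<inter> P j = {}"
      "\<And>e j. e \<in> E' \<Longrightarrow> j < r \<Longrightarrow> card (e \<inter> P j) \<le> 1"
    and \<delta>: "\<delta> = 1 / (300 * real r ^ (2 * r))"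
    and deg: "\<And>v. v \<in> V \<Longrightarrow> 15 / 16 * b \<le> card {e\<in>E. v \<in> e}"
    and n: "8 * real r ^ (r + 1) \<le> n"
  shows "\<exists>c. (\<forall>v\<in>V. c v < r) \<and> (\<forall>e\<in>E. inj_on c e)"
proof -
  \<comment> \<open>With this choice, and \<open>r * n ^ (r - 2)\<close> at most
    \<open>b / (8 * r)\<close> by the bound on \<open>n\<close>, the errors summed over the
    \<open>r\<close> classes stay below \<open>b / 4\<close>.\<close>
  define m where "m = b / (8 * r)"
  interpret approx_partite r k V E P m
    using r k V edge free P by unfold_locales auto
  have r0: "real r > 0" "real r \<ge> 2" using r by auto
  have rpow: "real r ^ (r + 1) > 0" using r0 by simp
  have n0: "n > 0" using n rpow by linarith
  have b0: "b > 0" using n0 r0 by (simp add: b_def n_def)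
  have m0: "m > 0" using b0 r0 by (simp add: m_def)
  have nr: "(n / r) ^ r = b * (n / r)"
    using r by (subst power_eq_if) (simp add: b_def n_def mult_ac)
  have nb: "n ^ (r - 1) = real r ^ (r - 1) * b" using r0 by (simp add: b_def n_def power_divide)
  have \<delta>0: "\<delta> > 0" using r0 by (simp add: \<delta>)
  have rr: "real r \<le> real r ^ (2 * r)" using r0 r self_le_power[of "real r" "2 * r"] by simp
  have "real r * \<delta> \<le> real r ^ (2 * r) * \<delta>" using rr \<delta>0 by (intro mult_right_mono) auto
  also have "\<dots> = 1 / 300" using r0 by (simp add: \<delta>)
  finally have r\<delta>: "real r * \<delta> \<le> 1 / 300" .
  have "\<delta> \<le> real r * \<delta>" using r0 \<delta>0 by simp
  then have \<delta>1: "\<delta> \<le> 1 / 300" using r\<delta> by linarith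
  have n2: "n * n ^ (r - 2) = n ^ (r - 1)"
  proof -
    have "r - 1 = Suc (r - 2)" using r by simp
    then show ?thesis by (simp only: power_Suc)
  qed
  have rp: "real r ^ (r + 1) = real r ^ (r - 1) * (real r * real r)"
  proof -
    have "r + 1 = (r - 1) + 2" using r by simp
    then have "real r ^ (r + 1) = real r ^ ((r - 1) + 2)" by (rule arg_cong)
    then show ?thesis unfolding power_add by (simp add: power2_eq_square)
  qed
  have small: "r * n ^ (r - 2) \<le> b / (8 * r)"
  proof -
    have "8 * real r ^ (r + 1) * n ^ (r - 2) \<le> n * n ^ (r - 2)" using n n0 by (intro mult_right_mono) auto
    also have "n * n ^ (r - 2) = n ^ (r - 1)" by (rule n2)
    also have "\<dots> = real r ^ (r - 1) * b" by (rule nb)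
    finally have "real r ^ (r - 1) * (8 * (real r * (real r * n ^ (r - 2)))) \<le> real r ^ (r - 1) * b"
      unfolding rp by (simp only: mult_ac)
    then have "8 * (real r * (real r * n ^ (r - 2))) \<le> b"
      using r0 by simp
    then show ?thesis using r0 by (simp add: field_simps)
  qed
  have disj: "disjoint_family_on P {..<r}" by (rule disjoint) simp
  have finP: "finite (P j)" if "j < r" for j using P(1)[OF that] V finite_subset by blast
  define U where "U = (\<Union>j<r. P j)"
  have U: "U \<subseteq> V" using P(1) by (auto simp: U_def)
  then have finU: "finite U" using V finite_subset by blast
  have cU: "card U = (\<Sum>j<r. card (P j))"
    unfolding U_def using finP P(3) by (intro card_UN_disjoint) auto
  have U_le: "real (\<Sum>j<r. card (P j)) \<le> n" 
    unfolding n_def cU[symmetric] by (rule of_nat_mono[OF card_mono[OF V U]])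
  have VU: "real (card (V - U)) \<le> \<delta> * n"
  proof -
    have "(\<Sum>j<r. (1 - \<delta>) * (n / r)) \<le> (\<Sum>j<r. real (card (P j)))" using P(2) by (intro sum_mono) auto
    then have "(1 - \<delta>) * n \<le> card U" using r0 by (simp add: cU)
    moreover have "real (card (V - U)) = n - card U"
      using card_mono[OF V U] finU by (simp add: card_Diff_subset[OF _ U] n_def of_nat_diff)
    ultimately show ?thesis by (simp add: algebra_simps)
  qed
  let ?T = "transversals P {..<r}"
  have finT: "finite ?T" using transversal_subset V by (blast intro: finite_edges)
  have cT: "card ?T = (\<Prod>j<r. card (P j))" by (rule card_transversals[OF _ disj]) simp
  have T_le: "real (card ?T) \<le> (n / r) ^ r"
  proof -
    have "(\<Prod>j<r. card (P j) * (r / n)) \<le> 1"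
    proof (rule prod_le_one_of_sum_le)
      have "(\<Sum>j<r. card (P j) * (r / n)) = real (\<Sum>j<r. card (P j)) * (r / n)"
        unfolding of_nat_sum by (rule sum_distrib_right[symmetric])
      also have "\<dots> \<le> n * (r / n)" using U_le n0 by (intro mult_right_mono) auto
      finally show "(\<Sum>j<r. card (P j) * (r / n)) \<le> card {..<r}" using n0 by simp
    qed (use n0 in auto)
    then have "real (card ?T) * (r / n) ^ r \<le> 1" by (simp add: cT prod.distrib del: times_divide_eq_right)
    then have "real (card ?T) * ((r / n) ^ r * (n / r) ^ r) \<le> 1 * (n / r) ^ r"
      unfolding mult.assoc[symmetric] using n0 r0 by (intro mult_right_mono) auto
    moreover have "(r / n) ^ r * (n / r) ^ r = 1"
      using n0 r0 by (simp add: power_mult_distrib[symmetric])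
    ultimately show ?thesis by simp
  qed
  \<comment> \<open>An edge of \<open>E'\<close> inside \<open>U\<close> meets each of the
    \<open>r\<close> parts at most once and is therefore a transversal; only edges through the few
    vertices outside \<open>U\<close> are exceptional.\<close>
  have E'_le: "real (card E') \<le> card (?T \<inter> E) + \<delta> * n * n ^ (r - 1)"
  proof -
    let ?bad = "{e\<in>E'. e \<inter> (V - U) \<noteq> {}}"
    have finE: "finite E" using V edge by (blast intro: finite_edges)
    have "E' \<subseteq> (?T \<inter> E) \<union> ?bad"
    proof
      fix e assume e: "e \<in> E'"
      then have eE: "e \<in> E" using E' by auto
      show "e \<in> (?T \<inter> E) \<union> ?bad"
      proof (cases "e \<subseteq> U")
        case True
        then have "e \<in> ?T"
          using edge[OF eE] finite_edge[OF eE] P(4)[OF e] disj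
          by (intro transversal_of_card_le_one) (auto simp: U_def)
        then show ?thesis using eE by auto
      qed (use e edge[OF eE] in auto)
    qed
    then have "card E' \<le> card ((?T \<inter> E) \<union> ?bad)"
      using finE E' finT by (intro card_mono) (auto intro: finite_subset)
    also have "\<dots> \<le> card (?T \<inter> E) + card ?bad" by (rule card_Un_le)
    also have "card ?bad \<le> card (V - U) * card V ^ (r - card ({} :: 'a set) - 1)"
    proof (rule card_edges_meeting_le[OF V])
      fix e assume "e \<in> ?bad"
      then show "e \<subseteq> V \<and> card e = r \<and> {} \<subseteq> e \<and> e \<inter> (V - U) \<noteq> {}" using E'(1) edge[of e] by auto
    qed (use V in auto)
    finally have "real (card E') \<le> card (?T \<inter> E) + real (card (V - U)) * n ^ (r - 1)"
      unfolding n_def by (simp flip: of_nat_power of_nat_mult of_nat_add)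
    also have "real (card (V - U)) * n ^ (r - 1) \<le> \<delta> * n * n ^ (r - 1)"
      using VU n0 by (intro mult_right_mono) auto
    finally show ?thesis by simp
  qed
  have missing_le: "real (card (?T - E)) \<le> \<delta> * (1 + real r ^ r) * (b * (n / r))"
  proof -
    have "card (?T - E) + card (?T \<inter> E) = card ?T"
      using finT by (metis card_Diff_subset_Int card_mono finite_Int inf_le1 le_add_diff_inverse2)
    then have "real (card (?T - E)) = card ?T - real (card (?T \<inter> E))" by linarith
    also have "\<dots> \<le> (n / r) ^ r - (1 - \<delta>) * (n / r) ^ r + \<delta> * n * n ^ (r - 1)"
      using T_le E'(2) E'_le by linarith
    also have "\<dots> = \<delta> * (b * (n / r)) + \<delta> * n * (real r ^ (r - 1) * b)"
    proof -
      have "X - (1 - \<delta>) * X + Y = \<delta> * X + Y" for X Y :: real by (simp add: algebra_simps)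
      then show ?thesis unfolding nb nr .
    qed
    also have "real r ^ (r - 1) = real r ^ r / r" using r r0 by (simp add: power_diff)
    also have "\<delta> * (b * (n / r)) + \<delta> * n * (real r ^ r / r * b) = \<delta> * (1 + real r ^ r) * (b * (n / r))"
    proof -
      have "\<delta> * n * (real r ^ r / r * b) = \<delta> * real r ^ r * (b * (n / r))" by simp
      then show ?thesis by (simp only: distrib_left distrib_right mult_1_right)
    qed
    finally show ?thesis .
  qed
  have atyp: "real (card (V - typical)) * n ^ (r - 2) \<le> b / 16"
  proof -
    have "real (card (U - typical)) \<le> real r * real (card (?T - E)) / m"
      using card_atypical_le[OF m0] by (simp add: U_def)
    also have "\<dots> \<le> real r * (\<delta> * (1 + real r ^ r) * (b * (n / r))) / m"
      by (intro divide_right_mono mult_left_mono missing_le) (use m0 in auto)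
    also have "\<dots> = 8 * r * \<delta> * (1 + real r ^ r) * n" using b0 r0 by (simp add: m_def)
    finally have 1: "real (card (U - typical)) \<le> 8 * r * \<delta> * (1 + real r ^ r) * n" .
    have "card (V - typical) \<le> card ((V - U) \<union> (U - typical))"
      using V finU by (intro card_mono) auto
    also have "\<dots> \<le> card (V - U) + card (U - typical)" by (rule card_Un_le)
    finally have "real (card (V - typical)) \<le> \<delta> * n + 8 * r * \<delta> * (1 + real r ^ r) * n"
      using VU 1 by linarith
    also have "\<dots> = (1 + 8 * r + 8 * (r * real r ^ r)) * (\<delta> * n)" by (simp add: algebra_simps)
    also have "\<dots> \<le> 17 * real r ^ (r + 1) * (\<delta> * n)"
    proof (rule mult_right_mono)
      have "1 \<le> real r ^ (r + 1)" using r0 by (intro one_le_power) auto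
      moreover have "real r \<le> real r ^ (r + 1)" using r0 self_le_power[of "real r" "r + 1"] by simp
      ultimately show "1 + 8 * r + 8 * (r * real r ^ r) \<le> 17 * real r ^ (r + 1)" by simp
    qed (use \<delta>0 n0 in auto)
    finally have "real (card (V - typical)) * n ^ (r - 2) \<le> 17 * real r ^ (r + 1) * (\<delta> * n) * n ^ (r - 2)"
      using n0 by (intro mult_right_mono) auto
    also have "\<dots> = 17 * \<delta> * real r ^ (r + 1) * (n * n ^ (r - 2))" by simp
    also have "n * n ^ (r - 2) = n ^ (r - 1)" by (rule n2)
    also have "17 * \<delta> * real r ^ (r + 1) * n ^ (r - 1) = 17 * \<delta> * (real r ^ (r + 1) * real r ^ (r - 1)) * b"
      unfolding nb by (simp only: mult_ac)
    also have "real r ^ (r + 1) * real r ^ (r - 1) = real r ^ (2 * r)"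
      using r unfolding power_add[symmetric] by (intro arg_cong[where f="\<lambda>x. real r ^ x"]) simp
    \<comment> \<open>The power \<open>2 * r\<close> in \<open>\<delta>\<close> collects
      \<open>r + 1\<close> from counting atypical vertices and \<open>r - 1\<close> from rewriting
      \<open>n ^ (r - 1)\<close> in terms of \<open>b\<close>; 300 makes \<open>17 / 300\<close>
      less than \<open>1 / 16\<close>.\<close>
    also have "17 * \<delta> * real r ^ (2 * r) * b = 17 / 300 * b" using r0 by (simp add: \<delta>)
    finally show ?thesis using b0 by simp
  qed
  have part: "card (partial_transversals j) = (\<Prod>i\<in>{..<r} - {j}. card (P i))" for j
    using disjoint[of "{..<r} - {j}"] by (intro card_transversals) auto
  have part_ge: "b / 2 \<le> card (partial_transversals j)" if j: "j < r" for j
  proof -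
    have "1 + real (r - 1) * (- \<delta>) \<le> (1 + - \<delta>) ^ (r - 1)"
      using \<delta>1 by (intro Bernoulli_inequality) simp
    moreover have "real (r - 1) * \<delta> \<le> real r * \<delta>" using \<delta>0 by (intro mult_right_mono) auto
    ultimately have "1 / 2 \<le> (1 - \<delta>) ^ (r - 1)" using r\<delta> by simp
    then have "1 / 2 * b \<le> (1 - \<delta>) ^ (r - 1) * b" using b0 by (intro mult_right_mono) auto
    also have "\<dots> = ((1 - \<delta>) * (n / r)) ^ card ({..<r} - {j})"
      using j by (simp only: b_def n_def power_mult_distrib) simp
    also have "\<dots> = (\<Prod>i\<in>{..<r} - {j}. (1 - \<delta>) * (n / r))" by (rule prod_constant[symmetric])
    also have "\<dots> \<le> (\<Prod>i\<in>{..<r} - {j}. real (card (P i)))"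
      using P(2) \<delta>1 n0 by (intro prod_mono) auto
    finally show ?thesis by (simp add: part)
  qed
  have part_le: "card (partial_transversals j) \<le> 5 / 4 * b" if j: "j < r" for j
  proof -
    have "card ?T = card (P j) * card (partial_transversals j)"
      unfolding cT part using j by (intro prod.remove) auto
    then have "real (card (P j)) * card (partial_transversals j) \<le> b * (n / r)"
      using T_le nr by simp
    moreover have "4 / 5 * (n / r) * card (partial_transversals j) \<le> real (card (P j)) * card (partial_transversals j)"
    proof (rule mult_right_mono)
      have "4 / 5 * (n / r) \<le> (1 - \<delta>) * (n / r)" using \<delta>1 n0 by (intro mult_right_mono) auto
      then show "4 / 5 * (n / r) \<le> card (P j)" using P(2)[OF j] by linarith
    qed simp
    ultimately have "(n / r) * (4 / 5 * card (partial_transversals j)) \<le> (n / r) * b" by (simp add: mult_ac)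
    then have "4 / 5 * card (partial_transversals j) \<le> b" using n0 r0 by (subst (asm) mult_le_cancel_left_pos) auto
    then show ?thesis by simp
  qed
  have br: "b / (8 * r) \<le> b / 16" using b0 r0 by (intro divide_left_mono) auto
  have small': "r * real (card V ^ (r - 2)) \<le> b / 16" using small br by (simp add: n_def)
  show ?thesis
  \<comment> \<open>Of a degree of \<open>15 / 16 * b\<close>, at most \<open>b / 16\<close> is lost
    to atypical vertices. Two links of size \<open>7 / 8 * b\<close> among at most
    \<open>5 / 4 * b\<close> partial transversals overlap substantially.\<close>
  proof (rule rainbow_colouring[where \<kappa> = "7 / 8 * b"])
    show "\<forall>j<r. 2 * m + r * card V ^ (r - 2) < card (partial_transversals j)"
    proof (intro allI impI)
      fix j assume "j < r"
      moreover have "m \<le> b / 16" using br by (simp add: m_def)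
      ultimately show "2 * m + r * card V ^ (r - 2) < card (partial_transversals j)"
        using small' part_ge[of j] b0 by simp
    qed
    show "7 / 8 * b + card (V - typical) * card V ^ (r - 2) \<le> card {e\<in>E. v \<in> e}" if "v \<in> V" for v
      using deg[OF that] atyp by (simp add: n_def)
    show "r * (m + r * card V ^ (r - 2)) < 7 / 8 * b"
    proof -
      have "r * (m + r * n ^ (r - 2)) \<le> r * (b / (8 * r) + b / (8 * r))"
        using small by (intro mult_left_mono add_mono) (auto simp: m_def)
      also have "\<dots> = b / 4" using r0 by (simp add: field_simps)
      finally show ?thesis using b0 by (simp add: n_def)
    qed
    show "card (partial_transversals j) + r * card V ^ (r - 2) < 2 * (7 / 8 * b)" if "j < r" for j
      using part_le[OF that] small' b0 by simp
  qed
qed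

text \<open>The degree bound is the guaranteed growth of the Turan number when a vertex is added, so
  that its failure pays for deleting a vertex.\<close>

lemma colouring_of_min_degree:
  assumes r: "2 \<le> r" and k: "1 \<le> k" "k < r" "r \<le> 3 * k" and tail: "(\<Sum>i=Suc k..r. 1 / real i) \<le> 1"
  shows "\<exists>n0. \<forall>(V::'a set) E. finite V \<longrightarrow> n0 \<le> card V \<longrightarrow> (\<forall>e\<in>E. e \<subseteq> V \<and> card e = r) \<longrightarrow>
    family_free (tent_family r k) (V, E) \<longrightarrow>
    (\<forall>v\<in>V. ((card V - 1) div r) ^ (r - 1) \<le> card {e\<in>E. v \<in> e}) \<longrightarrow>
    (\<exists>c. (\<forall>v\<in>V. c v < r) \<and> (\<forall>e\<in>E. inj_on c e))"
proof -
  have r0: "real r \<ge> 2" using r by simp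
  define \<delta> where "\<delta> = 1 / (300 * real r ^ (2 * r))"
  have \<delta>0: "\<delta> > 0" using r0 by (simp add: \<delta>_def)
  have "1 \<le> real r ^ (2 * r)" using r0 by (intro one_le_power) auto
  then have \<delta>1: "\<delta> \<le> 1 / 300" using r by (simp add: \<delta>_def divide_le_eq_1)
  have "k \<le> r" using k by simp
  from hom_tent_free_stability[OF k(1) this k(3) tail \<delta>0, where 'a='a]
  obtain \<epsilon>0 where \<epsilon>0: "\<epsilon>0 > 0" and stab: "\<forall>(V::'a set) E. finite V \<longrightarrow> (\<forall>e\<in>E. e \<subseteq> V \<and> card e = r) \<longrightarrow>
      E \<noteq> {} \<longrightarrow> hom_tent_free k E \<longrightarrow> (1 - \<epsilon>0) * (card V / r) ^ r \<le> card E \<longrightarrow>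
      (\<exists>P. (\<forall>j<r. P j \<subseteq> V \<and> (1 - \<delta>) * (card V / r) \<le> card (P j)) \<and>
         (\<forall>i<r. \<forall>j<r. i \<noteq> j \<longrightarrow> P i \<inter> P j = {}) \<and> (\<forall>e\<in>E. \<forall>j<r. card (e \<inter> P j) \<le> 1))"
    by (elim exE conjE) (rule that)
  \<comment> \<open>The density of \<open>E'\<close> must serve both the stability result and
    \<open>colouring_of_dense\<close>.\<close>
  define \<epsilon> where "\<epsilon> = min \<epsilon>0 \<delta>"
  have \<epsilon>: "0 < \<epsilon>" "\<epsilon> \<le> \<epsilon>0" "\<epsilon> \<le> \<delta>" using \<epsilon>0 \<delta>0 by (auto simp: \<epsilon>_def)
  \<comment> \<open>The three terms bound the rounding loss in the degrees by
    \<open>\<epsilon> / 2\<close>, bound the edges lost to richness by \<open>\<epsilon> / 2\<close>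
    of \<open>(n / r) ^ r\<close>, and supply the size condition of
    \<open>colouring_of_dense\<close>.\<close>
  define N where "N = 2 * real r ^ 2 / \<epsilon> + 2 * real r ^ (r + 1) * (r + 1) / \<epsilon> + 8 * real r ^ (r + 1)"
  show ?thesis
  proof (rule exI[of _ "nat \<lceil>N\<rceil>"], intro allI impI)
    fix V :: "'a set" and E
    assume V: "finite V" and nN: "nat \<lceil>N\<rceil> \<le> card V" and edge: "\<forall>e\<in>E. e \<subseteq> V \<and> card e = r"
      and free: "family_free (tent_family r k) (V, E)"
      and deg: "\<forall>v\<in>V. ((card V - 1) div r) ^ (r - 1) \<le> card {e\<in>E. v \<in> e}"
    define n where "n = real (card V)"
    define b where "b = (n / r) ^ (r - 1)"
    have "N \<le> n" using nN unfolding n_def by linarith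
    moreover have "0 \<le> 2 * real r ^ 2 / \<epsilon>" "0 \<le> 2 * real r ^ (r + 1) * (r + 1) / \<epsilon>" "0 \<le> 8 * real r ^ (r + 1)"
      using \<epsilon> by auto
    ultimately have n: "2 * real r ^ 2 / \<epsilon> \<le> n" "2 * real r ^ (r + 1) * (r + 1) / \<epsilon> \<le> n" "8 * real r ^ (r + 1) \<le> n"
      unfolding N_def by linarith+
    have rpow: "real r ^ (r + 1) > 0" using r0 by simp
    then have n0: "n > 0" using n(3) by linarith
    have "real r \<le> real r ^ (r + 1)" by (rule self_le_power) (use r0 in auto)
    then have rn: "real r \<le> n" using n(3) rpow by linarith
    have Vne: "V \<noteq> {}" using n0 by (auto simp: n_def)
    have nr: "(n / r) ^ r = b * (n / r)"
      using r by (subst power_eq_if) (simp add: b_def mult_ac)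
    have b0: "b > 0" using n0 r0 by (simp add: b_def)
    have degb: "(1 - \<epsilon> / 2) * b \<le> card {e\<in>E. v \<in> e}" if v: "v \<in> V" for v
    proof -
      define q where "q = (card V - 1) div r"
      have "card V - 1 < r * q + r" unfolding q_def using r 
        by (metis add.commute dividend_less_times_div gr0I mult.commute not_numeral_le_zero)
      then have "card V \<le> r * q + r" by linarith
      then have "n \<le> real (r * q + r)" unfolding n_def by (rule of_nat_mono)
      then have q: "n / r - 1 \<le> q" using r0 by (simp add: field_simps)
      have "1 + real (r - 1) * (- (r / n)) \<le> (1 + - (r / n)) ^ (r - 1)"
        using rn n0 by (intro Bernoulli_inequality) simp
      moreover have "real (r - 1) * (r / n) \<le> \<epsilon> / 2"
      proof -
        have "real (r - 1) * (r / n) \<le> real r * (r / n)" using n0 by (intro mult_right_mono) auto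
        also have "\<dots> \<le> \<epsilon> / 2" using n(1) n0 \<epsilon>(1) by (simp add: field_simps power2_eq_square)
        finally show ?thesis .
      qed
      ultimately have "1 - \<epsilon> / 2 \<le> (1 - r / n) ^ (r - 1)" by simp
      then have "(1 - \<epsilon> / 2) * b \<le> (1 - r / n) ^ (r - 1) * b" using b0 by (intro mult_right_mono) auto
      also have "\<dots> = ((1 - r / n) * (n / r)) ^ (r - 1)" by (simp only: b_def power_mult_distrib)
      also have "(1 - r / n) * (n / r) = n / r - 1" using n0 r0 by (simp add: field_simps)
      also have "(n / r - 1) ^ (r - 1) \<le> real q ^ (r - 1)" using q rn r0 by (intro power_mono) auto
      also have "\<dots> \<le> card {e\<in>E. v \<in> e}" using deg v by (simp add: q_def flip: of_nat_power)
      finally show ?thesis .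
    qed
    have cE: "(1 - \<epsilon> / 2) * (n / r) ^ r \<le> card E"
    proof -
      have "(\<Sum>v\<in>V. (1 - \<epsilon> / 2) * b) \<le> (\<Sum>v\<in>V. real (card {e\<in>E. v \<in> e}))" using degb by (rule sum_mono)
      also have "\<dots> = real (r * card E)" using sum_degrees[OF V, of E r] edge by (metis of_nat_sum)
      finally have "n * ((1 - \<epsilon> / 2) * b) \<le> r * card E" by (simp add: n_def)
      then show ?thesis unfolding nr using r0 by (simp add: field_simps)
    qed
    obtain E' where E': "E' \<subseteq> E" "rich r E'" "card E \<le> card E' + r * (r + 1) * card V ^ (r - 1)"
      using exists_rich_subfamily[OF V Vne, of E r r] edge by auto
    have htf: "hom_tent_free k E'"
      using edge E' free k by (intro hom_tent_free_of_rich[OF V]) auto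
    have cE': "(1 - \<epsilon>) * (n / r) ^ r \<le> card E'"
    proof -
      have "real (card E) \<le> card E' + r * (r + 1) * n ^ (r - 1)"
        using E'(3) by (simp add: n_def flip: of_nat_power of_nat_mult of_nat_add)
      moreover have "r * (r + 1) * n ^ (r - 1) \<le> \<epsilon> / 2 * (n / r) ^ r"
      proof -
        have "real r ^ r * (r * (r + 1)) * n ^ (r - 1) \<le> \<epsilon> / 2 * n * n ^ (r - 1)"
          using n(2) n0 \<epsilon>(1) by (intro mult_right_mono) (auto simp: field_simps)
        also have "\<dots> = \<epsilon> / 2 * n ^ r" using r by (simp add: power_eq_if)
        finally show ?thesis using r0 by (simp add: power_divide field_simps)
      qed
      ultimately show ?thesis using cE by (simp add: algebra_simps)
    qed
    have nrpos: "(n / r) ^ r > 0" using n0 r0 by simp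
    have "(1 - \<epsilon>) * (n / r) ^ r > 0" using nrpos \<epsilon> \<delta>1 by simp
    then have E'ne: "E' \<noteq> {}" using cE' by auto
    have "(1 - \<epsilon>0) * (n / r) ^ r \<le> (1 - \<epsilon>) * (n / r) ^ r" "(1 - \<delta>) * (n / r) ^ r \<le> (1 - \<epsilon>) * (n / r) ^ r"
      using \<epsilon> nrpos by (intro mult_right_mono; simp)+
    then have cE'': "(1 - \<epsilon>0) * (n / r) ^ r \<le> card E'" "(1 - \<delta>) * (n / r) ^ r \<le> card E'" using cE' by linarith+
    have "\<forall>e\<in>E'. e \<subseteq> V \<and> card e = r" using edge E'(1) by auto
    from stab[THEN spec, of V, THEN spec, of E', THEN mp, OF V, THEN mp, OF this, THEN mp, OF E'ne,
        THEN mp, OF htf, THEN mp, OF cE''(1)[unfolded n_def]]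
    obtain P where P: "\<forall>j<r. P j \<subseteq> V \<and> (1 - \<delta>) * (card V / r) \<le> card (P j)"
      "\<forall>i<r. \<forall>j<r. i \<noteq> j \<longrightarrow> P i \<inter> P j = {}" "\<forall>e\<in>E'. \<forall>j<r. card (e \<inter> P j) \<le> 1" by blast
    have "15 / 16 * b \<le> card {e\<in>E. v \<in> e}" if "v \<in> V" for v
    proof -
      have "15 / 16 * b \<le> (1 - \<epsilon> / 2) * b" using \<epsilon> \<delta>1 b0 by (intro mult_right_mono) auto
      then show ?thesis using degb[OF that] by linarith
    qed
    then show "\<exists>c. (\<forall>v\<in>V. c v < r) \<and> (\<forall>e\<in>E. inj_on c e)"
      using r k V edge free E'(1) cE''(2) P \<delta>_def n(3)
      by (intro colouring_of_dense[where E'=E' and P=P and \<delta>=\<delta> and k=k]) (auto simp: n_def b_def)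
  qed
qed

section \<open>The extremal hypergraphs\<close>

abbreviation (input) turan_number :: "nat \<Rightarrow> nat \<Rightarrow> nat" where
  "turan_number r n \<equiv> card (hedges (turan_hypergraph r n))"

lemma disjoint_turan_parts: "disjoint_family_on (turan_part r n) I"
  using turan_part_disjoint by (auto simp: disjoint_family_on_def)

lemma hedges_turan_hypergraph:
  assumes "0 < r"
  shows "hedges (turan_hypergraph r n) = transversals (turan_part r n) {..<r}"
proof -
  have "hedges (turan_hypergraph r n) = {e \<in> transversals (turan_part r n) {..<r}. card e = r}"
    unfolding turan_hypergraph_def transversals_def turan_part_Union[OF assms] by auto
  moreover have "card e = r" if "e \<in> transversals (turan_part r n) {..<r}" for e
    using card_mem_transversals[OF finite_lessThan disjoint_turan_parts that] by simp
  ultimately show ?thesis by blast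
qed

lemma turan_number_eq_prod: "0 < r \<Longrightarrow> turan_number r n = (\<Prod>j<r. card (turan_part r n j))"
  by (simp add: hedges_turan_hypergraph card_transversals[OF _ disjoint_turan_parts])

text \<open>The new vertex \<open>m\<close> joins class \<open>m mod r\<close> and gains one edge
  per choice from the other \<open>r - 1\<close> classes, each of size at least
  \<open>m div r\<close>.\<close>

lemma turan_number_Suc_ge:
  assumes r: "0 < r"
  shows "turan_number r m + (m div r) ^ (r - 1) \<le> turan_number r (Suc m)"
proof -
  define j where "j = m mod r"
  have j: "j < r" using r by (simp add: j_def)
  have part: "turan_part r (Suc m) i = (if i = j then insert m (turan_part r m i) else turan_part r m i)" for i
    by (auto simp: turan_part_def less_Suc_eq j_def)
  have fin: "finite (turan_part r m i)" "m \<notin> turan_part r m i" for i by (auto simp: turan_part_def)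
  define R where "R = (\<Prod>i\<in>{..<r} - {j}. card (turan_part r m i))"
  have "turan_number r (Suc m) = card (turan_part r (Suc m) j) * (\<Prod>i\<in>{..<r} - {j}. card (turan_part r (Suc m) i))"
    unfolding turan_number_eq_prod[OF r] using j by (intro prod.remove) auto
  also have "(\<Prod>i\<in>{..<r} - {j}. card (turan_part r (Suc m) i)) = R"
    unfolding R_def by (intro prod.cong) (auto simp: part)
  also have "card (turan_part r (Suc m) j) = Suc (card (turan_part r m j))" using fin by (simp add: part)
  finally have 1: "turan_number r (Suc m) = Suc (card (turan_part r m j)) * R" .
  have "turan_number r m = card (turan_part r m j) * R"
    unfolding turan_number_eq_prod[OF r] R_def using j by (intro prod.remove) auto
  moreover have "(m div r) ^ (r - 1) \<le> R"
  proof -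
    have "(m div r) ^ card ({..<r} - {j}) = (\<Prod>i\<in>{..<r} - {j}. m div r)" by simp
    also have "\<dots> \<le> R" unfolding R_def by (intro prod_mono) (auto simp: card_turan_part)
    finally show ?thesis using j by simp
  qed
  ultimately show ?thesis using 1 by simp
qed

text \<open>Equality holds for the two part sizes \<open>q\<close> and \<open>q + 1\<close> only; since the exponents add up, multiplying
  over all parts compares a partition with the balanced one.\<close>

lemma weighted_power_le:
  fixes q x :: nat and w :: real
  defines "w \<equiv> 1 + 1 / real q"
  assumes q: "0 < q"
  shows "real x * w ^ q \<le> q * w ^ x" and "x \<noteq> q \<Longrightarrow> x \<noteq> Suc q \<Longrightarrow> real x * w ^ q < q * w ^ x"
proof -
  have w: "w > 1" using q by (simp add: w_def)
  \<comment> \<open>From \<open>y\<close> to \<open>Suc y\<close> the left side grows by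
    \<open>(y + 1) / y\<close> and the right side by \<open>w = (q + 1) / q\<close>, so their
    comparison changes direction exactly at \<open>y = q\<close>.\<close>
  have up: "real (Suc y) * w ^ q \<le> q * w ^ Suc y" if "real y * w ^ q \<le> q * w ^ y" "q \<le> y" for y
  proof -
    have "real (Suc y) \<le> w * y" using that(2) q by (simp add: w_def field_simps)
    then have "real (Suc y) * w ^ q \<le> w * y * w ^ q" using w by (intro mult_right_mono) auto
    also have "\<dots> \<le> w * (q * w ^ y)" using that(1) w by simp
    finally show ?thesis by (simp add: mult_ac)
  qed
  have up': "real (Suc y) * w ^ q < q * w ^ Suc y" if "real y * w ^ q \<le> q * w ^ y" "q < y" for y
  proof -
    have "real (Suc y) < w * y" using that(2) q by (simp add: w_def field_simps)
    then have "real (Suc y) * w ^ q < w * y * w ^ q" using w by (intro mult_strict_right_mono) auto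
    also have "\<dots> \<le> w * (q * w ^ y)" using that(1) w by simp
    finally show ?thesis by (simp add: mult_ac)
  qed
  have down: "real y * w ^ q < q * w ^ y" if "real (Suc y) * w ^ q \<le> q * w ^ Suc y" "y < q" for y
  proof -
    have "w * y < Suc y" using that(2) q by (simp add: w_def field_simps)
    then have "w * y * w ^ q < Suc y * w ^ q" using w by (intro mult_strict_right_mono) auto
    also have "\<dots> \<le> w * (q * w ^ y)" using that(1) by (simp add: mult_ac)
    finally have "w * (y * w ^ q) < w * (q * w ^ y)" by (simp add: mult_ac)
    then show ?thesis using w by simp
  qed
  have ge: "real x * w ^ q \<le> q * w ^ x" if "q \<le> x" for x
    using that by (induction x rule: dec_induct) (use up in auto)
  have le: "real x * w ^ q \<le> q * w ^ x" if "x \<le> q" for x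
    using that by (induction x rule: inc_induct) (use down in \<open>auto intro: less_imp_le\<close>)
  show all: "real x * w ^ q \<le> q * w ^ x" using ge[of x] le[of x] by linarith
  assume "x \<noteq> q" "x \<noteq> Suc q"
  then consider "x < q" | y where "x = Suc y" "q < y" by (cases x) force+
  then show "real x * w ^ q < q * w ^ x"
  proof cases
    case 1
    then show ?thesis using down[of x] le[of "Suc x"] by auto
  next
    case 2
    then show ?thesis using up'[of y] ge[of y] by auto
  qed
qed

lemma sum_card_turan_part: "0 < r \<Longrightarrow> (\<Sum>j<r. card (turan_part r n j)) = n"
proof -
  assume r: "0 < r"
  have "card (\<Union>j<r. turan_part r n j) = (\<Sum>j<r. card (turan_part r n j))"
    by (intro card_UN_disjoint) (auto simp: turan_part_def)
  then show ?thesis using turan_part_Union[OF r, of n] by simp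
qed

lemma prod_le_turan_number:
  fixes a :: "nat \<Rightarrow> nat"
  assumes r: "0 < r" "r \<le> n" and sum: "(\<Sum>j<r. a j) = n"
  shows "(\<Prod>j<r. a j) \<le> turan_number r n"
    and "(\<Prod>j<r. a j) = turan_number r n \<Longrightarrow> j < r \<Longrightarrow> a j = n div r \<or> a j = Suc (n div r)"
proof -
  define q where "q = n div r"
  define w where "w = 1 + 1 / real q"
  have q: "0 < q" using r by (simp add: q_def div_greater_zero_iff)
  then have w: "w > 0" by (simp add: w_def add_pos_nonneg)
  have weight: "(\<Prod>j<r. real q * w ^ b j) = real q ^ r * w ^ n" if "(\<Sum>j<r. b j) = n" for b
    unfolding that[symmetric] power_sum by (simp add: prod.distrib)
  \<comment> \<open>All parts of the Turan hypergraph have size \<open>q\<close> or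
    \<open>q + 1\<close>, the equality cases, so its edge number is evaluated exactly.\<close>
  have t: "real (turan_number r n) * (w ^ q) ^ r = real q ^ r * w ^ n"
  proof -
    have "(\<Prod>j<r. real (card (turan_part r n j)) * w ^ q) = (\<Prod>j<r. real q * w ^ card (turan_part r n j))"
    proof (rule prod.cong[OF refl])
      fix j assume "j \<in> {..<r}"
      then have "card (turan_part r n j) = q \<or> card (turan_part r n j) = Suc q"
        by (auto simp: card_turan_part q_def)
      moreover have "real (Suc q) * w ^ q = q * w ^ Suc q" using q by (simp add: w_def field_simps)
      ultimately show "real (card (turan_part r n j)) * w ^ q = real q * w ^ card (turan_part r n j)" by auto
    qed
    then show ?thesis unfolding weight[OF sum_card_turan_part[OF r(1)]]
      by (simp add: turan_number_eq_prod[OF r(1)] prod.distrib)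
  qed
  have le: "real (a j) * w ^ q \<le> q * w ^ a j" for j using weighted_power_le(1)[OF q] by (simp add: w_def)
  have wpos: "(w ^ q) ^ r > 0" using w by simp
  have "(\<Prod>j<r. real (a j) * w ^ q) \<le> (\<Prod>j<r. real q * w ^ a j)" using le w by (intro prod_mono) auto
  then have "real (\<Prod>j<r. a j) * (w ^ q) ^ r \<le> real (turan_number r n) * (w ^ q) ^ r"
    unfolding weight[OF sum] t[symmetric] by (simp add: prod.distrib)
  then have "real (\<Prod>j<r. a j) \<le> real (turan_number r n)" using wpos by (rule mult_right_le_imp_le)
  then show "(\<Prod>j<r. a j) \<le> turan_number r n" by (simp only: of_nat_le_iff)
  assume eq: "(\<Prod>j<r. a j) = turan_number r n" and j: "j < r"
  show "a j = n div r \<or> a j = Suc (n div r)"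
  proof (rule ccontr)
    assume "\<not> ?thesis"
    then have lt: "real (a j) * w ^ q < q * w ^ a j" using weighted_power_le(2)[OF q] by (simp add: w_def q_def)
    have "(\<Prod>i<r. real (a i) * w ^ q) = real (a j) * w ^ q * (\<Prod>i\<in>{..<r} - {j}. real (a i) * w ^ q)"
      using j by (intro prod.remove) auto
    also have "\<dots> \<le> real (a j) * w ^ q * (\<Prod>i\<in>{..<r} - {j}. real q * w ^ a i)"
      using le w by (intro mult_left_mono prod_mono) auto
    also have "\<dots> < q * w ^ a j * (\<Prod>i\<in>{..<r} - {j}. real q * w ^ a i)"
      using lt q w by (intro mult_strict_right_mono prod_pos) auto
    also have "\<dots> = (\<Prod>i<r. real q * w ^ a i)" using j by (intro prod.remove[symmetric]) auto
    finally have "real (\<Prod>j<r. a j) * (w ^ q) ^ r < real (turan_number r n) * (w ^ q) ^ r"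
      unfolding weight[OF sum] t[symmetric] by (simp add: prod.distrib)
    then show False using eq by simp
  qed
qed

text \<open>A rainbow edge with \<open>r\<close> colours uses all of them, so some vertex of the
  first edge of a tent has the colour of the apex \<open>2 * r - 1\<close>; but every vertex of that
  edge lies in a second edge together with the apex.\<close>

lemma family_free_of_colouring:
  fixes V :: "'a set"
  assumes r: "2 \<le> r" "k < r" and edge: "\<And>e. e \<in> E \<Longrightarrow> e \<subseteq> V \<and> card e = r"
    and c: "\<And>v. v \<in> V \<Longrightarrow> c v < r" "\<And>e. e \<in> E \<Longrightarrow> inj_on c e"
  shows "family_free (tent_family r k) (V, E)"
  unfolding family_free_def tent_family_def
proof (intro ballI notI)
  fix F assume "F \<in> tent r ` {1..k}" and copy: "contains_copy (V, E) F"
  then obtain i where i: "F = tent r i" "1 \<le> i" "i \<le> k" by auto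
  obtain f where f: "inj_on f {1..2 * r - 1}" "f ` {1..2 * r - 1} \<subseteq> V"
    and e1: "f ` {1..r} \<in> E"
    and e2: "f ` ({1..i} \<union> {r + 1..2 * r - i - 1} \<union> {2 * r - 1}) \<in> E"
    and e3: "f ` ({i + 1..r} \<union> {2 * r - i..2 * r - 1}) \<in> E"
    using copy unfolding contains_copy_def i tent_def by auto
  let ?v = "2 * r - 1"
  have "c ` (f ` {1..r}) = {..<r}"
  proof (rule card_subset_eq)
    have "f ` {1..r} \<subseteq> V" using edge[OF e1] by blast
    then show "c ` f ` {1..r} \<subseteq> {..<r}" using c(1) by auto
    show "card (c ` f ` {1..r}) = card {..<r}" using card_image[OF c(2)[OF e1]] edge[OF e1] by simp
  qed simp
  moreover have "c (f ?v) < r" using f(2) r by (intro c(1)) auto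
  ultimately obtain x where x: "x \<in> {1..r}" "c (f x) = c (f ?v)" by (metis imageE lessThan_iff)
  have "f x = f ?v"
  proof (cases "x \<le> i")
    case True
    then show ?thesis using x by (intro inj_onD[OF c(2)[OF e2] x(2)]) auto
  next
    case False
    then show ?thesis using x r i by (intro inj_onD[OF c(2)[OF e3] x(2)]) auto
  qed
  then have "x = ?v" using x r by (intro inj_onD[OF f(1)]) auto
  then show False using x r by auto
qed

lemma turan_hypergraph_mem_free_hypergraphs:
  assumes "2 \<le> r" "k < r"
  shows "turan_hypergraph r n \<in> free_hypergraphs r n (tent_family r k)"
proof -
  have "inj_on (\<lambda>v. v mod r) e" if e: "e \<in> hedges (turan_hypergraph r n)" for e
  proof (rule inj_onI)
    fix u v assume uv: "u \<in> e" "v \<in> e" "u mod r = v mod r"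
    have "u \<in> e \<inter> turan_part r n (u mod r)" "v \<in> e \<inter> turan_part r n (u mod r)"
      using e uv by (auto simp: turan_hypergraph_def turan_part_def)
    moreover have "card (e \<inter> turan_part r n (u mod r)) = 1" using e assms by (simp add: turan_hypergraph_def)
    ultimately show "u = v" by (metis card_1_singletonE singletonD)
  qed
  then have "family_free (tent_family r k) ({..<n}, hedges (turan_hypergraph r n))"
    using assms by (intro family_free_of_colouring[where c = "\<lambda>v. v mod r"]) (auto simp: turan_hypergraph_def)
  then show ?thesis by (auto simp: free_hypergraphs_def uniform_hypergraph_def turan_hypergraph_def)
qed

section \<open>Comparison of rainbow-coloured hypergraphs with the Turan hypergraph\<close>

lemma coloured_edges_subset_transversals:
  assumes "finite V" "\<And>e. e \<in> E \<Longrightarrow> e \<subseteq> V \<and> card e = r"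
    and c: "\<forall>v\<in>V. c v < r" "\<forall>e\<in>E. inj_on c e"
  shows "E \<subseteq> transversals (\<lambda>j. {v\<in>V. c v = j}) {..<r}"
proof
  fix e assume e: "e \<in> E"
  have fin: "finite e" using assms(1,2) e finite_subset by blast
  show "e \<in> transversals (\<lambda>j. {v\<in>V. c v = j}) {..<r}"
  proof (rule transversal_of_card_le_one)
    show "e \<subseteq> (\<Union>j<r. {v\<in>V. c v = j})" using assms(2)[OF e] c(1) by auto
    show "card (e \<inter> {v\<in>V. c v = j}) \<le> 1" for j
    proof -
      have "\<forall>x\<in>e \<inter> {v\<in>V. c v = j}. \<forall>y\<in>e \<inter> {v\<in>V. c v = j}. x = y"
        using c(2) e by (auto dest: inj_onD)
      then show ?thesis using fin by (simp add: card_le_Suc0_iff_eq)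
    qed
  qed (use assms(2)[OF e] fin in \<open>auto simp: disjoint_family_on_def\<close>)
qed

lemma image_transversals:
  assumes f: "bij_betw f (\<Union>i\<in>I. P i) (\<Union>i\<in>I. Q i)" and im: "\<And>i. i \<in> I \<Longrightarrow> f ` P i = Q i"
  shows "(\<lambda>X. f ` X) ` transversals P I = transversals Q I"
proof -
  have inj: "inj_on f (\<Union>i\<in>I. P i)" using f by (simp add: bij_betw_def)
  have int: "f ` X \<inter> Q i = f ` (X \<inter> P i)" if "X \<subseteq> (\<Union>i\<in>I. P i)" "i \<in> I" for X i
  proof -
    have "P i \<subseteq> (\<Union>i\<in>I. P i)" using that by auto
    then show ?thesis unfolding im[OF that(2), symmetric] using inj_on_image_Int[OF inj that(1)] by simp
  qed
  have card: "card (f ` X \<inter> Q i) = card (X \<inter> P i)" if "X \<subseteq> (\<Union>i\<in>I. P i)" "i \<in> I" for X i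
    unfolding int[OF that] using inj that(1) by (intro card_image) (auto intro: inj_on_subset)
  show ?thesis
  proof (intro set_eqI iffI)
    fix Y assume "Y \<in> (\<lambda>X. f ` X) ` transversals P I"
    then obtain X where X: "X \<subseteq> (\<Union>i\<in>I. P i)" "\<forall>i\<in>I. card (X \<inter> P i) = 1" "Y = f ` X"
      by (auto simp: transversals_def)
    then have "Y \<subseteq> (\<Union>i\<in>I. Q i)"
      using f image_mono[OF X(1), of f] by (simp add: bij_betw_def)
    then show "Y \<in> transversals Q I" using X card[OF X(1)] by (auto simp: transversals_def)
  next
    fix Y assume Y: "Y \<in> transversals Q I"
    define X where "X = {x \<in> (\<Union>i\<in>I. P i). f x \<in> Y}"
    have "Y \<subseteq> f ` (\<Union>i\<in>I. P i)" using Y f by (auto simp: transversals_def bij_betw_def)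
    then have fX: "f ` X = Y" unfolding X_def by blast
    have X: "X \<subseteq> (\<Union>i\<in>I. P i)" by (auto simp: X_def)
    then have "X \<in> transversals P I" using card[OF X] Y unfolding fX by (simp add: transversals_def)
    then show "Y \<in> (\<lambda>X. f ` X) ` transversals P I" using fX by blast
  qed
qed

text \<open>All edges are transversals of the colour classes. Equality forces every transversal to
  be an edge and the classes to be balanced; the isomorphism then only has to match classes of equal
  size.\<close>

lemma extremal_coloured:
  fixes V :: "'a set"
  assumes r: "2 \<le> r" "r \<le> card V" and V: "finite V" and edge: "\<And>e. e \<in> E \<Longrightarrow> e \<subseteq> V \<and> card e = r"
    and c: "\<forall>v\<in>V. c v < r" "\<forall>e\<in>E. inj_on c e"
  shows "card E \<le> turan_number r (card V)"
    and "card E = turan_number r (card V) \<Longrightarrow> hypergraph_iso (V, E) (turan_hypergraph r (card V))"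
proof -
  define n where "n = card V"
  define P where "P j = {v\<in>V. c v = j}" for j
  have finP: "finite (P j)" for j using V by (simp add: P_def)
  have disj: "disjoint_family_on P {..<r}" by (auto simp: disjoint_family_on_def P_def)
  have UP: "(\<Union>j<r. P j) = V" using c(1) by (auto simp: P_def)
  have sum: "(\<Sum>j<r. card (P j)) = n"
    unfolding n_def UP[symmetric] using finP disj by (subst card_UN_disjoint) (auto simp: disjoint_family_on_def)
  have E: "E \<subseteq> transversals P {..<r}"
    unfolding P_def by (rule coloured_edges_subset_transversals[OF V edge c])
  have finT: "finite (transversals P {..<r})"
    using UP by (intro finite_edges[OF V]) (auto simp: transversals_def)
  have cT: "card (transversals P {..<r}) = (\<Prod>j<r. card (P j))" by (rule card_transversals[OF _ disj]) simp
  have prod: "(\<Prod>j<r. card (P j)) \<le> turan_number r n"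
    using r sum by (intro prod_le_turan_number(1)) (auto simp: n_def)
  have cE: "card E \<le> (\<Prod>j<r. card (P j))" using card_mono[OF finT E] cT by simp
  then show "card E \<le> turan_number r (card V)" using prod by (simp add: n_def)
  assume "card E = turan_number r (card V)"
  then have eq: "card E = turan_number r n" by (simp add: n_def)
  then have prod_eq: "(\<Prod>j<r. card (P j)) = turan_number r n" using cE prod by simp
  then have ET: "E = transversals P {..<r}" using eq cT by (intro card_subset_eq[OF finT E]) simp
  define q where "q = n div r"
  have bal: "card (P j) = q \<or> card (P j) = Suc q" if "j < r" for j
    using prod_le_turan_number(2)[of r n "\<lambda>j. card (P j)"] r sum prod_eq that by (simp add: q_def n_def)
  \<comment> \<open>The larger classes. In the Turan hypergraph these are the residues below
    \<open>n mod r\<close>, so \<open>\<pi>\<close> renumbers the classes accordingly.\<close>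
  define J where "J = {j\<in>{..<r}. card (P j) = Suc q}"
  have "card J = n mod r"
  proof -
    have "n = (\<Sum>j<r. q + (if j \<in> J then 1 else 0))"
      unfolding sum[symmetric] using bal by (intro sum.cong) (auto simp: J_def)
    also have "\<dots> = r * q + card J"
      by (simp add: sum.distrib sum.If_cases J_def Int_def conj_ac)
    finally show ?thesis unfolding q_def using mult_div_mod_eq[of r n] by linarith
  qed
  then have "card J = card {..<n mod r}" by simp
  moreover have "n mod r < r" using r by simp
  then have "J \<subseteq> {..<r}" "{..<n mod r} \<subseteq> {..<r}" by (auto simp: J_def)
  ultimately obtain \<pi> where \<pi>: "\<pi> permutes {..<r}" "\<pi> ` J = {..<n mod r}"
    using permutes_image_eq_exists[of "{..<r}" J "{..<n mod r}"] by auto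
  define Q where "Q j = turan_part r n (\<pi> j)" for j
  have cQ: "card (P j) = card (Q j)" if j: "j < r" for j
  proof -
    have "\<pi> j < r" using permutes_in_image[OF \<pi>(1)] j by auto
    moreover have "\<pi> j < n mod r \<longleftrightarrow> j \<in> J"
      using \<pi>(2) permutes_inj[OF \<pi>(1)] by (metis inj_image_mem_iff lessThan_iff)
    ultimately show ?thesis using bal[OF j] j by (auto simp: Q_def card_turan_part q_def J_def)
  qed
  have "\<exists>g. bij_betw g (P j) (Q j)" if "j < r" for j
    using cQ[OF that] finP by (intro finite_same_card_bij) (auto simp: Q_def turan_part_def)
  then obtain g where g: "\<And>j. j < r \<Longrightarrow> bij_betw (g j) (P j) (Q j)" by metis
  define f where "f v = g (c v) v" for v
  have f: "bij_betw f (P j) (Q j)" if "j < r" for j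
    using g[OF that] by (subst bij_betw_cong[of _ f "g j"]) (auto simp: f_def P_def)
  have disjQ: "disjoint_family_on Q {..<r}"
    using permutes_inj[OF \<pi>(1)] by (auto simp: disjoint_family_on_def Q_def turan_part_def inj_def)
  have bij: "bij_betw f (\<Union>j<r. P j) (\<Union>j<r. Q j)"
    using f by (intro bij_betw_UNION_disjoint[OF disjQ]) auto
  have tr: "transversals Q {..<r} = transversals (turan_part r n) {..<r}" and UQ: "(\<Union>j<r. Q j) = (\<Union>j<r. turan_part r n j)"
  proof -
    have im: "\<pi> ` {..<r} = {..<r}" by (rule permutes_image[OF \<pi>(1)])
    show "(\<Union>j<r. Q j) = (\<Union>j<r. turan_part r n j)" by (subst (2) im[symmetric]) (simp add: Q_def)
    then show "transversals Q {..<r} = transversals (turan_part r n) {..<r}"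
      unfolding transversals_def Q_def by (subst (4) im[symmetric]) simp
  qed
  have "(\<lambda>X. f ` X) ` transversals P {..<r} = transversals Q {..<r}"
    using f by (intro image_transversals[OF bij]) (auto simp: bij_betw_def)
  then have "(\<lambda>X. f ` X) ` E = hedges (turan_hypergraph r n)"
    using r by (simp add: ET tr hedges_turan_hypergraph)
  moreover have "bij_betw f V (verts (turan_hypergraph r n))"
    using bij r unfolding UP UQ by (simp add: turan_part_Union turan_hypergraph_def)
  ultimately show "hypergraph_iso (V, E) (turan_hypergraph r (card V))"
    unfolding hypergraph_iso_def n_def[symmetric] by (intro exI[of _ f]) simp
qed

section \<open>Deleting vertices of small degree\<close>

lemma family_free_mono:
  "family_free \<F> (V, E) \<Longrightarrow> V' \<subseteq> V \<Longrightarrow> E' \<subseteq> E \<Longrightarrow> family_free \<F> (V', E')"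
  unfolding family_free_def contains_copy_def by (simp add: subset_iff) blast

text \<open>Deleting a vertex of too small degree increases the surplus over the Turan number by at least one, so
  this can happen only boundedly often before the minimum degree is large.\<close>

lemma card_edges_le_of_colouring:
  fixes K n0 r :: nat and \<F> :: "'b hypergraph set"
  assumes r: "2 \<le> r" "r \<le> n0"
    and col: "\<And>(V::'a set) E. finite V \<Longrightarrow> n0 \<le> card V \<Longrightarrow> (\<forall>e\<in>E. e \<subseteq> V \<and> card e = r) \<Longrightarrow>
      family_free \<F> (V, E) \<Longrightarrow> (\<forall>v\<in>V. ((card V - 1) div r) ^ (r - 1) \<le> card {e\<in>E. v \<in> e}) \<Longrightarrow>
      (\<exists>c. (\<forall>v\<in>V. c v < r) \<and> (\<forall>e\<in>E. inj_on c e))"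
    and V: "finite (V::'a set)" "n0 \<le> card V" "\<forall>e\<in>E. e \<subseteq> V \<and> card e = r" "family_free \<F> (V, E)"
  shows "card E \<le> turan_number r (card V) + (2 ^ n0 - (card V - n0))"
    and "n0 + 2 ^ n0 < card V \<Longrightarrow> card E = turan_number r (card V) \<Longrightarrow>
      hypergraph_iso (V, E) (turan_hypergraph r (card V))"
proof -
  \<comment> \<open>A vertex of small degree loses strictly fewer edges than the Turan number drops,
    whence the \<open>Suc\<close>. The surplus starts at \<open>2 ^ n0\<close>, the number of all
    subsets of \<open>n0\<close> vertices, and natural subtraction stops it at 0.\<close>
  have alternative: "(\<exists>c. (\<forall>v\<in>V. c v < r) \<and> (\<forall>e\<in>E. inj_on c e)) \<or>
      Suc (card E) \<le> turan_number r (Suc m) + (2 ^ n0 - (m - n0))"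
    if IH: "\<And>(V::'a set) E. card V = m \<Longrightarrow> finite V \<Longrightarrow> (\<forall>e\<in>E. e \<subseteq> V \<and> card e = r) \<Longrightarrow>
        family_free \<F> (V, E) \<Longrightarrow> card E \<le> turan_number r m + (2 ^ n0 - (m - n0))"
      and m: "n0 \<le> m" and V: "card V = Suc m" "finite V" "\<forall>e\<in>E. e \<subseteq> V \<and> card e = r" "family_free \<F> (V, E)"
    for m and V :: "'a set" and E
  proof (cases "\<forall>v\<in>V. ((card V - 1) div r) ^ (r - 1) \<le> card {e\<in>E. v \<in> e}")
    case True
    then show ?thesis using col[OF V(2) _ V(3,4)] V(1) m by simp
  next
    case False
    then obtain v where v: "v \<in> V" "card {e\<in>E. v \<in> e} < (m div r) ^ (r - 1)" using V(1) by force
    have finE: "finite E" using V(2,3) by (blast intro: finite_edges)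
    have "card {e\<in>E. v \<notin> e} \<le> turan_number r m + (2 ^ n0 - (m - n0))"
    proof (rule IH)
      show "card (V - {v}) = m" using v V by simp
      show "family_free \<F> (V - {v}, {e\<in>E. v \<notin> e})" using V(4) by (rule family_free_mono) auto
    qed (use V in auto)
    moreover have "card E = card {e\<in>E. v \<in> e} + card {e\<in>E. v \<notin> e}"
      using finE by (subst card_Un_disjoint[symmetric]) (auto intro!: arg_cong[where f=card])
    ultimately show ?thesis using v(2) turan_number_Suc_ge[of r m] r by linarith
  qed
  have bound: "card E \<le> turan_number r m + (2 ^ n0 - (m - n0))"
    if "n0 \<le> m" "card V = m" "finite V" "\<forall>e\<in>E. e \<subseteq> V \<and> card e = r" "family_free \<F> (V, E)"
    for m and V :: "'a set" and E
    using that
  proof (induction m arbitrary: V E rule: dec_induct)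
    case base
    have "E \<subseteq> Pow V" using base by auto
    then have "card E \<le> card (Pow V)" using base by (intro card_mono) auto
    then show ?case using base by (simp add: card_Pow)
  next
    case (step m)
    have "(\<exists>c. (\<forall>v\<in>V. c v < r) \<and> (\<forall>e\<in>E. inj_on c e)) \<or>
        Suc (card E) \<le> turan_number r (Suc m) + (2 ^ n0 - (m - n0))"
      by (rule alternative[OF step.IH step.hyps(1) step.prems])
    then show ?case
    proof (elim disjE exE conjE)
      fix c assume "\<forall>v\<in>V. c v < r" "\<forall>e\<in>E. inj_on c e"
      then have "card E \<le> turan_number r (card V)"
        using step r by (intro extremal_coloured(1)) auto
      then show ?thesis using step.prems(1) by simp
    qed (use step.hyps(1) in linarith)
  qed
  show "card E \<le> turan_number r (card V) + (2 ^ n0 - (card V - n0))"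
    using bound V by blast
  assume big: "n0 + 2 ^ n0 < card V" and eq: "card E = turan_number r (card V)"
  obtain m where m: "card V = Suc m" using big by (cases "card V") auto
  have "(\<exists>c. (\<forall>v\<in>V. c v < r) \<and> (\<forall>e\<in>E. inj_on c e)) \<or>
      Suc (card E) \<le> turan_number r (Suc m) + (2 ^ n0 - (m - n0))"
    using big m V by (intro alternative bound) auto
  \<comment> \<open>With no surplus left at \<open>m\<close> vertices, the second alternative would
    put \<open>card E\<close> strictly below the Turan number, so equality leaves only the
    colouring.\<close>
  moreover have "2 ^ n0 - (m - n0) = 0" using big m by simp
  ultimately obtain c where "\<forall>v\<in>V. c v < r" "\<forall>e\<in>E. inj_on c e" using eq m by auto
  then show "hypergraph_iso (V, E) (turan_hypergraph r (card V))"
    using V r eq by (intro extremal_coloured(2)) auto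
qed

text \<open>The crude bounds 2 and 3 on \<open>exp 1\<close> give \<open>k < r\<close> and
  \<open>r \<le> 3 * k\<close>; the sharp consequence \<open>r / k \<le> exp 1\<close> is what
  bounds the harmonic tail.\<close>

lemma ceiling_exp_facts:
  fixes r k :: nat
  assumes "4 \<le> r" "k = nat \<lceil>real r / exp 1\<rceil>"
  shows "1 \<le> k" "k < r" "r \<le> 3 * k" "(\<Sum>i=Suc k..r. 1 / real i) \<le> 1"
proof -
  have e: "2 \<le> exp (1::real)" "exp (1::real) \<le> 3" using exp_ge_add_one_self[of 1] exp_le by auto
  have pos: "0 < real r / exp 1" using assms by simp
  then have k: "real r / exp 1 \<le> k" "real k < real r / exp 1 + 1" unfolding assms(2) by linarith+
  show k1: "1 \<le> k" using pos k by linarith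
  have "real r / exp 1 \<le> real r / 2" using e by (intro divide_left_mono) auto
  then show kr: "k < r" using k(2) assms(1) by linarith
  have rk: "real r \<le> k * exp 1" using k(1) by (simp add: field_simps)
  also have "\<dots> \<le> real k * 3" using e by (intro mult_left_mono) auto
  finally show "r \<le> 3 * k" by linarith
  have "(\<Sum>i=Suc k..r. 1 / real i) \<le> ln (r / k)" using k1 kr by (intro harmonic_tail_le) auto
  also have "\<dots> \<le> ln (exp 1)" using rk k1 kr by (intro ln_mono) (auto simp: field_simps)
  finally show "(\<Sum>i=Suc k..r. 1 / real i) \<le> 1" by simp
qed

theorem theorem1p4:
  fixes r k :: nat
  assumes "r \<ge> 4"
    and "k = nat \<lceil>real r / exp 1\<rceil>"
  shows "\<forall>\<^sub>F n in sequentially.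
    ex_number r n (tent_family r k) = card (hedges (turan_hypergraph r n)) \<and>
    turan_hypergraph r n \<in> free_hypergraphs r n (tent_family r k) \<and>
    (\<forall>H \<in> free_hypergraphs r n (tent_family r k).
       card (hedges H) = card (hedges (turan_hypergraph r n)) \<longrightarrow>
       hypergraph_iso H (turan_hypergraph r n))"
proof -
  note k = ceiling_exp_facts[OF assms]
  have r: "2 \<le> r" using assms by simp
  obtain n1 where n1: "\<forall>(V::nat set) E. finite V \<longrightarrow> n1 \<le> card V \<longrightarrow> (\<forall>e\<in>E. e \<subseteq> V \<and> card e = r) \<longrightarrow>
    family_free (tent_family r k) (V, E) \<longrightarrow>
    (\<forall>v\<in>V. ((card V - 1) div r) ^ (r - 1) \<le> card {e\<in>E. v \<in> e}) \<longrightarrow>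
    (\<exists>c. (\<forall>v\<in>V. c v < r) \<and> (\<forall>e\<in>E. inj_on c e))"
    using colouring_of_min_degree[OF r k, where 'a=nat] by (rule exE)
  define n0 where "n0 = max n1 r"
  have r_le: "r \<le> n0" by (simp add: n0_def)
  have col: "\<exists>c. (\<forall>v\<in>V. c v < r) \<and> (\<forall>e\<in>E. inj_on c e)"
    if "finite V" "n0 \<le> card V" "\<forall>e\<in>E. e \<subseteq> V \<and> card e = r" "family_free (tent_family r k) (V, E)"
      "\<forall>v\<in>V. ((card V - 1) div r) ^ (r - 1) \<le> card {e\<in>E. v \<in> e}" for V :: "nat set" and E
    by (rule n1[THEN spec, THEN spec, THEN mp, THEN mp, THEN mp, THEN mp, THEN mp])
       (use that in \<open>auto simp: n0_def\<close>)
  show ?thesis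
  \<comment> \<open>From here on the surplus is exhausted already at \<open>n - 1\<close> vertices,
    as uniqueness requires.\<close>
  proof (rule eventually_sequentiallyI[of "n0 + 2 ^ n0 + 1"])
    fix n assume n: "n0 + 2 ^ n0 + 1 \<le> n"
    let ?\<F> = "tent_family r k"
    have mem: "turan_hypergraph r n \<in> free_hypergraphs r n ?\<F>"
      by (rule turan_hypergraph_mem_free_hypergraphs[OF r k(2)])
    have bound: "card E \<le> turan_number r n" and
      uniq: "card E = turan_number r n \<Longrightarrow> hypergraph_iso (V, E) (turan_hypergraph r n)"
      if "(V, E) \<in> free_hypergraphs r n ?\<F>" for V :: "nat set" and E
    proof -
      have V: "finite V" "card V = n" "\<forall>e\<in>E. e \<subseteq> V \<and> card e = r" "family_free ?\<F> (V, E)"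
        using that by (auto simp: free_hypergraphs_def uniform_hypergraph_def)
      have le: "n0 \<le> card V" using n V(2) by simp
      have "2 ^ n0 - (card V - n0) = 0" using n V(2) by simp
      moreover have "card E \<le> turan_number r (card V) + (2 ^ n0 - (card V - n0))"
        by (rule card_edges_le_of_colouring(1)[OF r r_le _ V(1) le V(3,4)]) (rule col; assumption)
      ultimately show "card E \<le> turan_number r n" using V(2) by simp
      assume "card E = turan_number r n"
      then have "card E = turan_number r (card V)" "n0 + 2 ^ n0 < card V" using V(2) n by auto
      then have "hypergraph_iso (V, E) (turan_hypergraph r (card V))"
        by (intro card_edges_le_of_colouring(2)[OF r r_le _ V(1) le V(3,4)]) (rule col; assumption)
      then show "hypergraph_iso (V, E) (turan_hypergraph r n)" using V(2) by simp
    qed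
    have "ex_number r n ?\<F> = turan_number r n"
      unfolding ex_number_def
      by (rule Max_eqI) (use finite_free_hypergraph_sizes bound mem in \<open>auto\<close>)
    then show "ex_number r n ?\<F> = turan_number r n \<and>
      turan_hypergraph r n \<in> free_hypergraphs r n ?\<F> \<and>
      (\<forall>H \<in> free_hypergraphs r n ?\<F>. card (hedges H) = turan_number r n \<longrightarrow>
         hypergraph_iso H (turan_hypergraph r n))"
      using mem uniq by auto
  qed
qed

end
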